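(* Let $u$ be the solution of the stochastic heat equation with additive noise on $[0,\infty)\times(0,\pi)$, $$\frac{\partial u}{\partial t}(t,x)=\Delta u(t,x)+\dot W(t,x),\qquad u(t,0)=u(t,\pi)=0,\qquad u(0,x)=0,$$ where $\dot W$ is a Gaussian space-time white noise on $[0,\infty)\times(0,\pi)$. Let $(\Delta_n)_{n\ge1}$ be a sequence of strictly positive numbers decreasing to $0$. Assume $r<\frac12$ and define $$\tau_n(r):=\begin{cases}\Delta_n^{1/2}&\text{if } r<-\frac12,\\ (\Delta_n|\log\Delta_n|)^{1/2}&\text{if } r=-\frac12,\\ \Delta_n^{\frac14-\frac r2}&\text{if } -\frac12<r<\frac12,\end{cases}$$ and, for an exponent $m>0$, $$V^{n,r}_{m}(u,t):=\Delta_n\sum_{i=1}^{[t/\Delta_n]}\left(\frac{\|u(i\Delta_n,\cdot)-u((i-1)\Delta_n,\cdot)\|_{H_r}}{\tau_n(r)}\right)^{m}.$$ If $p\ge1$ is an integer, then for every $q,T\in(0,\infty)$, $$\lim_{n\to\infty}\mathbb E\Big[\sup_{t\in[0,T]}\big|V^{n,r}_{2p}(u,t)-K(r,p)\,t\big|^q\Big]=0,$$ where $$K(r,p):=\begin{cases}2^pB_p\Big(\frac{(1-1)!}{2}\zeta(-2\cdot1\cdot r),\dots,\frac{(p-1)!}{2}\zeta(-2\cdot p\cdot r)\Big)&\text{if } r<-\frac12,\\ 2^{-p}&\text{if } r=-\frac12,\\ \Big(\frac{\Gamma(r+\frac12)}{2(\frac12-r)}\Big)^p&\text{if }-\frac1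2<r<\frac12.\end{cases}$$
   Context: On $D=(0,\pi)$, the Dirichlet Laplacian $-\Delta$ has eigenvalues $\lambda_k=k^2$ with orthonormal eigenfunctions $\phi_k(x)=\sqrt{2/\pi}\,\sin(kx)$, $k\ge1$. For $r\in\mathbb R$, $H_r$ is the Hilbert space of series $\Phi=\sum_{k\ge1}a_k(\Phi)\phi_k$ with $a_k(\Phi)\in\mathbb R$ and $\|\Phi\|_{H_r}:=(\sum_{k\ge1}\lambda_k^r a_k(\Phi)^2)^{1/2}<\infty$ (the completion of the finite linear combinations of the $\phi_k$ in this norm). The solution is the mild solution $u(t,x)=\int_0^t\int_0^\pi g(t-s;x,y)\,W(ds,dy)$ with $g(t;x,y)=\sum_{k\ge1}\phi_k(x)\phi_k(y)e^{-\lambda_kt}$ for $t>0$; equivalently $u(t,\cdot)=\sum_{k\ge1}a_k(t)\phi_k$ with $a_k(t)=\int_0^t\int_0^\pi e^{-\lambda_k(t-s)}\phi_k(y)\,W(ds,dy)$, viewed as a process with values in $H_r$ (for $r<\frac12$). $\zeta(z)=\sum_{k\ge1}k^{-z}$ for $z>1$ is the Riemann zeta function, $\Gamma(z)=\int_0^\infty y^{z-1}e^{-y}\,dy$, and $[x]$ denotes the integer part of $x$. $B_p$ is the complete Bell polynomial in $p$ variables: $$B_p(x_1,\dots,x_p)=\sum\frac{p!}{\prod_{\ell=1}^p(\ell!)^{r_\ell}r_\ell!}\prod_{\ell=1}^px_\ell^{r_\ell},$$ where the sum is over all $(r_1,\dots,r_p)\in\{0,1,2,\dots\}^p$ with $r_1+2r_2+\cdots+pr_p=p$.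 When $r=-\frac12$, only (large) $n$ with $\Delta_n<1$ are considered, so that $\tau_n(r)>0$. *)

theory Defs
  imports "HOL-Probability.Probability"
begin

section \<open>Dirichlet Laplacian on the interval from 0 to pi, and the spaces H_r\<close>

definition eigval :: "nat \<Rightarrow> real" where
  "eigval k = (real k)\<^sup>2"

definition eigfun :: "nat \<Rightarrow> real \<Rightarrow> real" where
  "eigfun k x = sqrt (2 / pi) * sin (real k * x)"

text \<open>
  An element \<open>\<Sum>k\<ge>1. a k * \<phi> k\<close> of \<open>H\<^sub>r\<close> is represented by its coefficient sequence \<open>a\<close>;
  for negative \<open>r\<close> it need not be a function on the interval. Only the entries \<open>a k\<close> with
  \<open>k \<ge> 1\<close> carry information, which is why the sums below run over \<open>Suc k\<close>.
\<close>

definition Hspace :: "real \<Rightarrow> (nat \<Rightarrow> real) set" where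
  "Hspace r = {a. summable (\<lambda>k. eigval (Suc k) powr r * (a (Suc k))\<^sup>2)}"

definition Hnorm :: "real \<Rightarrow> (nat \<Rightarrow> real) \<Rightarrow> real" where
  "Hnorm r a = sqrt (\<Sum>k. eigval (Suc k) powr r * (a (Suc k))\<^sup>2)"


section \<open>Space-time white noise and its Wiener integral\<close>

definition spacetime :: "(real \<times> real) measure" where
  "spacetime = restrict_space lborel ({0..} \<times> {0<..<pi})"

text \<open>The point mass at 0 counts as Gaussian; \<^const>\<open>normal_density\<close> does not cover variance 0.\<close>

definition centered_gaussian :: "'a measure \<Rightarrow> ('a \<Rightarrow> real) \<Rightarrow> bool" where
  "centered_gaussian M X \<longleftrightarrow>
     X \<in> borel_measurable M \<and>
     ((AE \<omega> in M. X \<omega> = 0) \<or> (\<exists>\<sigma>>0. distributed M lborel X (normal_density 0 \<sigma>)))"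

text \<open>
  A centered (jointly) Gaussian family indexed by the Borel sets of finite Lebesgue measure,
  with covariance \<open>E[W(A) W(B)] = |A \<inter> B|\<close>.
\<close>

definition space_time_white_noise ::
  "'a measure \<Rightarrow> ((real \<times> real) set \<Rightarrow> 'a \<Rightarrow> real) \<Rightarrow> bool" where
  "space_time_white_noise M W \<longleftrightarrow>
     (\<forall>F c. finite F \<and> F \<subseteq> fmeasurable spacetime \<longrightarrow>
        centered_gaussian M (\<lambda>\<omega>. \<Sum>A\<in>F. c A * W A \<omega>)) \<and>
     (\<forall>A\<in>fmeasurable spacetime. \<forall>B\<in>fmeasurable spacetime.
        (\<integral>\<omega>. W A \<omega> * W B \<omega> \<partial>M) = measure spacetime (A \<inter> B))"

text \<open>
  \<open>X\<close> is (a version of) \<open>\<integral> h dW\<close>, the \<open>L\<^sup>2\<close>-extension of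
  \<open>\<Sum> c A * indicator A \<mapsto> \<Sum> c A * W A\<close> from simple functions to
  square-integrable \<open>h\<close>. By the Ito isometry it is unique up to null sets.
\<close>

definition is_wiener_integral ::
  "'a measure \<Rightarrow> ((real \<times> real) set \<Rightarrow> 'a \<Rightarrow> real) \<Rightarrow> (real \<times> real \<Rightarrow> real) \<Rightarrow> ('a \<Rightarrow> real) \<Rightarrow> bool"
where
  "is_wiener_integral M W h X \<longleftrightarrow>
     h \<in> borel_measurable spacetime \<and> X \<in> borel_measurable M \<and>
     (\<exists>F c. (\<forall>n::nat. finite (F n) \<and> F n \<subseteq> fmeasurable spacetime) \<and>
        (\<lambda>n. \<integral>\<^sup>+z. ennreal ((h z - (\<Sum>A\<in>F n. c n A * indicator A z))\<^sup>2) \<partial>spacetime)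
           \<longlonglongrightarrow> 0 \<and>
        (\<lambda>n. \<integral>\<^sup>+\<omega>. ennreal ((X \<omega> - (\<Sum>A\<in>F n. c n A * W A \<omega>))\<^sup>2) \<partial>M)
           \<longlonglongrightarrow> 0)"


section \<open>The mild solution\<close>

definition mild_kernel :: "nat \<Rightarrow> real \<Rightarrow> real \<times> real \<Rightarrow> real" where
  "mild_kernel k t = (\<lambda>(s, y). indicator {0..t} s * exp (- eigval k * (t - s)) * eigfun k y)"

text \<open>\<open>u t \<omega> k\<close> is the coefficient \<open>a\<^sub>k(t)\<close> of the solution at the outcome \<open>\<omega>\<close>.\<close>

definition mild_solution ::
  "'a measure \<Rightarrow> ((real \<times> real) set \<Rightarrow> 'a \<Rightarrow> real) \<Rightarrow> real \<Rightarrow> (real \<Rightarrow> 'a \<Rightarrow> nat \<Rightarrow> real) \<Rightarrow> bool"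
where
  "mild_solution M W r u \<longleftrightarrow>
     (\<forall>t\<ge>0. \<forall>k\<ge>1. is_wiener_integral M W (mild_kernel k t) (\<lambda>\<omega>. u t \<omega> k)) \<and>
     (\<forall>t\<ge>0. AE \<omega> in M. u t \<omega> \<in> Hspace r)"


section \<open>Normalized power variations\<close>

text \<open>Relevant for \<open>r < 1/2\<close> only.\<close>

definition tau :: "real \<Rightarrow> real \<Rightarrow> real" where
  "tau r \<delta> =
     (if r < -1/2 then \<delta> powr (1/2)
      else if r = -1/2 then (\<delta> * \<bar>ln \<delta>\<bar>) powr (1/2)
      else \<delta> powr (1/4 - r/2))"

definition power_variation ::
  "real \<Rightarrow> real \<Rightarrow> real \<Rightarrow> (real \<Rightarrow> 'a \<Rightarrow> nat \<Rightarrow> real) \<Rightarrow> real \<Rightarrow> 'a \<Rightarrow> real" where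
  "power_variation \<delta> r m u t \<omega> =
     \<delta> * (\<Sum>i = 1..nat \<lfloor>t / \<delta>\<rfloor>.
       (Hnorm r (\<lambda>k. u (real i * \<delta>) \<omega> k - u ((real i - 1) * \<delta>) \<omega> k) / tau r \<delta>) powr m)"


section \<open>The limiting constant\<close>

definition bell_indices :: "nat \<Rightarrow> (nat \<Rightarrow> nat) set" where
  "bell_indices p = {s \<in> {1..p} \<rightarrow>\<^sub>E UNIV. (\<Sum>l = 1..p. l * s l) = p}"

lemma finite_bell_indices: "finite (bell_indices p)"
proof (rule finite_subset)
  show "bell_indices p \<subseteq> {1..p} \<rightarrow>\<^sub>E {0..p}"
  proof
    fix s assume s: "s \<in> bell_indices p"
    have "s l \<le> p" if l: "l \<in> {1..p}" for l
    proof -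
      have "s l \<le> l * s l" using l by simp
      also have "\<dots> \<le> (\<Sum>l = 1..p. l * s l)"
        by (rule member_le_sum[OF l]) auto
      also have "\<dots> = p" using s by (simp add: bell_indices_def)
      finally show ?thesis .
    qed
    then show "s \<in> {1..p} \<rightarrow>\<^sub>E {0..p}"
      using s by (auto simp: bell_indices_def PiE_iff)
  qed
  show "finite ({1..p} \<rightarrow>\<^sub>E {0..p})" by (intro finite_PiE) auto
qed

definition bell :: "nat \<Rightarrow> (nat \<Rightarrow> real) \<Rightarrow> real" where
  "bell p x =
     (\<Sum>s\<in>bell_indices p.
        fact p / (\<Prod>l = 1..p. fact l ^ s l * fact (s l)) * (\<Prod>l = 1..p. x l ^ s l))"

text \<open>Used for \<open>z > 1\<close> only.\<close>

definition real_zeta :: "real \<Rightarrow> real" where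
  "real_zeta z = (\<Sum>k. real (Suc k) powr (- z))"

definition limit_const :: "real \<Rightarrow> nat \<Rightarrow> real" where
  "limit_const r p =
     (if r < -1/2 then 2 ^ p * bell p (\<lambda>l. fact (l - 1) / 2 * real_zeta (- 2 * real l * r))
      else if r = -1/2 then 1 / 2 ^ p
      else (Gamma (r + 1/2) / (2 * (1/2 - r))) ^ p)"

end

theory Submission
  imports Defs
begin

text \<open>
  By the Ito isometry the coefficients of \<open>u\<close> form a centered Gaussian family whose covariance is
  explicit: coefficients with different indices are uncorrelated, and each is an Ornstein-Uhlenbeck
  process started at 0. Only moments of linear combinations enter, so neither independence nor
  path regularity is needed.

  For \<open>r \<ge> -1/2\<close> the normalized squared norm of one increment concentrates: its variance vanishes
  because no single mode contributes, and its mean converges, by a Riemann sum for \<open>r > -1/2\<close> and by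
  harmonic sums for \<open>r = -1/2\<close>. For \<open>r < -1/2\<close> finitely many modes dominate; the increment of mode
  \<open>k\<close> is replaced by the innovation \<open>a (t + \<delta>) - exp (- \<lambda> * \<delta>) * a t\<close>, and since the innovations form
  an orthogonal array a law of large numbers applies. Its limit is a moment of a weighted sum of
  squared standard Gaussians, whose cumulants give the Bell polynomial.

  Uniform moment bounds improve convergence in mean at fixed times to all \<open>q\<close>, and monotonicity in
  time gives the supremum.
\<close>


section \<open>Square integrable functions and convergence in mean square\<close>

text \<open>The regimes differ in where the expected squared norm of an increment has its mass. For
  \<open>r < -1/2\<close> mode \<open>k\<close> contributes about
  \<open>\<delta> * lam k powr r\<close>, a summable weight, so the randomness of single modes
  survives in the limit. For \<open>r > -1/2\<close> the modes of order
  \<open>1 / sqrt \<delta>\<close> dominate, and at \<open>r = -1/2\<close> all modes up to that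
  order contribute a harmonic sum, whence the logarithm. The common obstacle is that comparisons of
  squared norms are available only in mean, while their powers of order \<open>p\<close> are needed.
  Each comparison is therefore cut off at a level \<open>L\<close>, and the excess is paid for by
  moments of order \<open>p + 1\<close>, bounded uniformly in the step. \<open>L\<close>, and for
  \<open>r < -1/2\<close> the number \<open>K\<close> of retained modes, are fixed before the step
  tends to 0. Cumulants enter through the series of \<open>(1 - 2 * v * x) powr (-1/2)\<close>,
  which generates the moments of \<open>v\<close> times a squared standard Gaussian: its logarithmic
  derivative is geometric. The solution is given at each time only up to null sets; this suffices,
  since for a fixed step countably many increments determine the whole variation.\<close>

lemma abs_mult_le_sum_squares: "\<bar>x * y\<bar> \<le> x\<^sup>2 + (y::real)\<^sup>2"
proof -
  have "0 \<le> (\<bar>x\<bar> - \<bar>y\<bar>)\<^sup>2" by simp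
  then have "2 * (\<bar>x\<bar> * \<bar>y\<bar>) \<le> x\<^sup>2 + y\<^sup>2"
    by (simp add: power2_diff)
  moreover have "0 \<le> \<bar>x\<bar> * \<bar>y\<bar>" by simp
  ultimately have "\<bar>x\<bar> * \<bar>y\<bar> \<le> x\<^sup>2 + y\<^sup>2" by linarith
  then show ?thesis by (simp add: abs_mult)
qed

lemma power2_add_le: "(x + y)\<^sup>2 \<le> 2 * x\<^sup>2 + 2 * (y::real)\<^sup>2"
proof -
  have "0 \<le> (x - y)\<^sup>2" by simp
  then show ?thesis by (simp add: power2_diff power2_sum)
qed

lemma integrable_mult_of_squares:
  fixes f g :: "'a \<Rightarrow> real"
  assumes [measurable]: "f \<in> borel_measurable M" "g \<in> borel_measurable M"
    and "integrable M (\<lambda>x. (f x)\<^sup>2)" "integrable M (\<lambda>x. (g x)\<^sup>2)"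
  shows "integrable M (\<lambda>x. f x * g x)"
proof (rule Bochner_Integration.integrable_bound)
  show "integrable M (\<lambda>x. (f x)\<^sup>2 + (g x)\<^sup>2)"
    using assms by simp
  show "AE x in M. norm (f x * g x) \<le> norm ((f x)\<^sup>2 + (g x)\<^sup>2)"
    using abs_mult_le_sum_squares by (intro AE_I2) simp
qed simp

lemma integrable_power2_add:
  fixes f g :: "'a \<Rightarrow> real"
  assumes [measurable]: "f \<in> borel_measurable M" "g \<in> borel_measurable M"
    and "integrable M (\<lambda>x. (f x)\<^sup>2)" "integrable M (\<lambda>x. (g x)\<^sup>2)"
  shows "integrable M (\<lambda>x. (f x + g x)\<^sup>2)"
  using assms integrable_mult_of_squares[OF assms]
  by (simp add: power2_sum mult.assoc)

lemma Cauchy_Schwarz_integral: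
  fixes f g :: "'a \<Rightarrow> real"
  assumes [measurable]: "f \<in> borel_measurable M" "g \<in> borel_measurable M"
    and f2: "integrable M (\<lambda>x. (f x)\<^sup>2)" and g2: "integrable M (\<lambda>x. (g x)\<^sup>2)"
  shows "(\<integral>x. \<bar>f x * g x\<bar> \<partial>M) \<le> sqrt ((\<integral>x. (f x)\<^sup>2 \<partial>M) * (\<integral>x. (g x)\<^sup>2 \<partial>M))"
proof -
  have int: "integrable M (\<lambda>x. \<bar>f x * g x\<bar>)"
    using integrable_mult_of_squares[OF assms] by (rule integrable_abs)
  have "ennreal ((\<integral>x. \<bar>f x * g x\<bar> \<partial>M)\<^sup>2) = (\<integral>\<^sup>+x. ennreal \<bar>f x\<bar> * ennreal \<bar>g x\<bar> \<partial>M)\<^sup>2"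
    using int by (simp add: ennreal_power[symmetric] nn_integral_eq_integral[symmetric]
        ennreal_mult[symmetric] abs_mult)
  also have "\<dots> \<le> (\<integral>\<^sup>+x. (ennreal \<bar>f x\<bar>)\<^sup>2 \<partial>M) * (\<integral>\<^sup>+x. (ennreal \<bar>g x\<bar>)\<^sup>2 \<partial>M)"
    by (rule Cauchy_Schwarz_nn_integral) auto
  also have "\<dots> = ennreal ((\<integral>x. (f x)\<^sup>2 \<partial>M) * (\<integral>x. (g x)\<^sup>2 \<partial>M))"
    using f2 g2 by (simp add: ennreal_power nn_integral_eq_integral ennreal_mult)
  finally have "(\<integral>x. \<bar>f x * g x\<bar> \<partial>M)\<^sup>2 \<le> (\<integral>x. (f x)\<^sup>2 \<partial>M) * (\<integral>x. (g x)\<^sup>2 \<partial>M)"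
    by (simp add: ennreal_le_iff)
  then show ?thesis by (rule real_le_rsqrt)
qed

lemma (in prob_space) expectation_abs_le_sqrt:
  fixes f :: "'a \<Rightarrow> real"
  assumes [measurable]: "f \<in> borel_measurable M" and "integrable M (\<lambda>x. (f x)\<^sup>2)"
  shows "expectation (\<lambda>x. \<bar>f x\<bar>) \<le> sqrt (expectation (\<lambda>x. (f x)\<^sup>2))"
  using Cauchy_Schwarz_integral[of f M "\<lambda>_. 1"] assms by (simp add: prob_space)

text \<open>One approximant at finite distance already makes \<open>f\<close> square integrable. The
  norms converge because
  \<open>fn\<^sup>2 - f\<^sup>2 = (f - fn)\<^sup>2 - 2 * f * (f - fn)\<close>, and the integral of
  the right side is controlled by Cauchy-Schwarz. Distances are taken in \<open>ennreal\<close>, as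
  in the definition of the Wiener integral.\<close>

lemma mean_square_limit:
  fixes f :: "'a \<Rightarrow> real"
  assumes [measurable]: "f \<in> borel_measurable M" "\<And>n. fn n \<in> borel_measurable M"
    and fn2: "\<And>n. integrable M (\<lambda>x. (fn n x)\<^sup>2)"
    and lim: "(\<lambda>n. \<integral>\<^sup>+x. ennreal ((f x - fn n x)\<^sup>2) \<partial>M) \<longlonglongrightarrow> 0"
  shows mean_square_limit_integrable: "integrable M (\<lambda>x. (f x)\<^sup>2)"
    and mean_square_limit_diff: "(\<lambda>n. \<integral>x. (f x - fn n x)\<^sup>2 \<partial>M) \<longlonglongrightarrow> 0"
    and mean_square_limit_norm: "(\<lambda>n. \<integral>x. (fn n x)\<^sup>2 \<partial>M) \<longlonglongrightarrow> (\<integral>x. (f x)\<^sup>2 \<partial>M)"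
proof -
  have "eventually (\<lambda>n. (\<integral>\<^sup>+x. ennreal ((f x - fn n x)\<^sup>2) \<partial>M) < 1) sequentially"
    using lim by (rule order_tendstoD) simp
  then obtain n0 where "(\<integral>\<^sup>+x. ennreal ((f x - fn n0 x)\<^sup>2) \<partial>M) < 1"
    by (auto simp: eventually_sequentially)
  then have "integrable M (\<lambda>x. (f x - fn n0 x)\<^sup>2)"
    by (intro integrableI_bounded) (auto intro: less_trans ennreal_one_less_top)
  from integrable_power2_add[OF _ _ this fn2[of n0]]
  show f2: "integrable M (\<lambda>x. (f x)\<^sup>2)" by simp
  have d2: "integrable M (\<lambda>x. (f x - fn n x)\<^sup>2)" for n
    using integrable_power2_add[of f M "\<lambda>x. - fn n x"] f2 fn2 by simp
  have "(\<lambda>n. ennreal (\<integral>x. (f x - fn n x)\<^sup>2 \<partial>M)) \<longlonglongrightarrow> ennreal 0"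
    using lim d2 by (simp add: nn_integral_eq_integral)
  then show d0: "(\<lambda>n. \<integral>x. (f x - fn n x)\<^sup>2 \<partial>M) \<longlonglongrightarrow> 0"
    by (subst (asm) tendsto_ennreal_iff) auto
  let ?e = "\<lambda>n. \<integral>x. (f x - fn n x)\<^sup>2 \<partial>M" and ?F = "\<integral>x. (f x)\<^sup>2 \<partial>M"
  have bd: "\<bar>(\<integral>x. (fn n x)\<^sup>2 \<partial>M) - ?F\<bar> \<le> ?e n + 2 * sqrt (?F * ?e n)" for n
  proof -
    have im: "integrable M (\<lambda>x. f x * (f x - fn n x))"
      using f2 d2 by (intro integrable_mult_of_squares) auto
    have "(\<integral>x. (fn n x)\<^sup>2 \<partial>M) = (\<integral>x. (f x)\<^sup>2 + ((f x - fn n x)\<^sup>2 - 2 * (f x * (f x - fn n x))) \<partial>M)"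
      by (intro Bochner_Integration.integral_cong) (auto simp: power2_eq_square algebra_simps)
    also have "\<dots> = ?F + (?e n - 2 * (\<integral>x. f x * (f x - fn n x) \<partial>M))"
      using f2 d2 im by simp
    finally have eq: "(\<integral>x. (fn n x)\<^sup>2 \<partial>M) - ?F = ?e n - 2 * (\<integral>x. f x * (f x - fn n x) \<partial>M)" by simp
    have "\<bar>\<integral>x. f x * (f x - fn n x) \<partial>M\<bar> \<le> (\<integral>x. \<bar>f x * (f x - fn n x)\<bar> \<partial>M)"
      by (rule integral_abs_bound)
    also have "\<dots> \<le> sqrt (?F * ?e n)"
      using f2 d2 by (intro Cauchy_Schwarz_integral) auto
    finally have "\<bar>\<integral>x. f x * (f x - fn n x) \<partial>M\<bar> \<le> sqrt (?F * ?e n)" .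
    moreover have "0 \<le> ?e n" by simp
    ultimately show ?thesis unfolding eq by linarith
  qed
  have "(\<lambda>n. ?e n + 2 * sqrt (?F * ?e n)) \<longlonglongrightarrow> 0 + 2 * sqrt (?F * 0)"
    by (intro tendsto_intros d0)
  then have "(\<lambda>n. ?e n + 2 * sqrt (?F * ?e n)) \<longlonglongrightarrow> 0" by simp
  then have "(\<lambda>n. (\<integral>x. (fn n x)\<^sup>2 \<partial>M) - ?F) \<longlonglongrightarrow> 0"
    by (rule Lim_null_comparison[rotated]) (simp add: bd)
  then show "(\<lambda>n. \<integral>x. (fn n x)\<^sup>2 \<partial>M) \<longlonglongrightarrow> ?F"
    by (rule LIM_zero_cancel)
qed


section \<open>Random variables with moments of all orders\<close>

text \<open>All powers are required at once so that the class is closed under products as well as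
  sums. Integrability of every polynomial in Gaussian variables is then a matter of structural
  rules.\<close>

definition has_moments :: "'a measure \<Rightarrow> ('a \<Rightarrow> real) \<Rightarrow> bool" where
  "has_moments M X \<longleftrightarrow> X \<in> borel_measurable M \<and> (\<forall>n. integrable M (\<lambda>\<omega>. X \<omega> ^ n))"

lemma has_moments_measurable: "has_moments M X \<Longrightarrow> X \<in> borel_measurable M"
  and has_moments_integrable_power: "has_moments M X \<Longrightarrow> integrable M (\<lambda>\<omega>. X \<omega> ^ n)"
  by (auto simp: has_moments_def)

lemma has_moments_integrable: "has_moments M X \<Longrightarrow> integrable M X"
  using has_moments_integrable_power[of M X 1] by simp

lemma (in finite_measure) has_moments_const: "has_moments M (\<lambda>_. c)"
  by (simp add: has_moments_def)

lemma has_moments_power: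
  assumes "has_moments M X"
  shows "has_moments M (\<lambda>\<omega>. X \<omega> ^ n)"
  using assms by (auto simp: has_moments_def power_mult[symmetric])

text \<open>\<open>X ^ n * Y ^ n\<close> is dominated by
  \<open>X ^ (2 * n) + Y ^ (2 * n)\<close>.\<close>

lemma has_moments_mult:
  assumes X: "has_moments M X" and Y: "has_moments M Y"
  shows "has_moments M (\<lambda>\<omega>. X \<omega> * Y \<omega>)"
proof -
  have [measurable]: "X \<in> borel_measurable M" "Y \<in> borel_measurable M"
    using X Y by (auto simp: has_moments_def)
  have "integrable M (\<lambda>\<omega>. X \<omega> ^ n * Y \<omega> ^ n)" for n
    using X Y
    by (intro integrable_mult_of_squares) (auto simp: has_moments_def power_mult[symmetric])
  then show ?thesis
    by (auto simp: has_moments_def power_mult_distrib)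
qed

lemma (in finite_measure) has_moments_cmult:
  "has_moments M X \<Longrightarrow> has_moments M (\<lambda>\<omega>. c * X \<omega>)"
  by (intro has_moments_mult has_moments_const)

lemma has_moments_add:
  assumes X: "has_moments M X" and Y: "has_moments M Y"
  shows "has_moments M (\<lambda>\<omega>. X \<omega> + Y \<omega>)"
proof -
  have [measurable]: "X \<in> borel_measurable M" "Y \<in> borel_measurable M"
    using X Y by (auto simp: has_moments_def)
  have "integrable M (\<lambda>\<omega>. (X \<omega> + Y \<omega>) ^ n)" for n
    unfolding binomial_ring
    by (intro Bochner_Integration.integrable_sum)
       (auto simp: mult.assoc
          intro!: has_moments_integrable has_moments_mult has_moments_power X Y)
  then show ?thesis
    by (auto simp: has_moments_def)
qed

lemma (in finite_measure) has_moments_sum: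
  "(\<And>i. i \<in> I \<Longrightarrow> has_moments M (X i)) \<Longrightarrow> has_moments M (\<lambda>\<omega>. \<Sum>i\<in>I. X i \<omega>)"
  by (induction I rule: infinite_finite_induct)
     (auto intro: has_moments_add has_moments_const)

lemma (in finite_measure) has_moments_prod:
  "(\<And>i. i \<in> I \<Longrightarrow> has_moments M (X i)) \<Longrightarrow> has_moments M (\<lambda>\<omega>. \<Prod>i\<in>I. X i \<omega>)"
  by (induction I rule: infinite_finite_induct)
     (auto intro: has_moments_mult has_moments_const)

lemma (in finite_measure) has_moments_diff:
  "has_moments M X \<Longrightarrow> has_moments M Y \<Longrightarrow> has_moments M (\<lambda>\<omega>. X \<omega> - Y \<omega>)"
  using has_moments_add[of M X "\<lambda>\<omega>. -1 * Y \<omega>"] has_moments_cmult[of Y "-1"] by simp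


section \<open>Centered Gaussian random variables\<close>

text \<open>The moments of the standard normal law; \<open>(2 * k)! / (2 ^ k * k!)\<close> is the
  double factorial of \<open>2 * k - 1\<close>.\<close>

definition gauss_moment :: "nat \<Rightarrow> real" where
  "gauss_moment n = (if even n then fact n / (2 ^ (n div 2) * fact (n div 2)) else 0)"

lemma gauss_moment_nonneg: "0 \<le> gauss_moment n"
  by (simp add: gauss_moment_def)

lemma gauss_moment_0 [simp]: "gauss_moment 0 = 1"
  by (simp add: gauss_moment_def)

lemma gauss_moment_even: "gauss_moment (2 * n) = fact (2 * n) / (2 ^ n * fact n)"
  by (simp add: gauss_moment_def)

lemma gauss_moment_2: "gauss_moment 2 = 1"
  by (simp add: gauss_moment_def fact_numeral)

context prob_space
begin

lemma centered_gaussian_cases: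
  assumes "centered_gaussian M X"
  obtains "AE \<omega> in M. X \<omega> = 0" "X \<in> borel_measurable M"
  | \<sigma> where "\<sigma> > 0" "distributed M lborel X (normal_density 0 \<sigma>)" "X \<in> borel_measurable M"
  using assms by (auto simp: centered_gaussian_def)

text \<open>In terms of the standard deviation the formula includes the point mass at 0: there both
  sides are \<open>0 ^ n\<close> up to the factor \<open>gauss_moment n\<close>, and
  \<open>0 ^ 0 = 1\<close> settles \<open>n = 0\<close>.\<close>

lemma
  assumes X: "centered_gaussian M X"
  shows centered_gaussian_has_moments: "has_moments M X"
    and centered_gaussian_moment:
      "expectation (\<lambda>\<omega>. X \<omega> ^ n) = gauss_moment n * sqrt (expectation (\<lambda>\<omega>. (X \<omega>)\<^sup>2)) ^ n"
proof -
  have "has_moments M X \<and>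
      expectation (\<lambda>\<omega>. X \<omega> ^ n) = gauss_moment n * sqrt (expectation (\<lambda>\<omega>. (X \<omega>)\<^sup>2)) ^ n"
    using X
  proof (cases rule: centered_gaussian_cases)
    case 1
    have *: "integrable M (\<lambda>\<omega>. X \<omega> ^ m) \<and> expectation (\<lambda>\<omega>. X \<omega> ^ m) = 0 ^ m" for m
    proof -
      have ae: "AE \<omega> in M. X \<omega> ^ m = 0 ^ m" using 1(1) by auto
      have "integrable M (\<lambda>\<omega>. X \<omega> ^ m) \<longleftrightarrow> integrable M (\<lambda>\<omega>. (0::real) ^ m)"
        using ae 1(2) by (intro integrable_cong_AE) auto
      moreover have "expectation (\<lambda>\<omega>. X \<omega> ^ m) = expectation (\<lambda>\<omega>. (0::real) ^ m)"
        using ae 1(2) by (intro integral_cong_AE) auto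
      ultimately show ?thesis by (simp add: prob_space)
    qed
    show ?thesis
      using * *[of 2] *[of n] 1(2) by (cases "n = 0") (auto simp: has_moments_def)
  next
    case (2 \<sigma>)
    note D = 2(2)
    have int: "integrable M (\<lambda>\<omega>. X \<omega> ^ m)" for m
      using distributed_integrable[OF D, of "\<lambda>x. x ^ m"] integrable_normal_moment[OF 2(1), of 0 m]
      by auto
    have ex: "expectation (\<lambda>\<omega>. X \<omega> ^ m) = gauss_moment m * \<sigma> ^ m" for m
    proof -
      have "expectation (\<lambda>\<omega>. X \<omega> ^ m) = (\<integral>x. normal_density 0 \<sigma> x * x ^ m \<partial>lborel)"
        using distributed_integral[OF D, of "\<lambda>x. x ^ m"] by auto
      also have "\<dots> = gauss_moment m * \<sigma> ^ m"
      proof (cases "even m")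
        case True
        then obtain k where k: "m = 2 * k" by auto
        have "(\<integral>x. normal_density 0 \<sigma> x * x ^ m \<partial>lborel) = fact (2 * k) / ((2 / \<sigma>\<^sup>2)^k * fact k)"
          using integral_normal_moment_even[OF 2(1), of 0 k] by (simp add: k)
        then show ?thesis
          unfolding k gauss_moment_even using 2(1) by (simp add: power_divide power_mult)
      next
        case False
        then obtain k where k: "m = 2 * k + 1" by (auto elim: oddE)
        show ?thesis
          using integral_normal_moment_odd[OF 2(1), of 0 k] by (simp add: k gauss_moment_def)
      qed
      finally show ?thesis .
    qed
    show ?thesis
      using ex[of n] ex[of 2] int 2 by (simp add: gauss_moment_2 has_moments_def)
  qed
  then show "has_moments M X"
    "expectation (\<lambda>\<omega>. X \<omega> ^ n) = gauss_moment n * sqrt (expectation (\<lambda>\<omega>. (X \<omega>)\<^sup>2)) ^ n"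
    by auto
qed

lemma char_centered_gaussian:
  assumes X: "centered_gaussian M X"
  shows "char (distr M borel X) s = complex_of_real (exp (- (s\<^sup>2 * expectation (\<lambda>\<omega>. (X \<omega>)\<^sup>2)) / 2))"
  using X
proof (cases rule: centered_gaussian_cases)
  case 1
  have [measurable]: "X \<in> borel_measurable M" by fact
  have "expectation (\<lambda>\<omega>. (X \<omega>)\<^sup>2) = expectation (\<lambda>\<omega>. 0)"
    using 1 by (intro integral_cong_AE) auto
  moreover have "(CLINT \<omega>|M. iexp (s * X \<omega>)) = (CLINT \<omega>|M. 1)"
    using 1 by (intro integral_cong_AE) auto
  ultimately show ?thesis
    by (simp add: char_def integral_distr prob_space)
next
  case (2 \<sigma>)
  have [measurable]: "X \<in> borel_measurable M" by fact
  have v: "expectation (\<lambda>\<omega>. (X \<omega>)\<^sup>2) = \<sigma>\<^sup>2"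
    using normal_distributed_variance[OF 2(1,2)] normal_distributed_expectation[OF 2(1,2)] by simp
  have "distributed M lborel (\<lambda>\<omega>. X \<omega> / \<sigma>) std_normal_density"
    using normal_standard_normal_convert[OF 2(1), of X 0] 2 by simp
  from distributed_distr_eq_density[OF this]
  have dd: "distr M borel (\<lambda>\<omega>. X \<omega> / \<sigma>) = std_normal_distribution"
    by (metis distr_cong sets_lborel)
  have "char (distr M borel X) s = (CLINT \<omega>|M. iexp (s * X \<omega>))"
    by (simp add: char_def integral_distr)
  also have "\<dots> = (CLINT \<omega>|M. iexp ((s * \<sigma>) * (X \<omega> / \<sigma>)))"
  proof -
    have "(\<lambda>\<omega>. s * X \<omega>) = (\<lambda>\<omega>. (s * \<sigma>) * (X \<omega> / \<sigma>))" using 2(1) by auto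
    then show ?thesis by (simp only: fun_eq_iff)
  qed
  also have "\<dots> = char (distr M borel (\<lambda>\<omega>. X \<omega> / \<sigma>)) (s * \<sigma>)"
  proof -
    have m1: "(\<lambda>\<omega>. X \<omega> / \<sigma>) \<in> measurable M borel" by measurable
    have m2: "(\<lambda>x. iexp (s * \<sigma> * x)) \<in> borel_measurable borel" by measurable
    show ?thesis unfolding char_def integral_distr[OF m1 m2] ..
  qed
  also have "\<dots> = complex_of_real (exp (- ((s * \<sigma>)^2) / 2))"
    unfolding dd char_std_normal_distribution ..
  finally show ?thesis by (simp add: v power_mult_distrib)
qed

text \<open>Levy's uniqueness theorem, applied after division by the standard deviation so that the
  target is the standard normal distribution.\<close>

lemma centered_gaussian_of_char:
  assumes [measurable]: "X \<in> borel_measurable M"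
    and v: "expectation (\<lambda>\<omega>. (X \<omega>)\<^sup>2) > 0"
    and ch: "\<And>s. char (distr M borel X) s = complex_of_real (exp (- (s\<^sup>2 * expectation (\<lambda>\<omega>. (X \<omega>)\<^sup>2)) / 2))"
  shows "centered_gaussian M X"
proof -
  define \<sigma> where "\<sigma> = sqrt (expectation (\<lambda>\<omega>. (X \<omega>)\<^sup>2))"
  have \<sigma>: "\<sigma> > 0" "\<sigma>\<^sup>2 = expectation (\<lambda>\<omega>. (X \<omega>)\<^sup>2)" using v by (auto simp: \<sigma>_def)
  have "char (distr M borel (\<lambda>\<omega>. X \<omega> / \<sigma>)) = char std_normal_distribution"
  proof
    fix s
    have "char (distr M borel (\<lambda>\<omega>. X \<omega> / \<sigma>)) s = char (distr M borel X) (s / \<sigma>)"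
      by (simp add: char_def integral_distr)
    also have "\<dots> = complex_of_real (exp (- (s\<^sup>2) / 2))"
      unfolding ch \<sigma>(2)[symmetric] using \<sigma>(1) by (simp add: power_divide)
    finally show "char (distr M borel (\<lambda>\<omega>. X \<omega> / \<sigma>)) s = char std_normal_distribution s"
      by (simp add: char_std_normal_distribution)
  qed
  then have dd: "distr M borel (\<lambda>\<omega>. X \<omega> / \<sigma>) = std_normal_distribution"
    using real_dist_normal_dist by (intro Levy_uniqueness real_distribution_distr) auto
  have "distr M lborel (\<lambda>\<omega>. X \<omega> / \<sigma>) = density lborel std_normal_density"
    using dd by (metis distr_cong sets_lborel)
  then have "distributed M lborel (\<lambda>\<omega>. X \<omega> / \<sigma>) std_normal_density"
    by (auto simp: distributed_def)
  then have "distributed M lborel X (normal_density 0 \<sigma>)"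
    using normal_standard_normal_convert[OF \<sigma>(1), of X 0] by simp
  then show ?thesis
    using \<sigma>(1) by (auto simp: centered_gaussian_def)
qed

text \<open>Characteristic functions at \<open>s\<close> differ by at most
  \<open>\<bar>s\<bar>\<close> times the distance in mean square, and the variances converge, so the
  limit has a Gaussian characteristic function. A limit of variance 0 is treated apart, because it
  has no density.\<close>

lemma centered_gaussian_mean_square_limit:
  assumes Xn: "\<And>n. centered_gaussian M (Xn n)"
    and [measurable]: "X \<in> borel_measurable M"
    and lim: "(\<lambda>n. \<integral>\<^sup>+\<omega>. ennreal ((X \<omega> - Xn n \<omega>)\<^sup>2) \<partial>M) \<longlonglongrightarrow> 0"
  shows "centered_gaussian M X"
proof -
  have [measurable]: "Xn n \<in> borel_measurable M" for n
    using Xn by (auto simp: centered_gaussian_def)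
  have X2n: "integrable M (\<lambda>\<omega>. (Xn n \<omega>)\<^sup>2)" for n
    using centered_gaussian_has_moments[OF Xn] by (rule has_moments_integrable_power)
  note ml = mean_square_limit[OF \<open>X \<in> borel_measurable M\<close> \<open>\<And>n. Xn n \<in> borel_measurable M\<close> X2n lim]
  show ?thesis
  proof (cases "expectation (\<lambda>\<omega>. (X \<omega>)\<^sup>2) = 0")
    case True
    then have "AE \<omega> in M. (X \<omega>)\<^sup>2 = 0"
      using ml(1) by (subst (asm) integral_nonneg_eq_0_iff_AE) auto
    then show ?thesis by (auto simp: centered_gaussian_def)
  next
    case False
    then have pos: "expectation (\<lambda>\<omega>. (X \<omega>)\<^sup>2) > 0"
      by (simp add: order.not_eq_order_implies_strict)
    show ?thesis
    proof (rule centered_gaussian_of_char[OF _ pos])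
      fix s
      let ?c = "\<lambda>Y. CLINT \<omega>|M. iexp (s * Y \<omega>)"
      have d2: "integrable M (\<lambda>\<omega>. (X \<omega> - Xn n \<omega>)\<^sup>2)" for n
        using integrable_power2_add[of X M "\<lambda>x. - Xn n x"] ml(1) X2n by simp
      have d1: "integrable M (\<lambda>\<omega>. X \<omega> - Xn n \<omega>)" for n
        using d2 by (rule square_integrable_imp_integrable[rotated]) simp
      have ii: "integrable M (\<lambda>\<omega>. iexp (s * Y \<omega>))" if "Y \<in> borel_measurable M" for Y
        using that by (intro integrable_const_bound[of _ 1]) auto
      have bd: "norm (?c (Xn n) - ?c X) \<le> \<bar>s\<bar> * sqrt (expectation (\<lambda>\<omega>. (X \<omega> - Xn n \<omega>)\<^sup>2))" for n
      proof -
        have "norm (?c (Xn n) - ?c X) = norm (CLINT \<omega>|M. iexp (s * Xn n \<omega>) - iexp (s * X \<omega>))"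
          by (subst Bochner_Integration.integral_diff[OF ii ii]) simp_all
        also have "\<dots> \<le> (\<integral>\<omega>. norm (iexp (s * Xn n \<omega>) - iexp (s * X \<omega>)) \<partial>M)"
          by (rule integral_norm_bound)
        also have "\<dots> \<le> (\<integral>\<omega>. \<bar>s\<bar> * \<bar>X \<omega> - Xn n \<omega>\<bar> \<partial>M)"
        proof (rule integral_mono)
          show "integrable M (\<lambda>\<omega>. norm (iexp (s * Xn n \<omega>) - iexp (s * X \<omega>)))"
            by (intro integrable_norm Bochner_Integration.integrable_diff ii) auto
          show "integrable M (\<lambda>\<omega>. \<bar>s\<bar> * \<bar>X \<omega> - Xn n \<omega>\<bar>)"
            using d1 by (intro integrable_mult_right integrable_abs)
          fix \<omega>
          have "norm (iexp (s * Xn n \<omega>) - iexp (s * X \<omega>)) =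
              norm (iexp (s * X \<omega>) * (iexp (s * Xn n \<omega> - s * X \<omega>) - 1))"
            by (simp only: right_diff_distrib exp_add[symmetric] of_real_diff mult_1_right) simp
          also have "\<dots> = norm (iexp (s * Xn n \<omega> - s * X \<omega>) - 1)"
            by (simp add: norm_mult)
          also have "\<dots> \<le> \<bar>s * Xn n \<omega> - s * X \<omega>\<bar>"
            using iexp_approx1[of "s * Xn n \<omega> - s * X \<omega>" 0] by simp
          finally show "norm (iexp (s * Xn n \<omega>) - iexp (s * X \<omega>)) \<le> \<bar>s\<bar> * \<bar>X \<omega> - Xn n \<omega>\<bar>"
            by (simp add: right_diff_distrib[symmetric] abs_mult abs_minus_commute)
        qed
        also have "\<dots> = \<bar>s\<bar> * expectation (\<lambda>\<omega>. \<bar>X \<omega> - Xn n \<omega>\<bar>)" by simp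
        also have "\<dots> \<le> \<bar>s\<bar> * sqrt (expectation (\<lambda>\<omega>. (X \<omega> - Xn n \<omega>)\<^sup>2))"
          by (intro mult_left_mono expectation_abs_le_sqrt d2) auto
        finally show ?thesis .
      qed
      have "(\<lambda>n. \<bar>s\<bar> * sqrt (expectation (\<lambda>\<omega>. (X \<omega> - Xn n \<omega>)\<^sup>2))) \<longlonglongrightarrow> \<bar>s\<bar> * sqrt 0"
        by (intro tendsto_intros ml(2))
      then have "(\<lambda>n. \<bar>s\<bar> * sqrt (expectation (\<lambda>\<omega>. (X \<omega> - Xn n \<omega>)\<^sup>2))) \<longlonglongrightarrow> 0" by simp
      then have "(\<lambda>n. ?c (Xn n) - ?c X) \<longlonglongrightarrow> 0"
        by (rule Lim_null_comparison[rotated]) (intro always_eventually allI bd)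
      then have "(\<lambda>n. ?c (Xn n)) \<longlonglongrightarrow> ?c X" by (rule LIM_zero_cancel)
      moreover have "?c (Xn n) = complex_of_real (exp (- (s\<^sup>2 * expectation (\<lambda>\<omega>. (Xn n \<omega>)\<^sup>2)) / 2))" for n
        using char_centered_gaussian[OF Xn, of n s] by (simp add: char_def integral_distr)
      ultimately have "(\<lambda>n. complex_of_real (exp (- (s\<^sup>2 * expectation (\<lambda>\<omega>. (Xn n \<omega>)\<^sup>2)) / 2))) \<longlonglongrightarrow> ?c X"
        by simp
      moreover have "(\<lambda>n. complex_of_real (exp (- (s\<^sup>2 * expectation (\<lambda>\<omega>. (Xn n \<omega>)\<^sup>2)) / 2))) \<longlonglongrightarrow>
          complex_of_real (exp (- (s\<^sup>2 * expectation (\<lambda>\<omega>. (X \<omega>)\<^sup>2)) / 2))"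
        by (intro tendsto_intros ml(3)) auto
      ultimately show "char (distr M borel X) s =
          complex_of_real (exp (- (s\<^sup>2 * expectation (\<lambda>\<omega>. (X \<omega>)\<^sup>2)) / 2))"
        by (simp add: char_def integral_distr LIMSEQ_unique)
    qed simp
  qed
qed

end


section \<open>The Wiener integral and the coefficients of the mild solution\<close>

locale white_noise = prob_space M for M :: "'a measure" +
  fixes W :: "(real \<times> real) set \<Rightarrow> 'a \<Rightarrow> real"
  assumes noise: "space_time_white_noise M W"
begin

lemma centered_gaussian_simple:
  assumes "finite F" "F \<subseteq> fmeasurable spacetime"
  shows "centered_gaussian M (\<lambda>\<omega>. \<Sum>A\<in>F. c A * W A \<omega>)"
  using noise assms by (auto simp: space_time_white_noise_def)

lemma centered_gaussian_noise:
  assumes "A \<in> fmeasurable spacetime"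
  shows "centered_gaussian M (W A)"
  using centered_gaussian_simple[of "{A}" "\<lambda>_. 1"] assms by simp

lemma is_wiener_integralI:
  assumes "h \<in> borel_measurable spacetime" "X \<in> borel_measurable M"
    and "\<And>n::nat. finite (F n)" "\<And>n. F n \<subseteq> fmeasurable spacetime"
    and "(\<lambda>n. \<integral>\<^sup>+z. ennreal ((h z - (\<Sum>A\<in>F n. c n A * indicator A z))\<^sup>2) \<partial>spacetime) \<longlonglongrightarrow> 0"
    and "(\<lambda>n. \<integral>\<^sup>+\<omega>. ennreal ((X \<omega> - (\<Sum>A\<in>F n. c n A * W A \<omega>))\<^sup>2) \<partial>M) \<longlonglongrightarrow> 0"
  shows "is_wiener_integral M W h X"
  unfolding is_wiener_integral_def using assms by blast

lemma simple_measurable: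
  assumes "finite F" "F \<subseteq> fmeasurable spacetime"
  shows "(\<lambda>z. \<Sum>A\<in>F. c A * indicator A z :: real) \<in> borel_measurable spacetime"
    and "(\<lambda>\<omega>. \<Sum>A\<in>F. c A * W A \<omega>) \<in> borel_measurable M"
proof -
  show "(\<lambda>z. \<Sum>A\<in>F. c A * indicator A z :: real) \<in> borel_measurable spacetime"
    using assms by (intro borel_measurable_sum borel_measurable_times borel_measurable_const
        borel_measurable_indicator) (auto simp: fmeasurable_def)
  show "(\<lambda>\<omega>. \<Sum>A\<in>F. c A * W A \<omega>) \<in> borel_measurable M"
    using centered_gaussian_simple[OF assms, of c] by (simp add: centered_gaussian_def)
qed

text \<open>The sets in \<open>F\<close> may overlap, so both squares are expanded into double sums
  and compared term by term through the covariance of the noise.\<close>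

lemma isometry_simple:
  assumes F: "finite F" "F \<subseteq> fmeasurable spacetime"
  shows "integrable spacetime (\<lambda>z. (\<Sum>A\<in>F. c A * indicator A z)\<^sup>2)"
    and "expectation (\<lambda>\<omega>. (\<Sum>A\<in>F. c A * W A \<omega>)\<^sup>2) = (\<integral>z. (\<Sum>A\<in>F. c A * indicator A z)\<^sup>2 \<partial>spacetime)"
proof -
  have G: "has_moments M (W A)" if "A \<in> F" for A
    using that F by (intro centered_gaussian_has_moments centered_gaussian_noise) auto
  have iW: "integrable M (\<lambda>\<omega>. W A \<omega> * W B \<omega>)" if "A \<in> F" "B \<in> F" for A B
    using that G by (intro has_moments_integrable has_moments_mult)
  have AB: "A \<inter> B \<in> fmeasurable spacetime" if "A \<in> F" "B \<in> F" for A B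
    using that F by (intro fmeasurable.Int) auto
  have iI: "integrable spacetime (\<lambda>z. indicator (A \<inter> B) z :: real)" if "A \<in> F" "B \<in> F" for A B
    using AB[OF that] by (auto simp: fmeasurable_def)
  have sqI: "(\<Sum>A\<in>F. c A * indicator A z)\<^sup>2 =
      (\<Sum>A\<in>F. \<Sum>B\<in>F. (c A * c B) * (indicator (A \<inter> B) z :: real))" for z
    by (simp add: power2_eq_square sum_product indicator_inter_arith algebra_simps)
  have sqW: "(\<Sum>A\<in>F. c A * W A \<omega>)\<^sup>2 = (\<Sum>A\<in>F. \<Sum>B\<in>F. (c A * c B) * (W A \<omega> * W B \<omega>))" for \<omega>
    by (simp add: power2_eq_square sum_product algebra_simps)
  show "integrable spacetime (\<lambda>z. (\<Sum>A\<in>F. c A * indicator A z)\<^sup>2)"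
    unfolding sqI by (intro Bochner_Integration.integrable_sum integrable_mult_right iI)
  have "expectation (\<lambda>\<omega>. (\<Sum>A\<in>F. c A * W A \<omega>)\<^sup>2) =
      (\<Sum>A\<in>F. \<Sum>B\<in>F. (c A * c B) * expectation (\<lambda>\<omega>. W A \<omega> * W B \<omega>))"
    unfolding sqW by (simp add: iW Bochner_Integration.integral_sum)
  also have "\<dots> = (\<Sum>A\<in>F. \<Sum>B\<in>F. (c A * c B) * measure spacetime (A \<inter> B))"
  proof (intro sum.cong refl)
    fix A B assume "A \<in> F" "B \<in> F"
    then have "A \<in> fmeasurable spacetime" "B \<in> fmeasurable spacetime" using F by auto
    then have "expectation (\<lambda>\<omega>. W A \<omega> * W B \<omega>) = measure spacetime (A \<inter> B)"
      using noise unfolding space_time_white_noise_def by blast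
    then show "(c A * c B) * expectation (\<lambda>\<omega>. W A \<omega> * W B \<omega>) = (c A * c B) * measure spacetime (A \<inter> B)"
      by (rule arg_cong)
  qed
  also have "\<dots> = (\<Sum>A\<in>F. \<Sum>B\<in>F. (c A * c B) * (\<integral>z. indicator (A \<inter> B) z \<partial>spacetime))"
  proof (intro sum.cong refl)
    fix A B assume "A \<in> F" "B \<in> F"
    then have "A \<inter> B \<in> sets spacetime" using AB by (auto simp: fmeasurable_def)
    then show "(c A * c B) * measure spacetime (A \<inter> B) = (c A * c B) * (\<integral>z. indicator (A \<inter> B) z \<partial>spacetime)"
      by (simp add: sets.Int_space_eq2)
  qed
  also have "\<dots> = (\<integral>z. (\<Sum>A\<in>F. c A * indicator A z)\<^sup>2 \<partial>spacetime)"
    unfolding sqI by (simp add: iI Bochner_Integration.integral_sum)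
  finally show "expectation (\<lambda>\<omega>. (\<Sum>A\<in>F. c A * W A \<omega>)\<^sup>2) =
      (\<integral>z. (\<Sum>A\<in>F. c A * indicator A z)\<^sup>2 \<partial>spacetime)" .
qed

text \<open>The second moments of the simple approximants agree on both sides and converge to those
  of \<open>X\<close> and \<open>h\<close>; Gaussianity passes to limits in mean square.\<close>

lemma
  assumes X: "is_wiener_integral M W h X"
  shows wiener_gaussian: "centered_gaussian M X"
    and wiener_square_integrable: "integrable spacetime (\<lambda>z. (h z)\<^sup>2)"
    and wiener_isometry: "expectation (\<lambda>\<omega>. (X \<omega>)\<^sup>2) = (\<integral>z. (h z)\<^sup>2 \<partial>spacetime)"
proof -
  from X obtain F c where [measurable]: "h \<in> borel_measurable spacetime" "X \<in> borel_measurable M"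
    and F: "\<And>n::nat. finite (F n)" "\<And>n. F n \<subseteq> fmeasurable spacetime"
    and lh: "(\<lambda>n. \<integral>\<^sup>+z. ennreal ((h z - (\<Sum>A\<in>F n. c n A * indicator A z))\<^sup>2) \<partial>spacetime) \<longlonglongrightarrow> 0"
    and lX: "(\<lambda>n. \<integral>\<^sup>+\<omega>. ennreal ((X \<omega> - (\<Sum>A\<in>F n. c n A * W A \<omega>))\<^sup>2) \<partial>M) \<longlonglongrightarrow> 0"
    unfolding is_wiener_integral_def by blast
  have G: "centered_gaussian M (\<lambda>\<omega>. \<Sum>A\<in>F n. c n A * W A \<omega>)" for n
    using F by (rule centered_gaussian_simple)
  show "centered_gaussian M X"
    by (rule centered_gaussian_mean_square_limit[OF G _ lX]) simp
  note mI = simple_measurable(1)[OF F] and mW = simple_measurable(2)[OF F]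
  have iW: "integrable M (\<lambda>\<omega>. (\<Sum>A\<in>F n. c n A * W A \<omega>)\<^sup>2)" for n
    using centered_gaussian_has_moments[OF G] by (rule has_moments_integrable_power)
  note H = mean_square_limit[OF _ mI isometry_simple(1)[OF F] lh]
  note K = mean_square_limit[OF _ mW iW lX]
  show "integrable spacetime (\<lambda>z. (h z)\<^sup>2)" by (rule H) simp
  have "(\<lambda>n. \<integral>z. (\<Sum>A\<in>F n. c n A * indicator A z)\<^sup>2 \<partial>spacetime) \<longlonglongrightarrow> (\<integral>z. (h z)\<^sup>2 \<partial>spacetime)"
    by (rule H) simp
  moreover have "(\<lambda>n. expectation (\<lambda>\<omega>. (\<Sum>A\<in>F n. c n A * W A \<omega>)\<^sup>2)) \<longlonglongrightarrow> expectation (\<lambda>\<omega>. (X \<omega>)\<^sup>2)"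
    by (rule K) simp
  ultimately show "expectation (\<lambda>\<omega>. (X \<omega>)\<^sup>2) = (\<integral>z. (h z)\<^sup>2 \<partial>spacetime)"
    unfolding isometry_simple(2)[OF F] by (rule LIMSEQ_unique[symmetric])
qed

lemma wiener_scale:
  assumes X: "is_wiener_integral M W h X"
  shows "is_wiener_integral M W (\<lambda>z. a * h z) (\<lambda>\<omega>. a * X \<omega>)"
proof -
  from X obtain F c where [measurable]: "h \<in> borel_measurable spacetime" "X \<in> borel_measurable M"
    and F: "\<And>n::nat. finite (F n)" "\<And>n. F n \<subseteq> fmeasurable spacetime"
    and lh: "(\<lambda>n. \<integral>\<^sup>+z. ennreal ((h z - (\<Sum>A\<in>F n. c n A * indicator A z))\<^sup>2) \<partial>spacetime) \<longlonglongrightarrow> 0"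
    and lX: "(\<lambda>n. \<integral>\<^sup>+\<omega>. ennreal ((X \<omega> - (\<Sum>A\<in>F n. c n A * W A \<omega>))\<^sup>2) \<partial>M) \<longlonglongrightarrow> 0"
    unfolding is_wiener_integral_def by blast
  note mI = simple_measurable(1)[OF F] and mW = simple_measurable(2)[OF F]
  have sc: "(a * x - (\<Sum>A\<in>F n. a * c n A * y A))\<^sup>2 = a\<^sup>2 * (x - (\<Sum>A\<in>F n. c n A * y A))\<^sup>2" for x y n
    by (simp add: sum_distrib_left[symmetric] mult.assoc right_diff_distrib[symmetric] power_mult_distrib)
  have lim0: "(\<lambda>n. ennreal (a\<^sup>2) * f n) \<longlonglongrightarrow> 0" if "f \<longlonglongrightarrow> 0" for f :: "nat \<Rightarrow> ennreal"
    using tendsto_mult_ennreal[OF tendsto_const that, of "ennreal (a\<^sup>2)"] by simp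
  have "(\<lambda>n. \<integral>\<^sup>+z. ennreal ((a * h z - (\<Sum>A\<in>F n. a * c n A * indicator A z))\<^sup>2) \<partial>spacetime) \<longlonglongrightarrow> 0"
    unfolding sc using lim0[OF lh] mI by (simp add: ennreal_mult nn_integral_cmult)
  moreover have "(\<lambda>n. \<integral>\<^sup>+\<omega>. ennreal ((a * X \<omega> - (\<Sum>A\<in>F n. a * c n A * W A \<omega>))\<^sup>2) \<partial>M) \<longlonglongrightarrow> 0"
    unfolding sc using lim0[OF lX] mW by (simp add: ennreal_mult nn_integral_cmult)
  ultimately show ?thesis
    using F by (intro is_wiener_integralI[where F = F and c = "\<lambda>n A. a * c n A"]) simp_all
qed

lemma wiener_add:
  assumes X: "is_wiener_integral M W h X" and Y: "is_wiener_integral M W h' Y"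
  shows "is_wiener_integral M W (\<lambda>z. h z + h' z) (\<lambda>\<omega>. X \<omega> + Y \<omega>)"
proof -
  from X obtain F c where [measurable]: "h \<in> borel_measurable spacetime" "X \<in> borel_measurable M"
    and F: "\<And>n::nat. finite (F n)" "\<And>n. F n \<subseteq> fmeasurable spacetime"
    and lh: "(\<lambda>n. \<integral>\<^sup>+z. ennreal ((h z - (\<Sum>A\<in>F n. c n A * indicator A z))\<^sup>2) \<partial>spacetime) \<longlonglongrightarrow> 0"
    and lX: "(\<lambda>n. \<integral>\<^sup>+\<omega>. ennreal ((X \<omega> - (\<Sum>A\<in>F n. c n A * W A \<omega>))\<^sup>2) \<partial>M) \<longlonglongrightarrow> 0"
    unfolding is_wiener_integral_def by blast
  from Y obtain F' c' where [measurable]: "h' \<in> borel_measurable spacetime" "Y \<in> borel_measurable M"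
    and F': "\<And>n::nat. finite (F' n)" "\<And>n. F' n \<subseteq> fmeasurable spacetime"
    and lh': "(\<lambda>n. \<integral>\<^sup>+z. ennreal ((h' z - (\<Sum>A\<in>F' n. c' n A * indicator A z))\<^sup>2) \<partial>spacetime) \<longlonglongrightarrow> 0"
    and lY: "(\<lambda>n. \<integral>\<^sup>+\<omega>. ennreal ((Y \<omega> - (\<Sum>A\<in>F' n. c' n A * W A \<omega>))\<^sup>2) \<partial>M) \<longlonglongrightarrow> 0"
    unfolding is_wiener_integral_def by blast
  \<comment> \<open>The two approximations use different families of sets. A set that occurs in both
    receives the sum of its coefficients, so that the merged sum is again indexed by a set.\<close>
  define d where "d n A = (if A \<in> F n then c n A else 0) + (if A \<in> F' n then c' n A else 0)" for n A
  note [measurable] = simple_measurable[OF F] simple_measurable[OF F']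
  have ds: "(\<Sum>A\<in>F n \<union> F' n. d n A * y A) = (\<Sum>A\<in>F n. c n A * y A) + (\<Sum>A\<in>F' n. c' n A * y A)"
    for n and y :: "(real \<times> real) set \<Rightarrow> real"
  proof -
    have "(\<Sum>A\<in>F n \<union> F' n. d n A * y A) =
        (\<Sum>A\<in>F n \<union> F' n. if A \<in> F n then c n A * y A else 0) +
        (\<Sum>A\<in>F n \<union> F' n. if A \<in> F' n then c' n A * y A else 0)"
      by (subst sum.distrib[symmetric]) (auto simp: d_def distrib_right intro!: sum.cong)
    also have "(\<Sum>A\<in>F n \<union> F' n. if A \<in> F n then c n A * y A else 0) = (\<Sum>A\<in>F n. c n A * y A)"
      using F(1) F'(1) by (intro sum.mono_neutral_cong_right) auto
    also have "(\<Sum>A\<in>F n \<union> F' n. if A \<in> F' n then c' n A * y A else 0) = (\<Sum>A\<in>F' n. c' n A * y A)"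
      using F(1) F'(1) by (intro sum.mono_neutral_cong_right) auto
    finally show ?thesis .
  qed
  have bd: "ennreal ((x + x' - (\<Sum>A\<in>F n \<union> F' n. d n A * y A))\<^sup>2) \<le>
      2 * ennreal ((x - (\<Sum>A\<in>F n. c n A * y A))\<^sup>2) + 2 * ennreal ((x' - (\<Sum>A\<in>F' n. c' n A * y A))\<^sup>2)"
    for n x x' and y :: "(real \<times> real) set \<Rightarrow> real"
  proof -
    have "(x + x' - (\<Sum>A\<in>F n \<union> F' n. d n A * y A))\<^sup>2 \<le>
      2 * (x - (\<Sum>A\<in>F n. c n A * y A))\<^sup>2 + 2 * (x' - (\<Sum>A\<in>F' n. c' n A * y A))\<^sup>2"
      unfolding ds
      using power2_add_le[of "x - (\<Sum>A\<in>F n. c n A * y A)" "x' - (\<Sum>A\<in>F' n. c' n A * y A)"]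
      by (simp add: algebra_simps)
    then show ?thesis
      by (simp add: ennreal_plus[symmetric] ennreal_mult[symmetric] ennreal_numeral[symmetric]
          del: ennreal_plus ennreal_numeral)
  qed
  have lim0: "(\<lambda>n. 2 * f n + 2 * g n) \<longlonglongrightarrow> 0" if "f \<longlonglongrightarrow> 0" "g \<longlonglongrightarrow> 0" for f g :: "nat \<Rightarrow> ennreal"
    using tendsto_add[OF tendsto_mult_ennreal[OF tendsto_const that(1), of 2]
       tendsto_mult_ennreal[OF tendsto_const that(2), of 2]] by simp
  have "(\<lambda>n. \<integral>\<^sup>+z. ennreal ((h z + h' z - (\<Sum>A\<in>F n \<union> F' n. d n A * indicator A z))\<^sup>2) \<partial>spacetime) \<longlonglongrightarrow> 0"
  proof (rule tendsto_sandwich[OF _ _ tendsto_const lim0[OF lh lh']])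
    show "\<forall>\<^sub>F n in sequentially. (\<integral>\<^sup>+z. ennreal ((h z + h' z - (\<Sum>A\<in>F n \<union> F' n. d n A * indicator A z))\<^sup>2) \<partial>spacetime) \<le>
        2 * (\<integral>\<^sup>+z. ennreal ((h z - (\<Sum>A\<in>F n. c n A * indicator A z))\<^sup>2) \<partial>spacetime) +
        2 * (\<integral>\<^sup>+z. ennreal ((h' z - (\<Sum>A\<in>F' n. c' n A * indicator A z))\<^sup>2) \<partial>spacetime)"
      by (intro always_eventually allI order.trans[OF nn_integral_mono[OF bd]])
         (simp add: nn_integral_add nn_integral_cmult)
  qed simp
  moreover have "(\<lambda>n. \<integral>\<^sup>+\<omega>. ennreal ((X \<omega> + Y \<omega> - (\<Sum>A\<in>F n \<union> F' n. d n A * W A \<omega>))\<^sup>2) \<partial>M) \<longlonglongrightarrow> 0"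
  proof (rule tendsto_sandwich[OF _ _ tendsto_const lim0[OF lX lY]])
    show "\<forall>\<^sub>F n in sequentially. (\<integral>\<^sup>+\<omega>. ennreal ((X \<omega> + Y \<omega> - (\<Sum>A\<in>F n \<union> F' n. d n A * W A \<omega>))\<^sup>2) \<partial>M) \<le>
        2 * (\<integral>\<^sup>+\<omega>. ennreal ((X \<omega> - (\<Sum>A\<in>F n. c n A * W A \<omega>))\<^sup>2) \<partial>M) +
        2 * (\<integral>\<^sup>+\<omega>. ennreal ((Y \<omega> - (\<Sum>A\<in>F' n. c' n A * W A \<omega>))\<^sup>2) \<partial>M)"
      by (intro always_eventually allI order.trans[OF nn_integral_mono[OF bd]])
         (simp add: nn_integral_add nn_integral_cmult)
  qed simp
  ultimately show ?thesis
    using F F' by (intro is_wiener_integralI[where F = "\<lambda>n. F n \<union> F' n" and c = d]) simp_all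
qed

text \<open>Polarization: the isometry is applied to \<open>X\<close>, to \<open>Y\<close> and to
  \<open>X + Y\<close>.\<close>

lemma wiener_covariance:
  assumes X: "is_wiener_integral M W h X" and Y: "is_wiener_integral M W h' Y"
  shows "expectation (\<lambda>\<omega>. X \<omega> * Y \<omega>) = (\<integral>z. h z * h' z \<partial>spacetime)"
proof -
  have [measurable]: "h \<in> borel_measurable spacetime" "h' \<in> borel_measurable spacetime"
    using X Y by (auto simp: is_wiener_integral_def)
  note mX = centered_gaussian_has_moments[OF wiener_gaussian[OF X]]
  note mY = centered_gaussian_has_moments[OF wiener_gaussian[OF Y]]
  note hh = wiener_square_integrable[OF X] wiener_square_integrable[OF Y]
  have ihh: "integrable spacetime (\<lambda>z. h z * h' z)"
    by (intro integrable_mult_of_squares hh) auto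
  have iXY: "integrable M (\<lambda>\<omega>. X \<omega> * Y \<omega>)"
    by (intro has_moments_integrable has_moments_mult mX mY)
  have "expectation (\<lambda>\<omega>. (X \<omega> + Y \<omega>)\<^sup>2) =
      expectation (\<lambda>\<omega>. (X \<omega>)\<^sup>2) + expectation (\<lambda>\<omega>. (Y \<omega>)\<^sup>2) + 2 * expectation (\<lambda>\<omega>. X \<omega> * Y \<omega>)"
    using iXY has_moments_integrable_power[OF mX] has_moments_integrable_power[OF mY]
    by (simp add: power2_sum mult.assoc)
  moreover have "(\<integral>z. (h z + h' z)\<^sup>2 \<partial>spacetime) =
      (\<integral>z. (h z)\<^sup>2 \<partial>spacetime) + (\<integral>z. (h' z)\<^sup>2 \<partial>spacetime) + 2 * (\<integral>z. h z * h' z \<partial>spacetime)"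
    using ihh hh by (simp add: power2_sum mult.assoc)
  ultimately show ?thesis
    using wiener_isometry[OF X] wiener_isometry[OF Y] wiener_isometry[OF wiener_add[OF X Y]] by simp
qed

end

lemma eigfun_orthonormal:
  assumes "1 \<le> k" "1 \<le> l"
  shows "has_bochner_integral lborel (\<lambda>y. (eigfun k y * eigfun l y) * indicator {0<..<pi} y)
    (if k = l then 1 else 0)"
proof -
  \<comment> \<open>The eigenfunctions vanish at both endpoints, so the interval may be closed
    before the fundamental theorem of calculus is applied.\<close>
  have ind: "(eigfun k y * eigfun l y) * indicator {0<..<pi} y =
      (eigfun k y * eigfun l y) * indicator {0..pi} y" for y
  proof (cases "y = 0 \<or> y = pi")
    case True
    then have "eigfun k y = 0" by (auto simp: eigfun_def)
    then show ?thesis by simp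
  qed (auto simp: indicator_def)
  have prod: "eigfun k y * eigfun l y = (1 / pi) * (cos ((real k - real l) * y) - cos ((real k + real l) * y))" for y
  proof -
    have "eigfun k y * eigfun l y = (2 / pi) * (sin (real k * y) * sin (real l * y))"
    proof -
      have "eigfun k y * eigfun l y = (sqrt (2 / pi) * sqrt (2 / pi)) * (sin (real k * y) * sin (real l * y))"
        unfolding eigfun_def by (simp only: mult_ac)
      then show ?thesis by simp
    qed
    also have "\<dots> = (1 / pi) * (cos ((real k - real l) * y) - cos ((real k + real l) * y))"
      by (simp add: sin_times_sin left_diff_distrib distrib_right field_simps)
    finally show ?thesis .
  qed
  \<comment> \<open>An antiderivative of the difference of cosines. The diagonal needs its own
    branch, since for \<open>k = l\<close> the first cosine is the constant 1.\<close>
  define F where "F y = (1 / pi) * ((if k = l then y else sin ((real k - real l) * y) / (real k - real l))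
    - sin ((real k + real l) * y) / (real k + real l))" for y
  have "has_bochner_integral lborel (\<lambda>y. (eigfun k y * eigfun l y) * indicator {0..pi} y) (F pi - F 0)"
  proof (rule has_bochner_integral_FTC_Icc_real)
    fix y
    show "DERIV F y :> eigfun k y * eigfun l y"
    proof -
      have d: "((\<lambda>y. sin (c * y) / c) has_real_derivative cos (c * y)) (at y)" if "c \<noteq> 0" for c
        using that by (auto intro!: derivative_eq_intros)
      have d1: "((\<lambda>y. if k = l then y else sin ((real k - real l) * y) / (real k - real l))
          has_real_derivative cos ((real k - real l) * y)) (at y)"
        using d[of "real k - real l"] by (cases "k = l") auto
      show ?thesis
        unfolding prod F_def using assms by (intro DERIV_cmult DERIV_diff d1 d) simp
    qed
    show "isCont (\<lambda>y. eigfun k y * eigfun l y) y"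
      unfolding eigfun_def by (intro continuous_intros)
  qed simp
  moreover have "F pi - F 0 = (if k = l then 1 else 0)"
  proof -
    have "sin ((real k + real l) * pi) = 0"
      using sin_npi[of "k + l"] by simp
    moreover have "sin ((real k - real l) * pi) = 0"
      by (simp add: sin_times_pi_eq_0)
    ultimately show ?thesis by (simp add: F_def)
  qed
  ultimately show ?thesis unfolding ind by simp
qed

lemma time_integral:
  fixes s t lam :: real
  assumes "0 \<le> s" "s \<le> t" "lam > 0"
  shows "has_bochner_integral lborel
     (\<lambda>a. (exp (- lam * (s - a)) * exp (- lam * (t - a))) * indicator {0..s} a)
     ((exp (- lam * (t - s)) - exp (- lam * (s + t))) / (2 * lam))"
proof -
  define F where "F a = exp (- lam * (s + t - 2 * a)) / (2 * lam)" for a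
  have "has_bochner_integral lborel
     (\<lambda>a. (exp (- lam * (s - a)) * exp (- lam * (t - a))) * indicator {0..s} a) (F s - F 0)"
  proof (rule has_bochner_integral_FTC_Icc_real)
    fix a
    have "(F has_real_derivative exp (- lam * (s + t - 2 * a))) (at a)"
      unfolding F_def using assms by (auto intro!: derivative_eq_intros simp: field_simps)
    moreover have "exp (- lam * (s + t - 2 * a)) = exp (- lam * (s - a)) * exp (- lam * (t - a))"
      by (simp add: exp_add[symmetric] algebra_simps)
    ultimately show "(F has_real_derivative exp (- lam * (s - a)) * exp (- lam * (t - a))) (at a)" by simp
    show "isCont (\<lambda>a. exp (- lam * (s - a)) * exp (- lam * (t - a))) a" by (intro continuous_intros)
  qed fact
  then show ?thesis
    by (simp add: F_def diff_divide_distrib algebra_simps)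
qed

lemma integral_lborel_product:
  fixes f g :: "real \<Rightarrow> real"
  assumes f: "integrable lborel f" and g: "integrable lborel g"
  shows "(\<integral>z. f (fst z) * g (snd z) \<partial>lborel) = (\<integral>x. f x \<partial>lborel) * (\<integral>y. g y \<partial>lborel)"
proof -
  have [measurable]: "f \<in> borel_measurable borel" "g \<in> borel_measurable borel"
    using f g by auto
  have int: "integrable (lborel \<Otimes>\<^sub>M lborel) (\<lambda>(x, y). f x * g y)"
    using f g by (intro lborel_pair.Fubini_integrable) (auto simp: abs_mult)
  have "(\<integral>z. f (fst z) * g (snd z) \<partial>lborel) = integral\<^sup>L (lborel \<Otimes>\<^sub>M lborel) (\<lambda>(x, y). f x * g y)"
    by (simp add: lborel_prod case_prod_unfold)
  also have "\<dots> = (\<integral>x. \<integral>y. f x * g y \<partial>lborel \<partial>lborel)"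
    using lborel_pair.integral_fst[OF int] by simp
  finally show ?thesis by simp
qed

text \<open>Fubini separates time from space. As \<open>s \<le> t\<close>, the common time support
  is \<open>{0..s}\<close>. The spatial factor makes different modes uncorrelated; the time factor
  is the Ornstein-Uhlenbeck covariance, whose second exponential is the trace of the start at
  0.\<close>

lemma mild_kernel_inner_product:
  assumes k: "1 \<le> k" "1 \<le> l" and t: "0 \<le> s" "s \<le> t"
  shows "(\<integral>z. mild_kernel k s z * mild_kernel l t z \<partial>spacetime) =
    (if k = l then (exp (- eigval k * (t - s)) - exp (- eigval k * (s + t))) / (2 * eigval k) else 0)"
proof -
  define f where "f a = (exp (- eigval k * (s - a)) * exp (- eigval l * (t - a))) * indicator {0..s} a" for a
  define g where "g y = (eigfun k y * eigfun l y) * indicator {0<..<pi} y" for y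
  have S: "{0..} \<times> {0<..<pi} \<in> sets (lborel :: (real \<times> real) measure)"
    by (simp add: borel_Times)
  have "(\<integral>z. mild_kernel k s z * mild_kernel l t z \<partial>spacetime) =
    (\<integral>z. indicator ({0..} \<times> {0<..<pi}) z * (mild_kernel k s z * mild_kernel l t z) \<partial>lborel)"
    unfolding spacetime_def using S by (subst integral_restrict_space) auto
  also have "\<dots> = (\<integral>z. f (fst z) * g (snd z) \<partial>lborel)"
    using t by (intro Bochner_Integration.integral_cong refl)
      (auto simp: f_def g_def mild_kernel_def indicator_def split: prod.splits)
  also have "\<dots> = (\<integral>x. f x \<partial>lborel) * (\<integral>y. g y \<partial>lborel)"
  proof (rule integral_lborel_product)
    have "set_integrable lborel {0..s} (\<lambda>a. exp (- eigval k * (s - a)) * exp (- eigval l * (t - a)))"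
      by (intro borel_integrable_atLeastAtMost' continuous_intros)
    then show "integrable lborel f"
      unfolding f_def set_integrable_def by (simp add: mult.commute)
    show "integrable lborel g"
      unfolding g_def using eigfun_orthonormal[OF k] by (rule integrable.intros)
  qed
  also have "(\<integral>y. g y \<partial>lborel) = (if k = l then 1 else 0)"
    unfolding g_def using eigfun_orthonormal[OF k] by (rule has_bochner_integral_integral_eq)
  finally have *: "(\<integral>z. mild_kernel k s z * mild_kernel l t z \<partial>spacetime) = (\<integral>x. f x \<partial>lborel) * (if k = l then 1 else 0)" .
  show ?thesis
  proof (cases "k = l")
    case True
    have "eigval l > 0" using k by (simp add: eigval_def)
    from time_integral[OF t this, THEN has_bochner_integral_integral_eq] show ?thesis
      unfolding * f_def[abs_def] by (simp add: True)
  qed (simp add: *)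
qed


section \<open>Mixed moments in Gaussian spaces\<close>

text \<open>Reconciles two expansions of the moment of order \<open>2 * q\<close> of
  \<open>S + t * g\<close>: through the power \<open>q\<close> of the variance
  \<open>s + t\<^sup>2\<close>, and by the binomial theorem under the expectation.\<close>

lemma gauss_moment_binomial:
  assumes "b \<le> q"
  shows "gauss_moment (2 * q) * real (q choose b) = real ((2 * q) choose (2 * b)) * (gauss_moment (2 * b) * gauss_moment (2 * (q - b)))"
proof -
  have e: "(2::real) ^ q = 2 ^ b * 2 ^ (q - b)"
    using assms by (simp add: power_add[symmetric])
  have "fact (2 * q - 2 * b) = (fact (2 * (q - b)) :: real)"
    by (simp add: diff_mult_distrib2)
  then show ?thesis
    unfolding gauss_moment_even e using assms by (simp add: binomial_fact)
qed

text \<open>Closure under linear combinations, together with Gaussianity of each member, encodes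
  joint Gaussianity. The instance used in the end is the set of all Wiener integrals.\<close>

locale gaussian_space = prob_space M for M :: "'a measure" +
  fixes G :: "('a \<Rightarrow> real) set"
  assumes add_closed: "X \<in> G \<Longrightarrow> Y \<in> G \<Longrightarrow> (\<lambda>\<omega>. X \<omega> + Y \<omega>) \<in> G"
    and scale_closed: "X \<in> G \<Longrightarrow> (\<lambda>\<omega>. c * X \<omega>) \<in> G"
    and gaussian: "X \<in> G \<Longrightarrow> centered_gaussian M X"
begin

lemma moments: "X \<in> G \<Longrightarrow> has_moments M X"
  by (intro centered_gaussian_has_moments gaussian)

lemma moment: "X \<in> G \<Longrightarrow> expectation (\<lambda>\<omega>. X \<omega> ^ n) = gauss_moment n * sqrt (expectation (\<lambda>\<omega>. (X \<omega>)\<^sup>2)) ^ n"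
  by (intro centered_gaussian_moment gaussian)

lemma even_moment: "X \<in> G \<Longrightarrow> expectation (\<lambda>\<omega>. ((X \<omega>)\<^sup>2) ^ n) = gauss_moment (2 * n) * expectation (\<lambda>\<omega>. (X \<omega>)\<^sup>2) ^ n"
  using moment[of X "2 * n"] by (simp add: power_mult)

lemma diff_closed:
  assumes "X \<in> G" "Y \<in> G"
  shows "(\<lambda>\<omega>. X \<omega> - Y \<omega>) \<in> G"
  using add_closed[OF assms(1) scale_closed[OF assms(2), of "-1"]] by simp

lemma
  assumes "X \<in> G" "Y \<in> G"
  shows integrable_product: "integrable M (\<lambda>\<omega>. X \<omega> * Y \<omega>)"
    and integrable_square: "integrable M (\<lambda>\<omega>. (X \<omega>)\<^sup>2)"
  by (rule has_moments_integrable, rule has_moments_mult; rule moments, rule assms)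
     (rule has_moments_integrable, rule has_moments_power, rule moments, rule assms)

text \<open>
  The mixed moments are read off from those of \<open>S + t * g\<close>, which lies in the space for every \<open>t\<close>,
  by comparing coefficients of powers of \<open>t\<close>. No joint density or independence is involved.
\<close>

lemma moment_product_with:
  assumes "finite I"
    and "\<And>i. i \<in> I \<Longrightarrow> g i \<in> G"
    and "\<And>i j. i \<in> I \<Longrightarrow> j \<in> I \<Longrightarrow> expectation (\<lambda>\<omega>. g i \<omega> * g j \<omega>) = (if i = j then 1 else 0)"
    and "S \<in> G" and "\<And>i. i \<in> I \<Longrightarrow> expectation (\<lambda>\<omega>. S \<omega> * g i \<omega>) = 0"
  shows "expectation (\<lambda>\<omega>. S \<omega> ^ n * (\<Prod>i\<in>I. g i \<omega> ^ a i)) =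
    gauss_moment n * sqrt (expectation (\<lambda>\<omega>. (S \<omega>)\<^sup>2)) ^ n * (\<Prod>i\<in>I. gauss_moment (a i))"
  using assms
proof (induction I arbitrary: S n rule: finite_induct)
  case empty
  have "S \<in> G" by fact
  from moment[OF this, of n] show ?case by simp
next
  case (insert j I)
  \<comment> \<open>The degree \<open>N\<close> is chosen such that the coefficient of
    \<open>t ^ m\<close> in \<open>(t * g j + S) ^ N\<close> carries exactly the wanted product
    \<open>S ^ n * g j ^ m\<close>.\<close>
  define m N s P where "m = a j" and "N = n + a j" and "s = expectation (\<lambda>\<omega>. (S \<omega>)\<^sup>2)"
    and "P = (\<Prod>i\<in>I. gauss_moment (a i))"
  define h where "h \<omega> = (\<Prod>i\<in>I. g i \<omega> ^ a i)" for \<omega>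
  have s0: "0 \<le> s" by (simp add: s_def)
  have gj: "g j \<in> G" and SG: "S \<in> G" using insert by auto
  note mj = moments[OF gj] and mS = moments[OF SG]
  have mh: "has_moments M h"
    unfolding h_def by (intro has_moments_prod has_moments_power moments insert) auto
  define e where "e i = expectation (\<lambda>\<omega>. (g j \<omega> ^ i * S \<omega> ^ (N - i)) * h \<omega>)" for i
  have int: "integrable M (\<lambda>\<omega>. (g j \<omega> ^ i * S \<omega> ^ k) * h \<omega>)" for i k
    by (intro has_moments_integrable has_moments_mult has_moments_power mh mj mS)
  have gj2: "expectation (\<lambda>\<omega>. (g j \<omega>)\<^sup>2) = 1" using insert.prems(2)[of j j] by (simp add: power2_eq_square)
  have Sj: "expectation (\<lambda>\<omega>. S \<omega> * g j \<omega>) = 0" using insert.prems(4)[of j] by simp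
  have key: "(\<Sum>i\<le>N. (real (N choose i) * e i) * t ^ i) = gauss_moment N * sqrt (s + t\<^sup>2) ^ N * P" for t
  proof -
    define S' where "S' \<omega> = t * g j \<omega> + S \<omega>" for \<omega>
    have S'G: "S' \<in> G"
      unfolding S'_def by (intro add_closed scale_closed gj SG)
    have "expectation (\<lambda>\<omega>. (S' \<omega>)\<^sup>2) =
        expectation (\<lambda>\<omega>. t\<^sup>2 * (g j \<omega>)\<^sup>2 + (S \<omega>)\<^sup>2 + (2 * t) * (S \<omega> * g j \<omega>))"
      by (intro Bochner_Integration.integral_cong refl) (simp add: S'_def power2_eq_square algebra_simps)
    also have "\<dots> = s + t\<^sup>2"
      using integrable_product[OF SG gj] integrable_square[OF gj gj] integrable_square[OF SG SG] gj2 Sj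
      by (simp add: s_def)
    finally have var: "expectation (\<lambda>\<omega>. (S' \<omega>)\<^sup>2) = s + t\<^sup>2" .
    have orth: "expectation (\<lambda>\<omega>. S' \<omega> * g i \<omega>) = 0" if "i \<in> I" for i
    proof -
      have gi: "g i \<in> G" using insert.prems(1) that by auto
      have "expectation (\<lambda>\<omega>. S' \<omega> * g i \<omega>) = expectation (\<lambda>\<omega>. t * (g j \<omega> * g i \<omega>) + S \<omega> * g i \<omega>)"
        by (intro Bochner_Integration.integral_cong refl) (simp add: S'_def algebra_simps)
      also have "\<dots> = t * expectation (\<lambda>\<omega>. g j \<omega> * g i \<omega>) + expectation (\<lambda>\<omega>. S \<omega> * g i \<omega>)"
        using integrable_product[OF gj gi] integrable_product[OF SG gi] by simp
      also have "\<dots> = 0"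
        using insert.prems(2)[of j i] insert.prems(4)[of i] insert.hyps that by auto
      finally show ?thesis .
    qed
    have "expectation (\<lambda>\<omega>. S' \<omega> ^ N * h \<omega>) = gauss_moment N * sqrt (s + t\<^sup>2) ^ N * P"
      unfolding h_def P_def var[symmetric]
      by (intro insert.IH insert.prems(1,2) S'G orth) auto
    moreover have "expectation (\<lambda>\<omega>. S' \<omega> ^ N * h \<omega>) =
        expectation (\<lambda>\<omega>. \<Sum>i\<le>N. (real (N choose i) * t ^ i) * ((g j \<omega> ^ i * S \<omega> ^ (N - i)) * h \<omega>))"
      by (intro Bochner_Integration.integral_cong refl)
         (simp add: S'_def binomial_ring sum_distrib_right sum_distrib_left power_mult_distrib mult_ac)
    moreover have "\<dots> = (\<Sum>i\<le>N. (real (N choose i) * e i) * t ^ i)"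
    proof -
      have "expectation (\<lambda>\<omega>. \<Sum>i\<le>N. (real (N choose i) * t ^ i) * ((g j \<omega> ^ i * S \<omega> ^ (N - i)) * h \<omega>)) =
          (\<Sum>i\<le>N. (real (N choose i) * t ^ i) * e i)"
        by (subst Bochner_Integration.integral_sum) (simp_all add: int e_def)
      then show ?thesis by (simp add: mult_ac)
    qed
    ultimately show ?thesis by simp
  qed
  have goal_eq: "expectation (\<lambda>\<omega>. S \<omega> ^ n * (\<Prod>i\<in>insert j I. g i \<omega> ^ a i)) = e m"
    unfolding e_def using insert.hyps
    by (intro Bochner_Integration.integral_cong refl) (simp add: h_def m_def N_def mult_ac)
  have "e m = gauss_moment n * sqrt s ^ n * (gauss_moment m * P)"
  proof (cases "even N")
    case False
    then have "gauss_moment N = 0" by (simp add: gauss_moment_def)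
    then have "\<forall>t. (\<Sum>i\<le>N. (real (N choose i) * e i) * t ^ i) = (\<Sum>i\<le>N. 0 * t ^ i)"
      using key by simp
    from polyfun_eq_coeffs[THEN iffD1, OF this] have "real (N choose m) * e m = 0"
      by (simp add: N_def m_def)
    then have "e m = 0" by (simp add: N_def m_def)
    moreover have "odd n \<or> odd m" using False by (auto simp: N_def m_def)
    ultimately show ?thesis by (auto simp: gauss_moment_def)
  next
    case True
    then obtain q where q: "N = 2 * q" by auto
    \<comment> \<open>For even \<open>N\<close> the root disappears:
      \<open>sqrt (s + t\<^sup>2) ^ N\<close> is the polynomial \<open>(s + t\<^sup>2) ^ q\<close>,
      and its coefficients, nonzero at even powers only, determine the mixed moments.\<close>
    define d where "d i = (if even i then real (q choose (i div 2)) * s ^ (q - i div 2) else 0) * (gauss_moment N * P)" for i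
    have "(\<Sum>i\<le>N. (real (N choose i) * e i) * t ^ i) = (\<Sum>i\<le>N. d i * t ^ i)" for t
    proof -
      have "(\<Sum>i\<le>N. (real (N choose i) * e i) * t ^ i) = (gauss_moment N * P) * (t\<^sup>2 + s) ^ q"
      proof -
        have "sqrt (s + t\<^sup>2) ^ N = (t\<^sup>2 + s) ^ q" using s0 by (simp add: q power_mult add.commute)
        then show ?thesis by (simp add: key)
      qed
      also have "\<dots> = (\<Sum>b\<le>q. d (2 * b) * t ^ (2 * b))"
        by (simp add: binomial_ring sum_distrib_left d_def power_mult[symmetric] mult_ac)
      also have "\<dots> = (\<Sum>i\<in>(\<lambda>b. 2 * b) ` {..q}. d i * t ^ i)"
        by (subst sum.reindex) (auto simp: inj_on_def)
      also have "\<dots> = (\<Sum>i\<le>N. d i * t ^ i)"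
        by (rule sum.mono_neutral_left) (auto simp: q d_def image_iff elim!: evenE)
      finally show ?thesis .
    qed
    from polyfun_eq_coeffs[THEN iffD1, OF allI[OF this]] have eq: "real (N choose m) * e m = d m"
      by (simp add: N_def m_def)
    have ch: "real (N choose m) > 0" by (simp add: N_def m_def)
    show ?thesis
    proof (cases "even m")
      case False
      then have "e m = 0" using eq ch by (simp add: d_def)
      then show ?thesis using False by (simp add: gauss_moment_def)
    next
      case True
      then obtain b where b: "m = 2 * b" by auto
      have bq: "b \<le> q" and n: "n = 2 * (q - b)" using q b by (auto simp: N_def m_def)
      have "real (N choose m) * e m = (real (N choose m) * (gauss_moment m * gauss_moment n)) * (s ^ (q - b) * P)"
        unfolding eq using gauss_moment_binomial[OF bq] by (simp add: d_def b q n mult_ac)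
      then have "e m = (gauss_moment m * gauss_moment n) * (s ^ (q - b) * P)"
        using ch by (simp add: mult.assoc)
      moreover have "sqrt s ^ n = s ^ (q - b)" using s0 by (simp add: n power_mult)
      ultimately show ?thesis by (simp add: mult_ac)
    qed
  qed
  then show ?case
    unfolding goal_eq using insert.hyps by (simp add: s_def P_def m_def)
qed

lemma moment_product:
  assumes "finite I"
    and "\<And>i. i \<in> I \<Longrightarrow> g i \<in> G"
    and "\<And>i j. i \<in> I \<Longrightarrow> j \<in> I \<Longrightarrow> expectation (\<lambda>\<omega>. g i \<omega> * g j \<omega>) = (if i = j then 1 else 0)"
  shows "expectation (\<lambda>\<omega>. \<Prod>i\<in>I. g i \<omega> ^ a i) = (\<Prod>i\<in>I. gauss_moment (a i))"
proof (cases "I = {}")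
  case False
  then obtain i where "i \<in> I" by auto
  then have "(\<lambda>\<omega>. 0 * g i \<omega>) \<in> G" using assms by (intro scale_closed) auto
  then show ?thesis
    using moment_product_with[OF assms, of "\<lambda>\<omega>. 0 * g i \<omega>" 0 a] by simp
qed (simp add: prob_space)

end


section \<open>Moments of weighted sums of squares\<close>

text \<open>The exponential generating series of the moments of \<open>v * g\<^sup>2\<close> for a
  standard Gaussian \<open>g\<close>, formally \<open>(1 - 2 * v * x) powr (-1/2)\<close>.\<close>

definition gauss_square_fps :: "real \<Rightarrow> real fps" where
  "gauss_square_fps v = Abs_fps (\<lambda>j. gauss_moment (2 * j) * v ^ j / fact j)"

text \<open>The moment of order \<open>p\<close> of a sum of \<open>v k * (g k)\<^sup>2\<close> with
  independent standard Gaussians \<open>g k\<close>. Independence is encoded by multiplying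
  generating series, so no random variables are needed to state it.\<close>

definition quad_moment :: "('i \<Rightarrow> real) \<Rightarrow> 'i set \<Rightarrow> nat \<Rightarrow> real" where
  "quad_moment v K p = fact p * fps_nth (\<Prod>k\<in>K. gauss_square_fps (v k)) p"

lemma quad_moment_0 [simp]: "quad_moment v K 0 = 1"
proof (cases "finite K")
  case True
  then have "fps_nth (\<Prod>k\<in>K. gauss_square_fps (v k)) 0 = 1"
    by (induction K rule: finite_induct) (simp_all add: gauss_square_fps_def)
  then show ?thesis by (simp add: quad_moment_def)
qed (simp add: quad_moment_def)

lemma quad_moment_insert:
  assumes "finite K" "k \<notin> K"
  shows "quad_moment v (insert k K) p =
    (\<Sum>j\<le>p. real (p choose j) * v k ^ j * gauss_moment (2 * j) * quad_moment v K (p - j))"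
  using assms
  by (simp add: quad_moment_def fps_mult_nth atLeast0AtMost sum_distrib_left gauss_square_fps_def)
     (intro sum.cong refl, simp add: binomial_fact field_simps)

text \<open>A substitute for independence in terms of moments: the weight \<open>H\<close> factors
  out of the expectation of every monomial in the \<open>g k\<close>, which leaves the moments of
  independent standard Gaussians.\<close>

definition (in prob_space) decoupled :: "('a \<Rightarrow> real) \<Rightarrow> ('i \<Rightarrow> 'a \<Rightarrow> real) \<Rightarrow> 'i set \<Rightarrow> bool" where
  "decoupled H g K \<longleftrightarrow>
     (\<forall>a. expectation (\<lambda>\<omega>. H \<omega> * (\<Prod>k\<in>K. g k \<omega> ^ a k)) = expectation H * (\<Prod>k\<in>K. gauss_moment (a k)))"

text \<open>Induction on \<open>K\<close>: the term of a new index \<open>k\<close> is split off by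
  the binomial theorem, and its even powers are moved into the monomial over \<open>J\<close>. Hence
  \<open>J\<close>, \<open>p\<close> and the exponents vary in the induction. The first conclusion
  makes a power of one quadratic form the weight for the next.\<close>

lemma (in prob_space)
  assumes K: "finite K" and J: "finite J" "K \<inter> J = {}"
    and g: "\<And>i. i \<in> K \<union> J \<Longrightarrow> has_moments M (g i)" and H: "has_moments M H"
    and dec: "decoupled H g (K \<union> J)"
  shows decoupled_quad: "decoupled (\<lambda>\<omega>. H \<omega> * (\<Sum>k\<in>K. v k * (g k \<omega>)\<^sup>2) ^ p) g J"
    and expectation_decoupled_quad:
      "expectation (\<lambda>\<omega>. H \<omega> * (\<Sum>k\<in>K. v k * (g k \<omega>)\<^sup>2) ^ p) = expectation H * quad_moment v K p"
proof -
  have core: "expectation (\<lambda>\<omega>. (H \<omega> * (\<Sum>k\<in>K. v k * (g k \<omega>)\<^sup>2) ^ p) * (\<Prod>k\<in>J. g k \<omega> ^ a k)) =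
      expectation H * quad_moment v K p * (\<Prod>k\<in>J. gauss_moment (a k))" for a
    using K J g dec
  proof (induction K arbitrary: J p a rule: finite_induct)
    case empty
    then show ?case
      by (cases p) (auto simp: decoupled_def quad_moment_def)
  next
    case (insert k K)
    define R where "R \<omega> = (\<Sum>k\<in>K. v k * (g k \<omega>)\<^sup>2)" for \<omega>
    have mR: "has_moments M R"
      unfolding R_def by (intro has_moments_sum has_moments_cmult has_moments_power insert) auto
    have kJ: "k \<notin> J" using insert by auto
    have "expectation (\<lambda>\<omega>. (H \<omega> * (\<Sum>k\<in>insert k K. v k * (g k \<omega>)\<^sup>2) ^ p) * (\<Prod>k\<in>J. g k \<omega> ^ a k)) =
      expectation (\<lambda>\<omega>. \<Sum>j\<le>p. (real (p choose j) * v k ^ j) *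
         ((H \<omega> * R \<omega> ^ (p - j)) * (\<Prod>i\<in>insert k J. g i \<omega> ^ (a(k := 2 * j)) i)))"
    proof (intro Bochner_Integration.integral_cong refl)
      fix \<omega>
      have "(\<Prod>i\<in>insert k J. g i \<omega> ^ (a(k := 2 * j)) i) = ((g k \<omega>)\<^sup>2) ^ j * (\<Prod>i\<in>J. g i \<omega> ^ a i)" for j
      proof -
        have "(\<Prod>i\<in>J. g i \<omega> ^ (a(k := 2 * j)) i) = (\<Prod>i\<in>J. g i \<omega> ^ a i)"
          using kJ by (intro prod.cong) auto
        then show ?thesis using insert.prems(1) kJ by (simp add: power_mult)
      qed
      then show "(H \<omega> * (\<Sum>k\<in>insert k K. v k * (g k \<omega>)\<^sup>2) ^ p) * (\<Prod>k\<in>J. g k \<omega> ^ a k) =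
        (\<Sum>j\<le>p. (real (p choose j) * v k ^ j) *
         ((H \<omega> * R \<omega> ^ (p - j)) * (\<Prod>i\<in>insert k J. g i \<omega> ^ (a(k := 2 * j)) i)))"
        using insert.hyps
        by (simp add: R_def[symmetric] binomial_ring sum_distrib_left sum_distrib_right
            power_mult_distrib mult_ac)
    qed
    also have "\<dots> = (\<Sum>j\<le>p. (real (p choose j) * v k ^ j) *
         expectation (\<lambda>\<omega>. (H \<omega> * R \<omega> ^ (p - j)) * (\<Prod>i\<in>insert k J. g i \<omega> ^ (a(k := 2 * j)) i)))"
    proof (subst Bochner_Integration.integral_sum)
      fix j
      have "has_moments M (\<lambda>\<omega>. (H \<omega> * R \<omega> ^ (p - j)) * (\<Prod>i\<in>insert k J. g i \<omega> ^ (a(k := 2 * j)) i))"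
        by (intro has_moments_mult has_moments_power has_moments_prod H mR insert.prems) auto
      then show "integrable M (\<lambda>\<omega>. (real (p choose j) * v k ^ j) * 
          ((H \<omega> * R \<omega> ^ (p - j)) * (\<Prod>i\<in>insert k J. g i \<omega> ^ (a(k := 2 * j)) i)))"
        by (intro integrable_mult_right has_moments_integrable)
    qed simp
    also have "\<dots> = (\<Sum>j\<le>p. (real (p choose j) * v k ^ j) *
        (expectation H * quad_moment v K (p - j) * (\<Prod>i\<in>insert k J. gauss_moment ((a(k := 2 * j)) i))))"
    proof (intro sum.cong refl arg_cong2[of _ _ _ _ "(*)"])
      fix j
      have "K \<inter> insert k J = {}" "K \<union> insert k J = insert k K \<union> J" using insert by auto
      then show "expectation (\<lambda>\<omega>. (H \<omega> * R \<omega> ^ (p - j)) * (\<Prod>i\<in>insert k J. g i \<omega> ^ (a(k := 2 * j)) i)) =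
        expectation H * quad_moment v K (p - j) * (\<Prod>i\<in>insert k J. gauss_moment ((a(k := 2 * j)) i))"
        unfolding R_def using insert.prems by (intro insert.IH) auto
    qed
    also have "\<dots> = expectation H * quad_moment v (insert k K) p * (\<Prod>k\<in>J. gauss_moment (a k))"
    proof -
      have "(\<Prod>i\<in>insert k J. gauss_moment ((a(k := 2 * j)) i)) = gauss_moment (2 * j) * (\<Prod>i\<in>J. gauss_moment (a i))" for j
      proof -
        have "(\<Prod>i\<in>J. gauss_moment ((a(k := 2 * j)) i)) = (\<Prod>i\<in>J. gauss_moment (a i))"
          using kJ by (intro prod.cong) auto
        then show ?thesis using insert.prems(1) kJ by simp
      qed
      then show ?thesis
        using insert.hyps
        by (simp add: quad_moment_insert sum_distrib_left sum_distrib_right mult_ac)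
    qed
    finally show ?case .
  qed
  show *: "expectation (\<lambda>\<omega>. H \<omega> * (\<Sum>k\<in>K. v k * (g k \<omega>)\<^sup>2) ^ p) = expectation H * quad_moment v K p"
    using core[of "\<lambda>_. 0"] by simp
  show "decoupled (\<lambda>\<omega>. H \<omega> * (\<Sum>k\<in>K. v k * (g k \<omega>)\<^sup>2) ^ p) g J"
    unfolding decoupled_def * using core by blast
qed

text \<open>The logarithmic derivative of \<open>(1 - 2 * v * x) powr (-1/2)\<close> is
  \<open>v / (1 - 2 * v * x)\<close>, a geometric series. The identity is checked on
  coefficients.\<close>

lemma gauss_square_fps_deriv:
  "fps_deriv (gauss_square_fps v) = Abs_fps (\<lambda>l. 2 ^ l * v ^ Suc l) * gauss_square_fps v"
proof (rule fps_ext)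
  fix n
  define c where "c j = gauss_moment (2 * j) * v ^ j / fact j" for j
  have step: "real (Suc j) * c (Suc j) = v * (1 + 2 * real j) * c j" for j
  proof -
    have "gauss_moment (2 * Suc j) = real (2 * j + 1) * gauss_moment (2 * j)"
    proof -
      have f1: "fact (2 * Suc j) = fact (2 * j) * ((2 * real j + 1) * (2 * (real j + 1)))"
        by (simp add: algebra_simps)
      have f2: "(2::real) ^ Suc j * fact (Suc j) = (2 * (real j + 1)) * (2 ^ j * fact j)"
        by (simp add: algebra_simps)
      have "A * (B * C) / (C * D) = B * (A / D)" if "C \<noteq> 0" for A B C D :: real
        using that by simp
      from this[of "2 * (real j + 1)"] show ?thesis
        unfolding gauss_moment_even f1 f2 by simp
    qed
    then have "real (Suc j) * c (Suc j) =
        real (Suc j) * ((real (2 * j + 1) * gauss_moment (2 * j) * v ^ Suc j) / (real (Suc j) * fact j))"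
      by (simp only: c_def fact_Suc)
    also have "\<dots> = real (2 * j + 1) * gauss_moment (2 * j) * v ^ Suc j / fact j"
      by (simp del: of_nat_Suc power_Suc)
    finally show ?thesis by (simp add: c_def mult_ac)
  qed
  \<comment> \<open>The convolution satisfies a one-step recursion: without its term
    \<open>l = 0\<close> it is \<open>2 * v\<close> times the preceding convolution.\<close>
  have "(\<Sum>l=0..n. (2 ^ l * v ^ Suc l) * c (n - l)) = real (Suc n) * c (Suc n)"
  proof (induction n)
    case 0
    show ?case using step[of 0] by simp
  next
    case (Suc n)
    have "(\<Sum>l=0..Suc n. (2 ^ l * v ^ Suc l) * c (Suc n - l)) =
        v * c (Suc n) + (\<Sum>l=0..n. (2 ^ Suc l * v ^ Suc (Suc l)) * c (n - l))"
      by (subst sum.atLeast0_atMost_Suc_shift) simp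
    also have "(\<Sum>l=0..n. (2 ^ Suc l * v ^ Suc (Suc l)) * c (n - l)) =
        2 * v * (\<Sum>l=0..n. (2 ^ l * v ^ Suc l) * c (n - l))"
      by (simp add: sum_distrib_left mult_ac)
    also have "v * c (Suc n) + \<dots> = v * (1 + 2 * real (Suc n)) * c (Suc n)"
      unfolding Suc.IH by (simp add: algebra_simps)
    finally show ?case using step[of "Suc n"] by simp
  qed
  then show "fps_nth (fps_deriv (gauss_square_fps v)) n =
      fps_nth (Abs_fps (\<lambda>l. 2 ^ l * v ^ Suc l) * gauss_square_fps v) n"
    by (simp add: fps_mult_nth gauss_square_fps_def c_def)
qed

text \<open>The recursion from cumulants to moments. Logarithmic derivatives of the factors add up,
  and \<open>2 ^ l * fact l * (\<Sum>k\<in>K. v k ^ Suc l)\<close> is the cumulant of order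
  \<open>Suc l\<close>.\<close>

lemma quad_moment_Suc:
  assumes "finite K"
  shows "quad_moment v K (Suc p) =
    (\<Sum>l\<le>p. real (p choose l) * (2 ^ l * fact l * (\<Sum>k\<in>K. v k ^ Suc l)) * quad_moment v K (p - l))"
proof -
  define L where "L k = Abs_fps (\<lambda>l. 2 ^ l * v k ^ Suc l)" for k
  define B where "B K = (\<Prod>k\<in>K. gauss_square_fps (v k))" for K
  have "fps_deriv (B K) = (\<Sum>k\<in>K. L k) * B K"
    using assms
  proof (induction K rule: finite_induct)
    case (insert k K)
    have "fps_deriv (B (insert k K)) = L k * gauss_square_fps (v k) * B K + gauss_square_fps (v k) * ((\<Sum>k\<in>K. L k) * B K)"
      using insert by (simp add: B_def gauss_square_fps_deriv L_def algebra_simps)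
    then show ?case using insert.hyps by (simp add: B_def algebra_simps)
  qed (simp add: B_def)
  then have "fps_nth (fps_deriv (B K)) p = fps_nth ((\<Sum>k\<in>K. L k) * B K) p" by simp
  then have c: "real (Suc p) * fps_nth (B K) (Suc p) =
      (\<Sum>l\<le>p. 2 ^ l * (\<Sum>k\<in>K. v k ^ Suc l) * fps_nth (B K) (p - l))"
    by (simp add: fps_mult_nth fps_sum_nth L_def atLeast0AtMost sum_distrib_left)
  have "quad_moment v K (Suc p) = fact p * (real (Suc p) * fps_nth (B K) (Suc p))"
    by (simp add: quad_moment_def B_def)
  also have "\<dots> = (\<Sum>l\<le>p. real (p choose l) * (2 ^ l * fact l * (\<Sum>k\<in>K. v k ^ Suc l)) * quad_moment v K (p - l))"
  proof -
    have "fact p * (2 ^ l * s * b) = real (p choose l) * (2 ^ l * fact l * s) * (fact (p - l) * b)"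
      if "l \<le> p" for l and s b :: real
      using that by (simp add: binomial_fact)
    then show ?thesis
      unfolding c quad_moment_def B_def[symmetric] sum_distrib_left[of "fact p"]
      by (intro sum.cong refl) simp
  qed
  finally show ?thesis .
qed


section \<open>Complete Bell polynomials\<close>

text \<open>The index set of \<open>bell\<close>, with functions that are 0 instead of undefined
  outside \<open>{1..p}\<close>. Parts of different totals then live in one function type, and the
  weight may be a product up to any \<open>N \<ge> p\<close>, since the additional factors are
  1.\<close>

definition bell_parts :: "nat \<Rightarrow> (nat \<Rightarrow> nat) set" where
  "bell_parts p = {s. (\<forall>l. l \<notin> {1..p} \<longrightarrow> s l = 0) \<and> (\<Sum>l = 1..p. l * s l) = p}"

definition bell_weight :: "nat \<Rightarrow> (nat \<Rightarrow> real) \<Rightarrow> (nat \<Rightarrow> nat) \<Rightarrow> real" where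
  "bell_weight N x s = (\<Prod>l = 1..N. (x l / fact l) ^ s l / fact (s l))"

lemma bell_parts_le:
  assumes "p \<le> N"
  shows "bell_parts p = {s. (\<forall>l. l \<notin> {1..N} \<longrightarrow> s l = 0) \<and> (\<Sum>l = 1..N. l * s l) = p}"
proof (intro set_eqI iffI)
  fix s assume s: "s \<in> bell_parts p"
  have "(\<Sum>l = 1..N. l * s l) = (\<Sum>l = 1..p. l * s l)"
    using s assms by (intro sum.mono_neutral_right) (auto simp: bell_parts_def)
  then show "s \<in> {s. (\<forall>l. l \<notin> {1..N} \<longrightarrow> s l = 0) \<and> (\<Sum>l = 1..N. l * s l) = p}"
    using s assms by (auto simp: bell_parts_def)
next
  fix s assume s: "s \<in> {s. (\<forall>l. l \<notin> {1..N} \<longrightarrow> s l = 0) \<and> (\<Sum>l = 1..N. l * s l) = p}"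
  have z: "s l = 0" if "l \<notin> {1..p}" for l
  proof (cases "l \<in> {1..N}")
    case True
    have "l * s l \<le> (\<Sum>l = 1..N. l * s l)"
      using True by (intro member_le_sum) auto
    then have "l * s l \<le> p" using s by simp
    moreover have "p < l" using True that by auto
    ultimately show ?thesis by (cases "s l") auto
  qed (use s in auto)
  have "(\<Sum>l = 1..N. l * s l) = (\<Sum>l = 1..p. l * s l)"
    using z assms by (intro sum.mono_neutral_right) auto
  then show "s \<in> bell_parts p" using s z by (auto simp: bell_parts_def)
qed

lemma bell_weight_le:
  assumes "p \<le> N" "s \<in> bell_parts p"
  shows "bell_weight N x s = bell_weight p x s"
  unfolding bell_weight_def
  using assms by (intro prod.mono_neutral_right) (auto simp: bell_parts_def)

lemma bell_eq: "bell p x = fact p * (\<Sum>s\<in>bell_parts p. bell_weight p x s)"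
proof -
  have "bell p x = (\<Sum>s\<in>bell_parts p. fact p * bell_weight p x s)"
    unfolding bell_def
  proof (rule sum.reindex_bij_witness[of _ "\<lambda>s. restrict s {1..p}" "\<lambda>s l. if l \<in> {1..p} then s l else 0"])
    fix s assume s: "s \<in> bell_indices p"
    show "restrict (\<lambda>l. if l \<in> {1..p} then s l else 0) {1..p} = s"
      using s by (auto simp: bell_indices_def PiE_iff extensional_def restrict_def fun_eq_iff)
    show "(\<lambda>l. if l \<in> {1..p} then s l else 0) \<in> bell_parts p"
      using s by (auto simp: bell_indices_def bell_parts_def)
    have "bell_weight p x (\<lambda>l. if l \<in> {1..p} then s l else 0) =
        (\<Prod>l = 1..p. (x l ^ s l) / (fact l ^ s l * fact (s l)))"
      unfolding bell_weight_def by (intro prod.cong) (auto simp: power_divide)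
    then show "fact p * bell_weight p x (\<lambda>l. if l \<in> {1..p} then s l else 0) =
        fact p / (\<Prod>l = 1..p. fact l ^ s l * fact (s l)) * (\<Prod>l = 1..p. x l ^ s l)"
      by (simp add: prod_dividef)
  next
    fix s assume s: "s \<in> bell_parts p"
    show "(\<lambda>l. if l \<in> {1..p} then restrict s {1..p} l else 0) = s"
      using s by (auto simp: bell_parts_def fun_eq_iff)
    show "restrict s {1..p} \<in> bell_indices p"
      using s by (auto simp: bell_parts_def bell_indices_def)
  qed
  then show ?thesis by (simp add: sum_distrib_left)
qed

lemma finite_bell_parts: "finite (bell_parts p)"
proof (rule finite_subset)
  show "bell_parts p \<subseteq> (\<lambda>s l. if l \<in> {1..p} then s l else 0) ` bell_indices p"
  proof
    fix s assume s: "s \<in> bell_parts p"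
    have "s = (\<lambda>l. if l \<in> {1..p} then restrict s {1..p} l else 0)"
      using s by (auto simp: bell_parts_def fun_eq_iff)
    moreover have "restrict s {1..p} \<in> bell_indices p"
      using s by (auto simp: bell_parts_def bell_indices_def)
    ultimately show "s \<in> (\<lambda>s l. if l \<in> {1..p} then s l else 0) ` bell_indices p" by blast
  qed
qed (use finite_bell_indices in auto)

lemma bell_0 [simp]: "bell 0 x = 1"
proof -
  have "bell_parts 0 = {\<lambda>_. 0}" by (auto simp: bell_parts_def)
  then show ?thesis by (simp add: bell_eq bell_weight_def)
qed

text \<open>Writing \<open>p = \<Sum>l * s l\<close> and lowering \<open>s l\<close> by one in the \<open>l\<close>-th summand.\<close>

lemma bell_Suc: "bell (Suc p) x = (\<Sum>l\<le>p. real (p choose l) * x (Suc l) * bell (p - l) x)"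
proof -
  define N where "N = Suc p"
  define w where "w = bell_weight N x"
  have part: "(\<Sum>s\<in>bell_parts N. real (l * s l) * w s) =
      x l / fact (l - 1) * (\<Sum>s\<in>bell_parts (N - l). w s)" if l: "l \<in> {1..N}" for l
  proof -
    have PN: "bell_parts N = {s. (\<forall>l. l \<notin> {1..N} \<longrightarrow> s l = 0) \<and> (\<Sum>l = 1..N. l * s l) = N}"
      by (simp add: bell_parts_def)
    have PNl: "bell_parts (N - l) = {s. (\<forall>l. l \<notin> {1..N} \<longrightarrow> s l = 0) \<and> (\<Sum>l = 1..N. l * s l) = N - l}"
      by (rule bell_parts_le) simp
    have sums: "(\<Sum>i = 1..N. i * (s(l := s l + 1)) i) = (\<Sum>i = 1..N. i * s i) + l" for s
    proof -
      have "(\<Sum>i = 1..N. i * (s(l := s l + 1)) i) = l * (s l + 1) + (\<Sum>i\<in>{1..N} - {l}. i * (s(l := s l + 1)) i)"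
        using l by (subst sum.remove[of _ l]) auto
      also have "(\<Sum>i\<in>{1..N} - {l}. i * (s(l := s l + 1)) i) = (\<Sum>i\<in>{1..N} - {l}. i * s i)"
        by (intro sum.cong) auto
      also have "l * (s l + 1) + \<dots> = (\<Sum>i = 1..N. i * s i) + l"
        using l by (subst sum.remove[of "{1..N}" l]) auto
      finally show ?thesis .
    qed
    have weights: "real (s l + 1) * w (s(l := s l + 1)) = x l / fact l * w s" for s
    proof -
      have "w (s(l := s l + 1)) = (x l / fact l) ^ (s l + 1) / fact (s l + 1) *
          (\<Prod>i\<in>{1..N} - {l}. (x i / fact i) ^ (s(l := s l + 1)) i / fact ((s(l := s l + 1)) i))"
        unfolding w_def bell_weight_def using l by (subst prod.remove[of _ l]) auto
      also have "(\<Prod>i\<in>{1..N} - {l}. (x i / fact i) ^ (s(l := s l + 1)) i / fact ((s(l := s l + 1)) i)) =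
          (\<Prod>i\<in>{1..N} - {l}. (x i / fact i) ^ s i / fact (s i))"
        by (intro prod.cong) auto
      finally have 1: "w (s(l := s l + 1)) = (x l / fact l) ^ (s l + 1) / fact (s l + 1) *
          (\<Prod>i\<in>{1..N} - {l}. (x i / fact i) ^ s i / fact (s i))" .
      have 2: "w s = (x l / fact l) ^ s l / fact (s l) * (\<Prod>i\<in>{1..N} - {l}. (x i / fact i) ^ s i / fact (s i))"
        unfolding w_def bell_weight_def using l by (subst prod.remove[of _ l]) auto
      have f: "(fact (s l + 1) :: real) = real (s l + 1) * fact (s l)" by simp
      have "c * (y ^ (s l + 1) / (c * f) * P) = y * (y ^ s l / f * P)" if "c > 0" for c y f P :: real
        using that by (simp add: field_simps)
      from this[of "real (s l + 1)"] show ?thesis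
        unfolding 1 2 f by simp
    qed
    have "(\<Sum>s\<in>bell_parts N. real (l * s l) * w s) = (\<Sum>s\<in>{s\<in>bell_parts N. s l \<noteq> 0}. real (l * s l) * w s)"
      by (intro sum.mono_neutral_right finite_bell_parts) auto
    also have "\<dots> = (\<Sum>s\<in>bell_parts (N - l). real (l * (s l + 1)) * w (s(l := s l + 1)))"
    proof (rule sum.reindex_bij_witness[of _ "\<lambda>s. s(l := s l + 1)" "\<lambda>s. s(l := s l - 1)"])
      fix s assume s: "s \<in> {s\<in>bell_parts N. s l \<noteq> 0}"
      then have up: "(s(l := s l - 1))(l := (s(l := s l - 1)) l + 1) = s" by (auto simp: fun_eq_iff)
      then show "(s(l := s l - 1))(l := (s(l := s l - 1)) l + 1) = s" .
      show "s(l := s l - 1) \<in> bell_parts (N - l)"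
        using s sums[of "s(l := s l - 1)"] l unfolding up by (auto simp: PN PNl)
      show "real (l * ((s(l := s l - 1)) l + 1)) * w ((s(l := s l - 1))(l := (s(l := s l - 1)) l + 1)) = real (l * s l) * w s"
        unfolding up using s by auto
    next
      fix s assume s: "s \<in> bell_parts (N - l)"
      show "(s(l := s l + 1))(l := (s(l := s l + 1)) l - 1) = s" by auto
      show "s(l := s l + 1) \<in> {s\<in>bell_parts N. s l \<noteq> 0}"
        using s l sums[of s] unfolding PN PNl by (auto simp: fun_upd_def)
    qed
    also have "\<dots> = (\<Sum>s\<in>bell_parts (N - l). x l / fact (l - 1) * w s)"
    proof (intro sum.cong refl)
      fix s
      have fl: "(fact l :: real) = real l * fact (l - 1)" using l by (simp add: fact_reduce)
      have "real (l * (s l + 1)) * w (s(l := s l + 1)) = real l * (real (s l + 1) * w (s(l := s l + 1)))"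
        by (simp only: of_nat_mult mult.assoc)
      also have "\<dots> = x l / fact (l - 1) * w s"
        unfolding weights using l by (simp add: fl)
      finally show "real (l * (s l + 1)) * w (s(l := s l + 1)) = x l / fact (l - 1) * w s" .
    qed
    finally show ?thesis by (simp add: sum_distrib_left)
  qed
  have "bell (Suc p) x = fact p * (\<Sum>s\<in>bell_parts N. real N * w s)"
    by (simp add: bell_eq N_def w_def sum_distrib_left mult_ac)
  also have "(\<Sum>s\<in>bell_parts N. real N * w s) = (\<Sum>s\<in>bell_parts N. \<Sum>l = 1..N. real (l * s l) * w s)"
  proof (intro sum.cong refl)
    fix s assume "s \<in> bell_parts N"
    then have "N = (\<Sum>l = 1..N. l * s l)" by (simp add: bell_parts_def)
    then have "real N = (\<Sum>l = 1..N. real (l * s l))" by (metis of_nat_sum)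
    then show "real N * w s = (\<Sum>l = 1..N. real (l * s l) * w s)" by (simp only: sum_distrib_right)
  qed
  also have "\<dots> = (\<Sum>l = 1..N. x l / fact (l - 1) * (\<Sum>s\<in>bell_parts (N - l). w s))"
    by (subst sum.swap) (intro sum.cong refl part)
  also have "\<dots> = (\<Sum>l\<le>p. x (Suc l) / fact l * (\<Sum>s\<in>bell_parts (p - l). w s))"
    by (rule sum.reindex_bij_witness[of _ Suc "\<lambda>l. l - 1"]) (auto simp: N_def)
  also have "fact p * \<dots> = (\<Sum>l\<le>p. real (p choose l) * x (Suc l) * bell (p - l) x)"
    unfolding sum_distrib_left[of "fact p"]
  proof (intro sum.cong refl)
    fix l assume l: "l \<in> {..p}"
    have "(\<Sum>s\<in>bell_parts (p - l). w s) = (\<Sum>s\<in>bell_parts (p - l). bell_weight (p - l) x s)"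
      unfolding w_def by (intro sum.cong refl bell_weight_le) (simp add: N_def)
    then have "bell (p - l) x = fact (p - l) * (\<Sum>s\<in>bell_parts (p - l). w s)" by (simp add: bell_eq)
    then have "(\<Sum>s\<in>bell_parts (p - l). w s) = bell (p - l) x / fact (p - l)" by simp
    moreover have "real (p choose l) = fact p / (fact l * fact (p - l))"
      using l by (simp add: binomial_fact)
    ultimately show "fact p * (x (Suc l) / fact l * (\<Sum>s\<in>bell_parts (p - l). w s)) =
        real (p choose l) * x (Suc l) * bell (p - l) x"
      by simp
  qed
  finally show ?thesis .
qed

text \<open>Weighted homogeneity: \<open>x l\<close> has weight \<open>l\<close>. In the recursion
  the weights \<open>Suc l\<close> and \<open>m - l\<close> add up to \<open>Suc m\<close>.\<close>

lemma bell_scale: "bell p (\<lambda>l. c ^ l * x l) = c ^ p * bell p x"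
proof (induction p rule: less_induct)
  case (less p)
  show ?case
  proof (cases p)
    case (Suc m)
    have "bell p (\<lambda>l. c ^ l * x l) = (\<Sum>l\<le>m. real (m choose l) * (c ^ Suc l * x (Suc l)) * (c ^ (m - l) * bell (m - l) x))"
      unfolding Suc bell_Suc by (intro sum.cong refl) (simp add: less.IH Suc)
    also have "\<dots> = (\<Sum>l\<le>m. c ^ Suc m * (real (m choose l) * x (Suc l) * bell (m - l) x))"
    proof (intro sum.cong refl)
      fix l assume "l \<in> {..m}"
      then have "Suc m = Suc l + (m - l)" by simp
      then have "c ^ Suc m = c ^ Suc l * c ^ (m - l)" by (metis power_add)
      then show "real (m choose l) * (c ^ Suc l * x (Suc l)) * (c ^ (m - l) * bell (m - l) x) =
          c ^ Suc m * (real (m choose l) * x (Suc l) * bell (m - l) x)" by (simp only: mult_ac)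
    qed
    finally show ?thesis by (simp add: Suc bell_Suc sum_distrib_left)
  qed simp
qed

lemma tendsto_bell:
  assumes "\<And>l. 1 \<le> l \<Longrightarrow> ((\<lambda>n. x n l) \<longlongrightarrow> y l) F"
  shows "((\<lambda>n. bell p (x n)) \<longlongrightarrow> bell p y) F"
  unfolding bell_def using assms by (intro tendsto_intros) auto

text \<open>Moments are complete Bell polynomials in the cumulants, because both satisfy the same
  recursion from the value 1. The cumulant of order \<open>l\<close> is
  \<open>2 ^ l * (fact (l - 1) / 2)\<close> times a power sum, and homogeneity extracts the powers
  of 2.\<close>

lemma quad_moment_bell:
  assumes "finite K"
  shows "quad_moment v K p = 2 ^ p * bell p (\<lambda>l. fact (l - 1) / 2 * (\<Sum>k\<in>K. v k ^ l))"
proof -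
  have "quad_moment v K p = bell p (\<lambda>l. 2 ^ l * (fact (l - 1) / 2 * (\<Sum>k\<in>K. v k ^ l)))"
  proof (induction p rule: less_induct)
    case (less p)
    show ?case
    proof (cases p)
      case (Suc m)
      show ?thesis
        unfolding Suc bell_Suc quad_moment_Suc[OF assms]
        by (intro sum.cong refl) (simp add: less.IH Suc)
    qed simp
  qed
  also have "\<dots> = 2 ^ p * bell p (\<lambda>l. fact (l - 1) / 2 * (\<Sum>k\<in>K. v k ^ l))"
    by (rule bell_scale)
  finally show ?thesis .
qed


section \<open>Elementary inequalities for powers\<close>

text \<open>Jensen's inequality for the convex function \<open>x ^ m\<close>, with the weights
  divided by their total.\<close>

lemma power_weighted_sum_le:
  fixes c y :: "'i \<Rightarrow> real"
  assumes "finite I" "1 \<le> m" and c: "\<And>i. i \<in> I \<Longrightarrow> 0 \<le> c i" and y: "\<And>i. i \<in> I \<Longrightarrow> 0 \<le> y i"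
  shows "(\<Sum>i\<in>I. c i * y i) ^ m \<le> (\<Sum>i\<in>I. c i) ^ (m - 1) * (\<Sum>i\<in>I. c i * y i ^ m)"
proof (cases "(\<Sum>i\<in>I. c i) = 0")
  case True
  then have "\<forall>i\<in>I. c i = 0" using assms by (subst (asm) sum_nonneg_eq_0_iff) auto
  then show ?thesis using assms by (cases m) auto
next
  case False
  define C where "C = (\<Sum>i\<in>I. c i)"
  have C: "C > 0" using False sum_nonneg[of I c] c by (simp add: C_def order.not_eq_order_implies_strict)
  have "I \<noteq> {}" using False by auto
  have "convex_on {0::real..} (\<lambda>x. x ^ m)"
    using convex_power_odd[of m] convex_on_subset[OF convex_power_even[of m]] by (cases "even m") auto
  from convex_on_sum[OF assms(1) \<open>I \<noteq> {}\<close> this, of "\<lambda>i. c i / C" y]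
  have "(\<Sum>i\<in>I. c i / C * y i) ^ m \<le> (\<Sum>i\<in>I. c i / C * y i ^ m)"
    using c y C by (simp add: sum_divide_distrib[symmetric] C_def[symmetric])
  then have "(\<Sum>i\<in>I. c i * y i) ^ m / C ^ m \<le> (\<Sum>i\<in>I. c i * y i ^ m) / C"
    by (simp add: sum_divide_distrib[symmetric] power_divide)
  moreover have "C ^ m = C ^ (m - 1) * C" using assms(2) by (cases m) auto
  ultimately show ?thesis
    using C unfolding C_def[symmetric] by (simp add: divide_simps mult_ac)
qed

lemma abs_power_diff_le:
  fixes x y :: real
  assumes "0 \<le> x" "0 \<le> y"
  shows "\<bar>x ^ p - y ^ p\<bar> \<le> real p * \<bar>x - y\<bar> * (x + y) ^ (p - 1)"
proof (induction p)
  case (Suc p)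
  show ?case
  proof (cases "p = 0")
    case False
    have "x ^ Suc p - y ^ Suc p = x * (x ^ p - y ^ p) + (x - y) * y ^ p" by (simp add: algebra_simps)
    then have "\<bar>x ^ Suc p - y ^ Suc p\<bar> \<le> \<bar>x * (x ^ p - y ^ p)\<bar> + \<bar>(x - y) * y ^ p\<bar>"
      using abs_triangle_ineq[of "x * (x ^ p - y ^ p)" "(x - y) * y ^ p"] by metis
    also have "\<dots> = x * \<bar>x ^ p - y ^ p\<bar> + \<bar>x - y\<bar> * y ^ p"
      using assms by (simp add: abs_mult)
    also have "\<dots> \<le> (x + y) * (real p * \<bar>x - y\<bar> * (x + y) ^ (p - 1)) + \<bar>x - y\<bar> * (x + y) ^ p"
      using assms by (intro add_mono mult_mono Suc.IH power_mono) auto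
    also have "(x + y) * (real p * \<bar>x - y\<bar> * (x + y) ^ (p - 1)) = real p * \<bar>x - y\<bar> * (x + y) ^ p"
      using False by (cases p) auto
    finally show ?thesis by (simp add: algebra_simps)
  qed simp
qed simp

text \<open>Makes closeness in mean sufficient for closeness of powers. Where
  \<open>x + y \<le> L\<close> the power is Lipschitz with constant \<open>p * L ^ (p - 1)\<close>;
  elsewhere an extra factor \<open>(x + y) / L \<ge> 1\<close> is spent, which leaves moments of
  order \<open>Suc p\<close> with a small coefficient.\<close>

lemma abs_power_diff_le_cutoff:
  fixes x y L :: real
  assumes x: "0 \<le> x" and y: "0 \<le> y" and L: "0 < L" and p: "1 \<le> p"
  shows "\<bar>x ^ p - y ^ p\<bar> \<le>
    real p * L ^ (p - 1) * \<bar>x - y\<bar> + (real p * 2 ^ p / L) * (x ^ Suc p + y ^ Suc p)"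
proof -
  define S where "S = x + y"
  have S: "0 \<le> S" "\<bar>x - y\<bar> \<le> S" using x y by (auto simp: S_def)
  have "\<bar>x - y\<bar> * S ^ (p - 1) \<le> L ^ (p - 1) * \<bar>x - y\<bar> + S ^ Suc p / L"
  proof (cases "S \<le> L")
    case True
    then have "S ^ (p - 1) \<le> L ^ (p - 1)" using S by (intro power_mono) auto
    then have "\<bar>x - y\<bar> * S ^ (p - 1) \<le> \<bar>x - y\<bar> * L ^ (p - 1)" by (intro mult_left_mono) auto
    moreover have "0 \<le> S ^ Suc p / L" using S L by simp
    ultimately show ?thesis by (simp add: mult.commute)
  next
    case False
    have "\<bar>x - y\<bar> * S ^ (p - 1) \<le> S * S ^ (p - 1)" using S by (intro mult_right_mono) auto
    also have "\<dots> = S ^ p" using p by (cases p) auto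
    also have "\<dots> \<le> S ^ p * (S / L)"
      using False L S mult_left_mono[of 1 "S / L" "S ^ p"] by simp
    finally have "\<bar>x - y\<bar> * S ^ (p - 1) \<le> S ^ Suc p / L" by (simp add: mult.commute)
    moreover have "0 \<le> L ^ (p - 1) * \<bar>x - y\<bar>" using L by simp
    ultimately show ?thesis by linarith
  qed
  moreover have "S ^ Suc p \<le> 2 ^ p * (x ^ Suc p + y ^ Suc p)"
    using power_weighted_sum_le[of "{True, False}" "Suc p" "\<lambda>_. 1" "\<lambda>b. if b then x else y"] x y
    by (simp add: S_def)
  then have "S ^ Suc p / L \<le> (2 ^ p * (x ^ Suc p + y ^ Suc p)) / L"
    using L by (intro divide_right_mono) auto
  ultimately have "\<bar>x - y\<bar> * S ^ (p - 1) \<le> L ^ (p - 1) * \<bar>x - y\<bar> + (2 ^ p * (x ^ Suc p + y ^ Suc p)) / L"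
    by linarith
  then have "real p * (\<bar>x - y\<bar> * S ^ (p - 1)) \<le>
      real p * (L ^ (p - 1) * \<bar>x - y\<bar> + (2 ^ p * (x ^ Suc p + y ^ Suc p)) / L)"
    by (intro mult_left_mono) auto
  moreover have "\<bar>x ^ p - y ^ p\<bar> \<le> real p * (\<bar>x - y\<bar> * S ^ (p - 1))"
    using abs_power_diff_le[OF x y, of p] by (simp add: S_def mult.assoc)
  ultimately show ?thesis by (simp add: algebra_simps add_divide_distrib)
qed


section \<open>Quadratic forms in a Gaussian space\<close>

text \<open>The absolute value only matters where the series diverges.\<close>

definition weighted_squares :: "(nat \<Rightarrow> real) \<Rightarrow> (nat \<Rightarrow> 'a \<Rightarrow> real) \<Rightarrow> 'a \<Rightarrow> real" where
  "weighted_squares w X \<omega> = \<bar>\<Sum>k. w k * (X k \<omega>)\<^sup>2\<bar>"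

text \<open>Moment bounds follow from the law of each single \<open>X k\<close>; orthogonality
  enters as a hypothesis where the variance of the form is estimated. Positivity of
  \<open>v k\<close> permits normalization of \<open>X k\<close> to variance 1.\<close>

locale quadratic_form = gaussian_space M G for M :: "'a measure" and G +
  fixes X :: "nat \<Rightarrow> 'a \<Rightarrow> real" and w v :: "nat \<Rightarrow> real"
  assumes XG: "X k \<in> G"
    and variance: "expectation (\<lambda>\<omega>. (X k \<omega>)\<^sup>2) = v k" and v_pos: "0 < v k"
    and w_nonneg: "0 \<le> w k"
    and summable_wv: "summable (\<lambda>k. w k * v k)"
begin

abbreviation Q :: "'a \<Rightarrow> real" where
  "Q \<equiv> weighted_squares w X"

abbreviation S :: real where
  "S \<equiv> (\<Sum>k. w k * v k)"

lemma X_measurable [measurable]: "X k \<in> borel_measurable M"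
  using moments[OF XG] by (rule has_moments_measurable)

lemma Q_measurable [measurable]: "Q \<in> borel_measurable M"
  unfolding weighted_squares_def[abs_def] by measurable

lemma Q_nonneg: "0 \<le> Q \<omega>"
  by (simp add: weighted_squares_def)

lemma wv_nonneg: "0 \<le> w k * v k"
  using w_nonneg[of k] v_pos[of k] by simp

lemma S_nonneg: "0 \<le> S"
  by (intro suminf_nonneg summable_wv wv_nonneg)

lemma sum_wv_le_S: "(\<Sum>k<K. w k * v k) \<le> S"
  by (intro sum_le_suminf summable_wv) (auto intro: wv_nonneg)

lemma integrable_wX2: "integrable M (\<lambda>\<omega>. w k * (X k \<omega>)\<^sup>2)"
  using integrable_square[OF XG XG] by simp

lemma AE_summable: "AE \<omega> in M. summable (\<lambda>k. w k * (X k \<omega>)\<^sup>2)"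
proof -
  have "(\<integral>\<^sup>+\<omega>. (\<Sum>k. ennreal (w k * (X k \<omega>)\<^sup>2)) \<partial>M) = (\<Sum>k. \<integral>\<^sup>+\<omega>. ennreal (w k * (X k \<omega>)\<^sup>2) \<partial>M)"
    by (rule nn_integral_suminf) measurable
  also have "\<dots> = (\<Sum>k. ennreal (w k * v k))"
    using integrable_wX2 w_nonneg by (simp add: nn_integral_eq_integral variance)
  also have "\<dots> = ennreal S"
    by (rule suminf_ennreal2[OF wv_nonneg summable_wv])
  finally have "AE \<omega> in M. (\<Sum>k. ennreal (w k * (X k \<omega>)\<^sup>2)) \<noteq> \<infinity>"
    by (intro nn_integral_noteq_infinite) auto
  then show ?thesis
    using w_nonneg by (auto intro!: summable_suminf_not_top elim!: eventually_mono)
qed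

lemma AE_Q_sums: "AE \<omega> in M. (\<lambda>k. w k * (X k \<omega>)\<^sup>2) sums Q \<omega>"
  using AE_summable
proof eventually_elim
  case (elim \<omega>)
  then have "0 \<le> (\<Sum>k. w k * (X k \<omega>)\<^sup>2)" using w_nonneg by (intro suminf_nonneg) auto
  then show ?case using elim by (simp add: weighted_squares_def summable_sums)
qed

text \<open>Covers the remainder beyond \<open>K\<close> modes and, for \<open>K = 0\<close>, the
  form \<open>Q\<close> itself. Nonnegative terms turn convergence into the absolute convergence
  required for exchanging series and expectation.\<close>

lemma tail:
  assumes "\<And>\<omega>. F \<omega> = \<bar>\<Sum>k. w (k + K) * (X (k + K) \<omega>)\<^sup>2\<bar>"
  shows "integrable M F" "expectation F = (\<Sum>k. w (k + K) * v (k + K))"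
proof -
  have F: "AE \<omega> in M. F \<omega> = (\<Sum>k. w (k + K) * (X (k + K) \<omega>)\<^sup>2)"
    using AE_summable
  proof eventually_elim
    case (elim \<omega>)
    then have "summable (\<lambda>k. w (k + K) * (X (k + K) \<omega>)\<^sup>2)"
      by (subst summable_iff_shift)
    then have "0 \<le> (\<Sum>k. w (k + K) * (X (k + K) \<omega>)\<^sup>2)" using w_nonneg by (intro suminf_nonneg) auto
    then show ?case by (simp add: assms)
  qed
  have sm: "AE \<omega> in M. summable (\<lambda>k. norm (w (k + K) * (X (k + K) \<omega>)\<^sup>2))"
    using AE_summable
  proof eventually_elim
    case (elim \<omega>)
    have "summable (\<lambda>k. w (k + K) * (X (k + K) \<omega>)\<^sup>2)"
      using elim by (subst summable_iff_shift)
    then show ?case using w_nonneg by (simp add: abs_mult)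
  qed
  have sv: "summable (\<lambda>k. \<integral>\<omega>. norm (w (k + K) * (X (k + K) \<omega>)\<^sup>2) \<partial>M)"
  proof -
    have "summable (\<lambda>k. w (k + K) * v (k + K))"
      using summable_wv by (subst summable_iff_shift)
    then show ?thesis using w_nonneg by (simp add: abs_mult variance)
  qed
  note I = integrable_suminf[OF integrable_wX2 sm sv] integral_suminf[OF integrable_wX2 sm sv]
  have Fm: "F \<in> borel_measurable M" unfolding assms[abs_def] by measurable
  show "integrable M F"
    using I(1) by (subst integrable_cong_AE[OF Fm _ F]) auto
  have "expectation F = expectation (\<lambda>\<omega>. \<Sum>k. w (k + K) * (X (k + K) \<omega>)\<^sup>2)"
    using F Fm by (intro integral_cong_AE) auto
  then show "expectation F = (\<Sum>k. w (k + K) * v (k + K))"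
    unfolding I(2) by (simp add: variance)
qed

lemma integrable_Q: "integrable M Q" and expectation_Q: "expectation Q = S"
  using tail[of Q 0] by (simp_all add: weighted_squares_def)

text \<open>Replaces the squares of the first \<open>K\<close> modes and discards the others at the
  price of their expectation. It serves pure truncation, with \<open>Y k\<close> the square itself
  and \<open>e k = 0\<close>, as well as the passage to innovations.\<close>

lemma expectation_diff_partial_sum:
  assumes Y: "\<And>k. k < K \<Longrightarrow> has_moments M (Y k)"
    and e: "\<And>k. k < K \<Longrightarrow> expectation (\<lambda>\<omega>. \<bar>(X k \<omega>)\<^sup>2 - Y k \<omega>\<bar>) \<le> e k"
  shows "expectation (\<lambda>\<omega>. \<bar>Q \<omega> - (\<Sum>k<K. w k * Y k \<omega>)\<bar>) \<le>
    (\<Sum>k<K. w k * e k) + (\<Sum>k. w (k + K) * v (k + K))"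
proof -
  define F where "F \<omega> = \<bar>\<Sum>k. w (k + K) * (X (k + K) \<omega>)\<^sup>2\<bar>" for \<omega>
  note tF = tail[of F K, OF F_def]
  have iXY: "integrable M (\<lambda>\<omega>. \<bar>(X k \<omega>)\<^sup>2 - Y k \<omega>\<bar>)" if "k < K" for k
    using that by (intro integrable_abs has_moments_integrable has_moments_diff has_moments_power moments XG Y)
  have iY: "integrable M (\<lambda>\<omega>. \<Sum>k<K. w k * Y k \<omega>)"
    by (intro has_moments_integrable has_moments_sum has_moments_cmult Y) auto
  have ptw: "AE \<omega> in M. \<bar>Q \<omega> - (\<Sum>k<K. w k * Y k \<omega>)\<bar> \<le> (\<Sum>k<K. w k * \<bar>(X k \<omega>)\<^sup>2 - Y k \<omega>\<bar>) + F \<omega>"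
    using AE_Q_sums
  proof eventually_elim
    case (elim \<omega>)
    have "Q \<omega> = (\<Sum>k. w (k + K) * (X (k + K) \<omega>)\<^sup>2) + (\<Sum>k<K. w k * (X k \<omega>)\<^sup>2)"
      using suminf_split_initial_segment[OF sums_summable[OF elim], of K] sums_unique[OF elim] by simp
    then have "Q \<omega> - (\<Sum>k<K. w k * Y k \<omega>) =
        (\<Sum>k. w (k + K) * (X (k + K) \<omega>)\<^sup>2) + (\<Sum>k<K. w k * ((X k \<omega>)\<^sup>2 - Y k \<omega>))"
      by (simp add: sum_subtractf right_diff_distrib)
    moreover have "\<bar>\<Sum>k<K. w k * ((X k \<omega>)\<^sup>2 - Y k \<omega>)\<bar> \<le> (\<Sum>k<K. w k * \<bar>(X k \<omega>)\<^sup>2 - Y k \<omega>\<bar>)"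
      using sum_abs[of "\<lambda>k. w k * ((X k \<omega>)\<^sup>2 - Y k \<omega>)" "{..<K}"] w_nonneg by (simp add: abs_mult)
    ultimately show ?case unfolding F_def by linarith
  qed
  have iA: "integrable M (\<lambda>\<omega>. \<bar>Q \<omega> - (\<Sum>k<K. w k * Y k \<omega>)\<bar>)"
    by (intro integrable_abs Bochner_Integration.integrable_diff integrable_Q iY)
  have iB: "integrable M (\<lambda>\<omega>. \<Sum>k<K. w k * \<bar>(X k \<omega>)\<^sup>2 - Y k \<omega>\<bar>)"
    by (intro Bochner_Integration.integrable_sum integrable_mult_right iXY) auto
  have "expectation (\<lambda>\<omega>. \<bar>Q \<omega> - (\<Sum>k<K. w k * Y k \<omega>)\<bar>) \<le>
      expectation (\<lambda>\<omega>. (\<Sum>k<K. w k * \<bar>(X k \<omega>)\<^sup>2 - Y k \<omega>\<bar>) + F \<omega>)"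
    by (intro integral_mono_AE iA Bochner_Integration.integrable_add iB tF(1) ptw)
  also have "\<dots> = (\<Sum>k<K. w k * expectation (\<lambda>\<omega>. \<bar>(X k \<omega>)\<^sup>2 - Y k \<omega>\<bar>)) + (\<Sum>k. w (k + K) * v (k + K))"
  proof -
    have "expectation (\<lambda>\<omega>. \<Sum>k<K. w k * \<bar>(X k \<omega>)\<^sup>2 - Y k \<omega>\<bar>) =
        (\<Sum>k<K. w k * expectation (\<lambda>\<omega>. \<bar>(X k \<omega>)\<^sup>2 - Y k \<omega>\<bar>))"
      by (subst Bochner_Integration.integral_sum) (simp_all add: iXY integrable_mult_right del: integrable_mult_right_iff)
    then show ?thesis
      by (subst Bochner_Integration.integral_add[OF iB tF(1)]) (simp add: tF(2))
  qed
  also have "\<dots> \<le> (\<Sum>k<K. w k * e k) + (\<Sum>k. w (k + K) * v (k + K))"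
    by (intro add_right_mono sum_mono mult_left_mono w_nonneg e) auto
  finally show ?thesis .
qed

lemma tail_tendsto_0: "(\<lambda>K. \<Sum>k. w (k + K) * v (k + K)) \<longlonglongrightarrow> 0"
  using suminf_exist_split2[OF summable_wv] by (simp add: add.commute)

text \<open>For finitely many orthogonal modes with mean contributions
  \<open>c k = w k * v k\<close> the variance is twice the sum of \<open>(c k)\<^sup>2\<close>,
  hence at most \<open>2 * B * S\<close>; the root bounds the mean deviation. The truncation error
  then tends to 0. Concentration thus depends on the largest single contribution.\<close>

lemma expectation_abs_Q_minus_S:
  assumes orth: "\<And>k l. k \<noteq> l \<Longrightarrow> expectation (\<lambda>\<omega>. X k \<omega> * X l \<omega>) = 0"
    and B: "\<And>k. w k * v k \<le> B"
  shows "expectation (\<lambda>\<omega>. \<bar>Q \<omega> - S\<bar>) \<le> sqrt (2 * B * S)"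
proof -
  define g where "g k \<omega> = (1 / sqrt (v k)) * X k \<omega>" for k \<omega>
  have gG: "g k \<in> G" for k
    unfolding g_def by (intro scale_closed XG)
  have orthg: "expectation (\<lambda>\<omega>. g k \<omega> * g l \<omega>) = (if k = l then 1 else 0)" for k l
  proof -
    have "expectation (\<lambda>\<omega>. g k \<omega> * g l \<omega>) = (1 / sqrt (v k) * (1 / sqrt (v l))) * expectation (\<lambda>\<omega>. X k \<omega> * X l \<omega>)"
      by (subst Bochner_Integration.integral_mult_right_zero[symmetric])
         (intro Bochner_Integration.integral_cong refl, simp add: g_def)
    then show ?thesis
      using orth[of k l] variance[of k] v_pos[of k] by (auto simp: power2_eq_square)
  qed
  have X2: "(X k \<omega>)\<^sup>2 = v k * (g k \<omega>)\<^sup>2" for k \<omega>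
    using v_pos[of k] by (simp add: g_def power_mult_distrib power_divide)
  have bound: "expectation (\<lambda>\<omega>. \<bar>Q \<omega> - S\<bar>) \<le> sqrt (2 * B * S) + 2 * (\<Sum>k. w (k + K) * v (k + K))" for K
  proof -
    define QK where "QK \<omega> = (\<Sum>k<K. w k * (X k \<omega>)\<^sup>2)" for \<omega>
    define SK where "SK = (\<Sum>k<K. w k * v k)"
    define c where "c k = w k * v k" for k
    have mX: "has_moments M (X k)" for k by (intro moments XG)
    have mQK: "has_moments M QK"
      unfolding QK_def by (intro has_moments_sum has_moments_cmult has_moments_power mX)
    have QKg: "QK = (\<lambda>\<omega>. \<Sum>k<K. c k * (g k \<omega>)\<^sup>2)"
      by (simp add: QK_def X2 c_def fun_eq_iff mult.assoc)
    have dec: "decoupled (\<lambda>_. 1) g ({..<K} \<union> {})"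
      unfolding decoupled_def using moment_product[of "{..<K}" g] gG orthg by (simp add: prob_space)
    have E: "expectation (\<lambda>\<omega>. QK \<omega> ^ p) = quad_moment c {..<K} p" for p
      using expectation_decoupled_quad[OF _ _ _ _ _ dec, of c p]
      by (simp add: QKg has_moments_const moments gG prob_space)
    have "quad_moment c {..<K} 1 = SK"
      using quad_moment_Suc[of "{..<K}" c 0] by (simp add: SK_def c_def)
    moreover have "quad_moment c {..<K} 2 = SK\<^sup>2 + 2 * (\<Sum>k<K. (c k)\<^sup>2)"
    proof -
      have "{..Suc 0} = {0, Suc 0}" by auto
      then show ?thesis
        using quad_moment_Suc[of "{..<K}" c 1] quad_moment_Suc[of "{..<K}" c 0]
        by (simp add: SK_def c_def numeral_2_eq_2 power2_eq_square)
    qed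
    ultimately have E1: "expectation QK = SK" and E2: "expectation (\<lambda>\<omega>. (QK \<omega>)\<^sup>2) = SK\<^sup>2 + 2 * (\<Sum>k<K. (c k)\<^sup>2)"
      using E[of 1] E[of 2] by simp_all
    have "expectation (\<lambda>\<omega>. (QK \<omega> - SK)\<^sup>2) = expectation (\<lambda>\<omega>. (QK \<omega>)\<^sup>2 + (SK\<^sup>2 - (2 * SK) * QK \<omega>))"
      by (intro Bochner_Integration.integral_cong refl) (simp add: power2_eq_square algebra_simps)
    also have "\<dots> = 2 * (\<Sum>k<K. (c k)\<^sup>2)"
      using has_moments_integrable[OF mQK] has_moments_integrable_power[OF mQK, of 2]
      by (simp add: E1 E2 prob_space) (simp add: power2_eq_square)
    also have "\<dots> \<le> 2 * (\<Sum>k<K. B * c k)"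
      using B wv_nonneg
      by (intro mult_left_mono sum_mono) (auto simp: c_def power2_eq_square intro!: mult_right_mono)
    also have "\<dots> = 2 * B * SK" by (simp add: SK_def c_def sum_distrib_left mult_ac)
    also have "\<dots> \<le> 2 * B * S"
      using sum_wv_le_S[of K] wv_nonneg[of 0] B[of 0] by (intro mult_left_mono) (auto simp: SK_def)
    finally have var: "expectation (\<lambda>\<omega>. (QK \<omega> - SK)\<^sup>2) \<le> 2 * B * S" .
    have mD: "has_moments M (\<lambda>\<omega>. QK \<omega> - SK)"
      by (intro has_moments_diff has_moments_const mQK)
    have "expectation (\<lambda>\<omega>. \<bar>QK \<omega> - SK\<bar>) \<le> sqrt (expectation (\<lambda>\<omega>. (QK \<omega> - SK)\<^sup>2))"
      using mD by (intro expectation_abs_le_sqrt has_moments_measurable has_moments_integrable_power)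
    also have "\<dots> \<le> sqrt (2 * B * S)" using var by simp
    finally have mid: "expectation (\<lambda>\<omega>. \<bar>QK \<omega> - SK\<bar>) \<le> sqrt (2 * B * S)" .
    have left: "expectation (\<lambda>\<omega>. \<bar>Q \<omega> - QK \<omega>\<bar>) \<le> (\<Sum>k. w (k + K) * v (k + K))"
      using expectation_diff_partial_sum[of K "\<lambda>k \<omega>. (X k \<omega>)\<^sup>2" "\<lambda>_. 0"]
      by (simp add: has_moments_power mX QK_def)
    have right: "S - SK = (\<Sum>k. w (k + K) * v (k + K))"
      using suminf_split_initial_segment[OF summable_wv, of K] by (simp add: SK_def)
    have right0: "0 \<le> S - SK" using sum_wv_le_S[of K] by (simp add: SK_def)
    have i1: "integrable M (\<lambda>\<omega>. \<bar>Q \<omega> - QK \<omega>\<bar>)" "integrable M (\<lambda>\<omega>. \<bar>QK \<omega> - SK\<bar>)"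
      using integrable_Q has_moments_integrable[OF mQK] by auto
    have "expectation (\<lambda>\<omega>. \<bar>Q \<omega> - S\<bar>) \<le> expectation (\<lambda>\<omega>. \<bar>Q \<omega> - QK \<omega>\<bar> + \<bar>QK \<omega> - SK\<bar> + (S - SK))"
      using i1 integrable_Q right0 by (intro integral_mono) auto
    also have "\<dots> = expectation (\<lambda>\<omega>. \<bar>Q \<omega> - QK \<omega>\<bar>) + expectation (\<lambda>\<omega>. \<bar>QK \<omega> - SK\<bar>) + (S - SK)"
      using i1 by (simp add: prob_space)
    finally show ?thesis using left mid right by linarith
  qed
  have "(\<lambda>K. sqrt (2 * B * S) + 2 * (\<Sum>k. w (k + K) * v (k + K))) \<longlonglongrightarrow> sqrt (2 * B * S) + 2 * 0"
    by (intro tendsto_intros tail_tendsto_0)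
  then have "(\<lambda>K. sqrt (2 * B * S) + 2 * (\<Sum>k. w (k + K) * v (k + K))) \<longlonglongrightarrow> sqrt (2 * B * S)" by simp
  then show ?thesis using bound by (intro LIMSEQ_le_const) auto
qed

text \<open>Jensen's inequality with weights \<open>w k * v k\<close> reduces the moment of a
  partial sum to that of one squared standard Gaussian, whatever the correlations; Fatou's lemma
  passes to the series.\<close>

lemma
  shows Q_has_moments: "has_moments M Q"
    and Q_moment_le: "expectation (\<lambda>\<omega>. Q \<omega> ^ m) \<le> gauss_moment (2 * m) * S ^ m"
proof -
  have main: "(\<integral>\<^sup>+\<omega>. ennreal (Q \<omega> ^ m) \<partial>M) \<le> ennreal (gauss_moment (2 * m) * S ^ m)" for m
  proof (cases "m = 0")
    case False
    define QK where "QK K \<omega> = (\<Sum>k<K. w k * (X k \<omega>)\<^sup>2)" for K \<omega>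
    have bK: "(\<integral>\<^sup>+\<omega>. ennreal (QK K \<omega> ^ m) \<partial>M) \<le> ennreal (gauss_moment (2 * m) * S ^ m)" for K
    proof -
      let ?SK = "\<Sum>k<K. w k * v k"
      have SK: "0 \<le> ?SK" by (intro sum_nonneg wv_nonneg)
      have i: "integrable M (\<lambda>\<omega>. (w k * v k) * ((X k \<omega>)\<^sup>2 / v k) ^ m)" for k
        using has_moments_integrable_power[OF moments[OF XG[of k]], of "2 * m"]
        by (simp add: power_divide power_mult)
      have ex: "expectation (\<lambda>\<omega>. (w k * v k) * ((X k \<omega>)\<^sup>2 / v k) ^ m) = (w k * v k) * gauss_moment (2 * m)" for k
        using even_moment[OF XG[of k], of m] v_pos[of k] by (simp add: power_divide variance)
      have mQ: "has_moments M (QK K)"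
        unfolding QK_def by (intro has_moments_sum has_moments_cmult has_moments_power moments XG)
      have "expectation (\<lambda>\<omega>. QK K \<omega> ^ m) \<le>
          expectation (\<lambda>\<omega>. ?SK ^ (m - 1) * (\<Sum>k<K. (w k * v k) * ((X k \<omega>)\<^sup>2 / v k) ^ m))"
      proof (rule integral_mono)
        show "integrable M (\<lambda>\<omega>. QK K \<omega> ^ m)" using mQ by (rule has_moments_integrable_power)
        show "integrable M (\<lambda>\<omega>. ?SK ^ (m - 1) * (\<Sum>k<K. (w k * v k) * ((X k \<omega>)\<^sup>2 / v k) ^ m))"
          by (intro integrable_mult_right Bochner_Integration.integrable_sum i)
        fix \<omega>
        have "QK K \<omega> = (\<Sum>k<K. (w k * v k) * ((X k \<omega>)\<^sup>2 / v k))"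
          unfolding QK_def using v_pos by (intro sum.cong refl) (simp add: less_imp_neq[symmetric])
        then show "QK K \<omega> ^ m \<le> ?SK ^ (m - 1) * (\<Sum>k<K. (w k * v k) * ((X k \<omega>)\<^sup>2 / v k) ^ m)"
          using power_weighted_sum_le[of "{..<K}" m "\<lambda>k. w k * v k" "\<lambda>k. (X k \<omega>)\<^sup>2 / v k"]
            wv_nonneg v_pos False by (simp add: less_imp_le)
      qed
      also have "\<dots> = ?SK ^ (m - 1) * (\<Sum>k<K. (w k * v k) * gauss_moment (2 * m))"
        by (subst Bochner_Integration.integral_mult_right_zero)
           (simp only: Bochner_Integration.integral_sum[OF i] ex)
      also have "\<dots> = gauss_moment (2 * m) * ?SK ^ m"
        using False by (cases m) (auto simp: sum_distrib_right[symmetric])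
      also have "\<dots> \<le> gauss_moment (2 * m) * S ^ m"
        using sum_wv_le_S SK by (intro mult_left_mono power_mono gauss_moment_nonneg)
      finally have le: "expectation (\<lambda>\<omega>. QK K \<omega> ^ m) \<le> gauss_moment (2 * m) * S ^ m" .
      have "0 \<le> QK K \<omega>" for \<omega> unfolding QK_def by (intro sum_nonneg mult_nonneg_nonneg w_nonneg) auto
      then show ?thesis
        using le has_moments_integrable_power[OF mQ, of m]
        by (subst nn_integral_eq_integral) (auto intro: ennreal_leI)
    qed
    have [measurable]: "QK K \<in> borel_measurable M" for K unfolding QK_def by measurable
    have "(\<integral>\<^sup>+\<omega>. ennreal (Q \<omega> ^ m) \<partial>M) = (\<integral>\<^sup>+\<omega>. liminf (\<lambda>K. ennreal (QK K \<omega> ^ m)) \<partial>M)"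
    proof (rule nn_integral_cong_AE)
      show "AE \<omega> in M. ennreal (Q \<omega> ^ m) = liminf (\<lambda>K. ennreal (QK K \<omega> ^ m))"
        using AE_Q_sums
      proof eventually_elim
        case (elim \<omega>)
        then have "(\<lambda>K. QK K \<omega>) \<longlonglongrightarrow> Q \<omega>" by (simp add: sums_def QK_def)
        then have "(\<lambda>K. ennreal (QK K \<omega> ^ m)) \<longlonglongrightarrow> ennreal (Q \<omega> ^ m)"
          by (intro tendsto_ennrealI tendsto_power)
        then show ?case by (intro lim_imp_Liminf[symmetric]) auto
      qed
    qed
    also have "\<dots> \<le> liminf (\<lambda>K. \<integral>\<^sup>+\<omega>. ennreal (QK K \<omega> ^ m) \<partial>M)"
      by (rule nn_integral_liminf) measurable
    also have "\<dots> \<le> ennreal (gauss_moment (2 * m) * S ^ m)"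
      using bK by (intro Liminf_le) auto
    finally show ?thesis .
  qed (simp add: emeasure_space_1)
  have int: "integrable M (\<lambda>\<omega>. Q \<omega> ^ n)" for n
    using main[of n] Q_nonneg by (intro integrableI_bounded) (auto simp: less_top[symmetric] top_unique)
  then show "has_moments M Q"
    by (simp add: has_moments_def)
  have "ennreal (expectation (\<lambda>\<omega>. Q \<omega> ^ m)) \<le> ennreal (gauss_moment (2 * m) * S ^ m)"
    using main[of m] int Q_nonneg by (simp add: nn_integral_eq_integral)
  then show "expectation (\<lambda>\<omega>. Q \<omega> ^ m) \<le> gauss_moment (2 * m) * S ^ m"
    using gauss_moment_nonneg S_nonneg by (simp add: ennreal_le_iff)
qed

end


text \<open>The integrated form of the cutoff inequality. The errors \<open>e i\<close> may vary
  with \<open>i\<close> and enter only through their sum, since near time 0 they are not small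
  individually.\<close>

lemma (in prob_space) expectation_abs_average_diff:
  fixes Z Y :: "nat \<Rightarrow> 'a \<Rightarrow> real"
  assumes Z: "\<And>i. i \<in> I \<Longrightarrow> has_moments M (Z i)" "\<And>i \<omega>. i \<in> I \<Longrightarrow> 0 \<le> Z i \<omega>"
    and Y: "\<And>i. i \<in> I \<Longrightarrow> has_moments M (Y i)" "\<And>i \<omega>. i \<in> I \<Longrightarrow> 0 \<le> Y i \<omega>"
    and e: "\<And>i. i \<in> I \<Longrightarrow> expectation (\<lambda>\<omega>. \<bar>Z i \<omega> - Y i \<omega>\<bar>) \<le> e i"
    and C: "\<And>i. i \<in> I \<Longrightarrow> expectation (\<lambda>\<omega>. Z i \<omega> ^ Suc p) \<le> C"
      "\<And>i. i \<in> I \<Longrightarrow> expectation (\<lambda>\<omega>. Y i \<omega> ^ Suc p) \<le> C"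
    and d: "0 < d" and L: "0 < L" and p: "1 \<le> p"
  shows "expectation (\<lambda>\<omega>. \<bar>d * (\<Sum>i\<in>I. Z i \<omega> ^ p) - d * (\<Sum>i\<in>I. Y i \<omega> ^ p)\<bar>) \<le>
    real p * L ^ (p - 1) * (d * (\<Sum>i\<in>I. e i)) + (d * real (card I)) * (real p * 2 ^ p * (2 * C) / L)"
proof -
  have iD: "integrable M (\<lambda>\<omega>. \<bar>Z i \<omega> ^ p - Y i \<omega> ^ p\<bar>)" if "i \<in> I" for i
    using that by (intro integrable_abs has_moments_integrable has_moments_diff has_moments_power Z Y)
  have each: "expectation (\<lambda>\<omega>. \<bar>Z i \<omega> ^ p - Y i \<omega> ^ p\<bar>) \<le>
      real p * L ^ (p - 1) * e i + real p * 2 ^ p * (2 * C) / L" if i: "i \<in> I" for i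
  proof -
    have i1: "integrable M (\<lambda>\<omega>. \<bar>Z i \<omega> - Y i \<omega>\<bar>)" "integrable M (\<lambda>\<omega>. Z i \<omega> ^ Suc p)" "integrable M (\<lambda>\<omega>. Y i \<omega> ^ Suc p)"
      by (intro integrable_abs has_moments_integrable has_moments_diff Z(1) Y(1) i)
         (rule has_moments_integrable_power, rule Z(1) Y(1), rule i)+
    have "expectation (\<lambda>\<omega>. \<bar>Z i \<omega> ^ p - Y i \<omega> ^ p\<bar>) \<le>
        expectation (\<lambda>\<omega>. real p * L ^ (p - 1) * \<bar>Z i \<omega> - Y i \<omega>\<bar> + (real p * 2 ^ p / L) * (Z i \<omega> ^ Suc p + Y i \<omega> ^ Suc p))"
      using iD[OF i] i1 Z(2)[OF i] Y(2)[OF i] L p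
      by (intro integral_mono abs_power_diff_le_cutoff Bochner_Integration.integrable_add integrable_mult_right) auto
    also have "\<dots> = real p * L ^ (p - 1) * expectation (\<lambda>\<omega>. \<bar>Z i \<omega> - Y i \<omega>\<bar>) +
        (real p * 2 ^ p / L) * (expectation (\<lambda>\<omega>. Z i \<omega> ^ Suc p) + expectation (\<lambda>\<omega>. Y i \<omega> ^ Suc p))"
      using i1 by (simp del: power_Suc)
    also have "\<dots> \<le> real p * L ^ (p - 1) * e i + (real p * 2 ^ p / L) * (C + C)"
      using e[OF i] C[OF i] L by (intro add_mono mult_left_mono) auto
    finally show ?thesis by simp
  qed
  have "expectation (\<lambda>\<omega>. \<bar>d * (\<Sum>i\<in>I. Z i \<omega> ^ p) - d * (\<Sum>i\<in>I. Y i \<omega> ^ p)\<bar>) \<le>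
      expectation (\<lambda>\<omega>. d * (\<Sum>i\<in>I. \<bar>Z i \<omega> ^ p - Y i \<omega> ^ p\<bar>))"
  proof (rule integral_mono)
    show "integrable M (\<lambda>\<omega>. \<bar>d * (\<Sum>i\<in>I. Z i \<omega> ^ p) - d * (\<Sum>i\<in>I. Y i \<omega> ^ p)\<bar>)"
      by (intro integrable_abs has_moments_integrable has_moments_diff has_moments_cmult has_moments_sum has_moments_power Z Y)
    show "integrable M (\<lambda>\<omega>. d * (\<Sum>i\<in>I. \<bar>Z i \<omega> ^ p - Y i \<omega> ^ p\<bar>))"
      by (intro integrable_mult_right Bochner_Integration.integrable_sum iD)
    fix \<omega>
    have "\<bar>d * (\<Sum>i\<in>I. Z i \<omega> ^ p) - d * (\<Sum>i\<in>I. Y i \<omega> ^ p)\<bar> = d * \<bar>\<Sum>i\<in>I. Z i \<omega> ^ p - Y i \<omega> ^ p\<bar>"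
      using d by (simp add: right_diff_distrib[symmetric] sum_subtractf abs_mult)
    also have "\<dots> \<le> d * (\<Sum>i\<in>I. \<bar>Z i \<omega> ^ p - Y i \<omega> ^ p\<bar>)"
      using d by (intro mult_left_mono sum_abs) auto
    finally show "\<bar>d * (\<Sum>i\<in>I. Z i \<omega> ^ p) - d * (\<Sum>i\<in>I. Y i \<omega> ^ p)\<bar> \<le> d * (\<Sum>i\<in>I. \<bar>Z i \<omega> ^ p - Y i \<omega> ^ p\<bar>)" .
  qed
  also have "\<dots> = d * (\<Sum>i\<in>I. expectation (\<lambda>\<omega>. \<bar>Z i \<omega> ^ p - Y i \<omega> ^ p\<bar>))"
    using iD by (simp add: Bochner_Integration.integral_sum)
  also have "\<dots> \<le> d * (\<Sum>i\<in>I. real p * L ^ (p - 1) * e i + real p * 2 ^ p * (2 * C) / L)"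
    using d by (intro mult_left_mono sum_mono each) auto
  also have "\<dots> = real p * L ^ (p - 1) * (d * (\<Sum>i\<in>I. e i)) + (d * real (card I)) * (real p * 2 ^ p * (2 * C) / L)"
    by (simp add: sum.distrib sum_distrib_left distrib_left mult_ac)
  finally show ?thesis .
qed


section \<open>Law of large numbers for orthonormal Gaussian arrays\<close>

text \<open>All rows of an array are put into one orthonormal family indexed by pairs; row
  \<open>i\<close> occupies \<open>{i} \<times> K\<close>.\<close>

lemma quad_moment_Times_singleton:
  "quad_moment (\<lambda>(i, k). c k) ({i} \<times> K) p = quad_moment c K p"
proof -
  have "(\<Prod>j\<in>{i} \<times> K. gauss_square_fps (case j of (i, k) \<Rightarrow> c k)) = (\<Prod>k\<in>K. gauss_square_fps (c k))"
    by (rule prod.reindex_bij_witness[of _ "Pair i" snd]) auto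
  then show ?thesis by (simp add: quad_moment_def)
qed

lemma sum_Times_singleton:
  "(\<Sum>j\<in>{i} \<times> K. f j) = (\<Sum>k\<in>K. f (i, k))"
  by (rule sum.reindex_bij_witness[of _ "Pair i" snd]) auto

text \<open>Powers of quadratic forms of different rows are uncorrelated, so the variance of the sum
  grows only linearly in the number of rows, and each row contributes at most its moment of order
  \<open>2 * p\<close>.\<close>

lemma (in gaussian_space)
  fixes g :: "nat \<Rightarrow> nat \<Rightarrow> 'a \<Rightarrow> real"
  assumes gG: "\<And>i k. i \<in> I \<Longrightarrow> g i k \<in> G"
    and orth: "\<And>i j k l. i \<in> I \<Longrightarrow> j \<in> I \<Longrightarrow>
      expectation (\<lambda>\<omega>. g i k \<omega> * g j l \<omega>) = (if i = j \<and> k = l then 1 else 0)"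
    and I: "finite I" and K: "finite K"
  shows quad_array_moment: "i \<in> I \<Longrightarrow>
      expectation (\<lambda>\<omega>. (\<Sum>k\<in>K. c k * (g i k \<omega>)\<^sup>2) ^ p) = quad_moment c K p"
    and quad_array_lln:
      "expectation (\<lambda>\<omega>. \<bar>(\<Sum>i\<in>I. (\<Sum>k\<in>K. c k * (g i k \<omega>)\<^sup>2) ^ p) - real (card I) * quad_moment c K p\<bar>) \<le>
        sqrt (real (card I) * quad_moment c K (2 * p))"
proof -
  define Y where "Y i \<omega> = (\<Sum>k\<in>K. c k * (g i k \<omega>)\<^sup>2)" for i \<omega>
  define b where "b = quad_moment c K p"
  define h where "h = (\<lambda>(i, k). g i k)"
  have hG: "h j \<in> G" if "fst j \<in> I" for j using gG that by (auto simp: h_def split: prod.splits)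
  have mh: "has_moments M (h j)" if "fst j \<in> I" for j using hG[OF that] by (rule moments)
  have mY: "has_moments M (Y i)" if "i \<in> I" for i
    unfolding Y_def using that by (intro has_moments_sum has_moments_cmult has_moments_power moments gG)
  have dec1: "decoupled (\<lambda>_. 1) h J" if "finite J" "fst ` J \<subseteq> I" for J
  proof -
    have "expectation (\<lambda>\<omega>. \<Prod>j\<in>J. h j \<omega> ^ a j) = (\<Prod>j\<in>J. gauss_moment (a j))" for a
    proof (rule moment_product[OF that(1)])
      show "h j \<in> G" if "j \<in> J" for j using \<open>fst ` J \<subseteq> I\<close> that by (intro hG) blast
      show "expectation (\<lambda>\<omega>. h i \<omega> * h j \<omega>) = (if i = j then 1 else 0)" if "i \<in> J" "j \<in> J" for i j
      proof -
        have "fst i \<in> I" "fst j \<in> I" using \<open>fst ` J \<subseteq> I\<close> that by auto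
        from orth[OF this, of "snd i" "snd j"] show ?thesis
          by (simp add: h_def case_prod_unfold prod_eq_iff)
      qed
    qed
    then show ?thesis by (simp add: decoupled_def prob_space)
  qed
  have Yh: "Y i \<omega> = (\<Sum>j\<in>{i} \<times> K. (case j of (i, k) \<Rightarrow> c k) * (h j \<omega>)\<^sup>2)" for i \<omega>
    unfolding sum_Times_singleton by (simp add: Y_def h_def)
  have E1: "expectation (\<lambda>\<omega>. Y i \<omega> ^ p) = quad_moment c K p" if i: "i \<in> I" for i p
    using expectation_decoupled_quad[of "{i} \<times> K" "{}" h "\<lambda>_. 1" "\<lambda>(i, k). c k" p] K i
      dec1[of "{i} \<times> K \<union> {}"] mh
    unfolding quad_moment_Times_singleton Yh[symmetric]
    by (auto simp: has_moments_const prob_space)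
  then show "i \<in> I \<Longrightarrow> expectation (\<lambda>\<omega>. (\<Sum>k\<in>K. c k * (g i k \<omega>)\<^sup>2) ^ p) = quad_moment c K p"
    by (simp add: Y_def)
  have E2: "expectation (\<lambda>\<omega>. Y i \<omega> ^ p * Y j \<omega> ^ p) = b * b" if ij: "i \<in> I" "j \<in> I" "i \<noteq> j" for i j
  proof -
    have disj: "({i} \<times> K) \<inter> ({j} \<times> K) = {}" using ij by auto
    \<comment> \<open>The power of row \<open>i\<close> becomes the weight against which the form of
      row \<open>j\<close> is integrated; the factor 1 is the weight of the preceding round.\<close>
    have d: "decoupled (\<lambda>\<omega>. 1 * Y i \<omega> ^ p) h ({j} \<times> K)"
      unfolding Yh
      by (rule decoupled_quad[OF _ _ disj _ has_moments_const dec1]) (use K ij in \<open>auto intro: mh\<close>)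
    have "expectation (\<lambda>\<omega>. (1 * Y i \<omega> ^ p) * Y j \<omega> ^ p) = expectation (\<lambda>\<omega>. 1 * Y i \<omega> ^ p) * quad_moment (\<lambda>(i, k). c k) ({j} \<times> K) p"
    proof -
      have mH: "has_moments M (\<lambda>\<omega>. 1 * Y i \<omega> ^ p)"
        by (intro has_moments_cmult has_moments_power mY ij)
      have d': "decoupled (\<lambda>\<omega>. 1 * Y i \<omega> ^ p) h ({j} \<times> K \<union> {})" using d by simp
      show ?thesis
        unfolding Yh[of j]
        by (rule expectation_decoupled_quad[OF _ _ _ _ mH d']) (use K ij in \<open>auto intro: mh\<close>)
    qed
    then show ?thesis
      using E1[OF ij(1), of p] by (simp add: quad_moment_Times_singleton b_def)
  qed
  define F where "F i \<omega> = Y i \<omega> ^ p - b" for i \<omega>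
  have mF: "has_moments M (F i)" if "i \<in> I" for i
    unfolding F_def using that by (intro has_moments_diff has_moments_const has_moments_power mY)
  have EF: "expectation (\<lambda>\<omega>. F i \<omega> * F j \<omega>) = (if i = j then quad_moment c K (2 * p) - b\<^sup>2 else 0)"
    if ij: "i \<in> I" "j \<in> I" for i j
  proof -
    have int: "integrable M (\<lambda>\<omega>. Y i \<omega> ^ p * Y j \<omega> ^ p)" "integrable M (\<lambda>\<omega>. Y i \<omega> ^ p)" "integrable M (\<lambda>\<omega>. Y j \<omega> ^ p)"
      by (intro has_moments_integrable has_moments_mult has_moments_power mY ij)+
    have "expectation (\<lambda>\<omega>. F i \<omega> * F j \<omega>) =
        expectation (\<lambda>\<omega>. Y i \<omega> ^ p * Y j \<omega> ^ p - b * Y i \<omega> ^ p - b * Y j \<omega> ^ p + b\<^sup>2)"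
      by (intro Bochner_Integration.integral_cong refl) (simp add: F_def algebra_simps power2_eq_square)
    also have "\<dots> = expectation (\<lambda>\<omega>. Y i \<omega> ^ p * Y j \<omega> ^ p) - b * b - b * b + b\<^sup>2"
      using int E1 ij by (simp add: b_def prob_space)
    also have "expectation (\<lambda>\<omega>. Y i \<omega> ^ p * Y j \<omega> ^ p) = (if i = j then quad_moment c K (2 * p) else b * b)"
      using E2[of i j] E1[of i "2 * p"] ij by (auto simp: mult_2 power_add)
    finally show ?thesis by (simp add: power2_eq_square)
  qed
  have "expectation (\<lambda>\<omega>. (\<Sum>i\<in>I. F i \<omega>)\<^sup>2) = expectation (\<lambda>\<omega>. \<Sum>i\<in>I. \<Sum>j\<in>I. F i \<omega> * F j \<omega>)"
    by (simp add: power2_eq_square sum_product)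
  also have "\<dots> = (\<Sum>i\<in>I. \<Sum>j\<in>I. expectation (\<lambda>\<omega>. F i \<omega> * F j \<omega>))"
  proof -
    have "integrable M (\<lambda>\<omega>. F i \<omega> * F j \<omega>)" if "i \<in> I" "j \<in> I" for i j
      using that by (intro has_moments_integrable has_moments_mult mF)
    then show ?thesis by (simp add: Bochner_Integration.integral_sum)
  qed
  also have "\<dots> = (\<Sum>i\<in>I. \<Sum>j\<in>I. if i = j then quad_moment c K (2 * p) - b\<^sup>2 else 0)"
    by (intro sum.cong refl EF)
  also have "\<dots> = real (card I) * (quad_moment c K (2 * p) - b\<^sup>2)"
    using I by simp
  also have "\<dots> \<le> real (card I) * quad_moment c K (2 * p)"
    by (intro mult_left_mono) auto
  finally have var: "expectation (\<lambda>\<omega>. (\<Sum>i\<in>I. F i \<omega>)\<^sup>2) \<le> real (card I) * quad_moment c K (2 * p)" .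
  have mS: "has_moments M (\<lambda>\<omega>. \<Sum>i\<in>I. F i \<omega>)" by (intro has_moments_sum mF)
  have "expectation (\<lambda>\<omega>. \<bar>\<Sum>i\<in>I. F i \<omega>\<bar>) \<le> sqrt (expectation (\<lambda>\<omega>. (\<Sum>i\<in>I. F i \<omega>)\<^sup>2))"
    using mS by (intro expectation_abs_le_sqrt has_moments_measurable has_moments_integrable_power)
  also have "\<dots> \<le> sqrt (real (card I) * quad_moment c K (2 * p))" using var by simp
  finally show "expectation (\<lambda>\<omega>. \<bar>(\<Sum>i\<in>I. (\<Sum>k\<in>K. c k * (g i k \<omega>)\<^sup>2) ^ p) - real (card I) * quad_moment c K p\<bar>) \<le>
        sqrt (real (card I) * quad_moment c K (2 * p))"
    by (simp add: F_def Y_def b_def sum_subtractf)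
qed


section \<open>Increments and innovations of the modes\<close>

abbreviation lam :: "nat \<Rightarrow> real" where
  "lam k \<equiv> eigval (Suc k)"

lemma lam_pos: "0 < lam k"
  by (simp add: eigval_def)

lemma exp_neg_bounds:
  fixes z :: real
  assumes "0 \<le> z"
  shows "1 - exp (- z) \<le> z" "z - z\<^sup>2 / 2 \<le> 1 - exp (- z)" "0 \<le> 1 - exp (- z)"
proof -
  show "1 - exp (- z) \<le> z" using exp_ge_add_one_self[of "- z"] by simp
  show "0 \<le> 1 - exp (- z)" using assms by simp
  have "0 < 1 + z + z\<^sup>2 / 2" using assms by (simp add: add_pos_nonneg)
  have "exp (- z) \<le> 1 / (1 + z + z\<^sup>2 / 2)"
    using exp_lower_Taylor_quadratic[OF assms] \<open>0 < 1 + z + z\<^sup>2 / 2\<close>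
    by (simp add: exp_minus inverse_eq_divide frac_le)
  also have "\<dots> \<le> 1 - z + z\<^sup>2 / 2"
  proof -
    have "(1 - z + z\<^sup>2 / 2) * (1 + z + z\<^sup>2 / 2) = 1 + z ^ 4 / 4"
      by (simp add: algebra_simps power2_eq_square power4_eq_xxxx)
    then show ?thesis using \<open>0 < 1 + z + z\<^sup>2 / 2\<close> by (simp add: divide_le_eq)
  qed
  finally show "z - z\<^sup>2 / 2 \<le> 1 - exp (- z)" by simp
qed

text \<open>\<open>a t k\<close> is the coefficient of the eigenfunction with number \<open>Suc k\<close> at time \<open>t\<close>.\<close>

locale heat_modes = gaussian_space M G for M :: "'a measure" and G +
  fixes a :: "real \<Rightarrow> nat \<Rightarrow> 'a \<Rightarrow> real"
  assumes a_G: "0 \<le> t \<Longrightarrow> a t k \<in> G"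
    and cov: "0 \<le> s \<Longrightarrow> s \<le> t \<Longrightarrow> expectation (\<lambda>\<omega>. a s k \<omega> * a t l \<omega>) =
      (if k = l then (exp (- lam k * (t - s)) - exp (- lam k * (s + t))) / (2 * lam k) else 0)"
begin

definition inc :: "real \<Rightarrow> nat \<Rightarrow> nat \<Rightarrow> 'a \<Rightarrow> real" where
  "inc d i k \<omega> = a (real i * d) k \<omega> - a ((real i - 1) * d) k \<omega>"

text \<open>The part of the new value that the noise of the last step creates in an
  Ornstein-Uhlenbeck process: the old value is subtracted after its deterministic decay.\<close>

definition innov :: "real \<Rightarrow> nat \<Rightarrow> nat \<Rightarrow> 'a \<Rightarrow> real" where
  "innov d i k \<omega> = a (real i * d) k \<omega> - exp (- lam k * d) * a ((real i - 1) * d) k \<omega>"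

text \<open>The first term is the variance of an increment of the stationary process. The second is
  the correction for the start at 0, which decays with the elapsed time
  \<open>(real i - 1) * d\<close>.\<close>

definition inc_var :: "real \<Rightarrow> nat \<Rightarrow> nat \<Rightarrow> real" where
  "inc_var d i k = (1 - exp (- lam k * d)) / lam k -
     (1 - exp (- lam k * d))\<^sup>2 * exp (- 2 * lam k * ((real i - 1) * d)) / (2 * lam k)"

definition innov_var :: "real \<Rightarrow> nat \<Rightarrow> real" where
  "innov_var d k = (1 - (exp (- lam k * d))\<^sup>2) / (2 * lam k)"

lemma expectation_product_diff:
  assumes "X \<in> G" "Y \<in> G" "Z \<in> G" "U \<in> G"
  shows "expectation (\<lambda>\<omega>. (X \<omega> - c * Y \<omega>) * (Z \<omega> - e * U \<omega>)) =
    expectation (\<lambda>\<omega>. X \<omega> * Z \<omega>) - e * expectation (\<lambda>\<omega>. X \<omega> * U \<omega>)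
    - c * expectation (\<lambda>\<omega>. Y \<omega> * Z \<omega>) + c * e * expectation (\<lambda>\<omega>. Y \<omega> * U \<omega>)"
proof -
  have "expectation (\<lambda>\<omega>. (X \<omega> - c * Y \<omega>) * (Z \<omega> - e * U \<omega>)) =
    expectation (\<lambda>\<omega>. X \<omega> * Z \<omega> - e * (X \<omega> * U \<omega>) - c * (Y \<omega> * Z \<omega>) + c * e * (Y \<omega> * U \<omega>))"
    by (intro Bochner_Integration.integral_cong refl) (simp add: algebra_simps)
  also have "\<dots> = expectation (\<lambda>\<omega>. X \<omega> * Z \<omega>) - e * expectation (\<lambda>\<omega>. X \<omega> * U \<omega>)
    - c * expectation (\<lambda>\<omega>. Y \<omega> * Z \<omega>) + c * e * expectation (\<lambda>\<omega>. Y \<omega> * U \<omega>)"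
    using integrable_product assms by simp
  finally show ?thesis .
qed

lemma cov_commute: "expectation (\<lambda>\<omega>. a t l \<omega> * a s k \<omega>) = expectation (\<lambda>\<omega>. a s k \<omega> * a t l \<omega>)"
  by (simp add: mult.commute)

lemma cov_distinct:
  assumes "0 \<le> s" "0 \<le> t" "k \<noteq> l"
  shows "expectation (\<lambda>\<omega>. a s k \<omega> * a t l \<omega>) = 0"
  using cov[of s t k l] cov[of t s l k] cov_commute[of s k t l] assms by (cases "s \<le> t") auto

lemma a_var:
  assumes "0 \<le> t"
  shows "expectation (\<lambda>\<omega>. (a t k \<omega>)\<^sup>2) \<le> 1 / (2 * lam k)"
proof -
  have "expectation (\<lambda>\<omega>. (a t k \<omega>)\<^sup>2) = (1 - exp (- lam k * (t + t))) / (2 * lam k)"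
    using cov[of t t k k] assms by (simp add: power2_eq_square)
  then show ?thesis using lam_pos[of k] by (simp add: divide_right_mono)
qed

context
  fixes d :: real and i :: nat
  assumes d: "0 < d" and i: "1 \<le> i"
begin

lemma grid_times: "0 \<le> (real i - 1) * d" "(real i - 1) * d \<le> real i * d" "0 \<le> real i * d"
  "real i * d = (real i - 1) * d + d"
  using d i by (auto simp: algebra_simps)

lemma inc_G: "inc d i k \<in> G" and innov_G: "innov d i k \<in> G"
  unfolding inc_def[abs_def] innov_def[abs_def]
  by (intro diff_closed scale_closed a_G grid_times)+

lemma cov_step:
  fixes k :: nat
  defines "t \<equiv> (real i - 1) * d"
  defines "x \<equiv> exp (- lam k * d)" and "y \<equiv> exp (- 2 * lam k * t)"
  shows "expectation (\<lambda>\<omega>. a t k \<omega> * a t k \<omega>) = (1 - y) / (2 * lam k)"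
    "expectation (\<lambda>\<omega>. a t k \<omega> * a (real i * d) k \<omega>) = (x - y * x) / (2 * lam k)"
    "expectation (\<lambda>\<omega>. a (real i * d) k \<omega> * a t k \<omega>) = (x - y * x) / (2 * lam k)"
    "expectation (\<lambda>\<omega>. a (real i * d) k \<omega> * a (real i * d) k \<omega>) = (1 - y * x\<^sup>2) / (2 * lam k)"
proof -
  note T = grid_times[folded t_def]
  have e: "exp (- lam k * (t + t)) = y" "exp (- lam k * (t + (t + d))) = y * x"
    "exp (- lam k * (t + d + (t + d))) = y * x\<^sup>2"
    by (simp_all add: y_def x_def exp_add[symmetric] power2_eq_square algebra_simps)
  show "expectation (\<lambda>\<omega>. a t k \<omega> * a t k \<omega>) = (1 - y) / (2 * lam k)"
    using cov[of t t k k] T e by simp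
  show 2: "expectation (\<lambda>\<omega>. a t k \<omega> * a (real i * d) k \<omega>) = (x - y * x) / (2 * lam k)"
    using cov[of t "t + d" k k] T e by (simp add: x_def)
  then show "expectation (\<lambda>\<omega>. a (real i * d) k \<omega> * a t k \<omega>) = (x - y * x) / (2 * lam k)"
    by (subst cov_commute)
  show "expectation (\<lambda>\<omega>. a (real i * d) k \<omega> * a (real i * d) k \<omega>) = (1 - y * x\<^sup>2) / (2 * lam k)"
    using cov[of "t + d" "t + d" k k] T e by simp
qed

lemma expectation_inc: "expectation (\<lambda>\<omega>. (inc d i k \<omega>)\<^sup>2) = inc_var d i k"
proof -
  let ?A = "a (real i * d) k" and ?B = "a ((real i - 1) * d) k"
  have "expectation (\<lambda>\<omega>. (inc d i k \<omega>)\<^sup>2) = expectation (\<lambda>\<omega>. (?A \<omega> - 1 * ?B \<omega>) * (?A \<omega> - 1 * ?B \<omega>))"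
    by (simp add: inc_def power2_eq_square)
  also have "\<dots> = inc_var d i k"
    unfolding expectation_product_diff[OF a_G[OF grid_times(3)] a_G[OF grid_times(1)] a_G[OF grid_times(3)] a_G[OF grid_times(1)]]
      cov_step inc_var_def
    using lam_pos[of k] by (simp add: divide_simps) (simp add: power2_eq_square algebra_simps)
  finally show ?thesis .
qed

lemma expectation_inc_orth:
  assumes "k \<noteq> l"
  shows "expectation (\<lambda>\<omega>. inc d i k \<omega> * inc d i l \<omega>) = 0"
  unfolding inc_def
  using expectation_product_diff[OF a_G[OF grid_times(3), of k] a_G[OF grid_times(1), of k]
      a_G[OF grid_times(3), of l] a_G[OF grid_times(1), of l], where c = 1 and e = 1]
  by (simp add: cov_distinct grid_times(1,3) assms)

lemma expectation_innov: "expectation (\<lambda>\<omega>. (innov d i k \<omega>)\<^sup>2) = innov_var d k"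
proof -
  let ?A = "a (real i * d) k" and ?B = "a ((real i - 1) * d) k" and ?x = "exp (- lam k * d)"
  have "expectation (\<lambda>\<omega>. (innov d i k \<omega>)\<^sup>2) = expectation (\<lambda>\<omega>. (?A \<omega> - ?x * ?B \<omega>) * (?A \<omega> - ?x * ?B \<omega>))"
    by (simp add: innov_def power2_eq_square)
  also have "\<dots> = innov_var d k"
    unfolding expectation_product_diff[OF a_G[OF grid_times(3)] a_G[OF grid_times(1)] a_G[OF grid_times(3)] a_G[OF grid_times(1)]]
      cov_step innov_var_def
    using lam_pos[of k] by (simp add: divide_simps) (simp add: power2_eq_square algebra_simps)
  finally show ?thesis .
qed

text \<open>For a fixed earlier time the covariance in the later argument decays by the factor
  \<open>exp (- lam k * d)\<close> in one step, and exactly this part is subtracted in the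
  innovation.\<close>

lemma expectation_past_innov:
  assumes "0 \<le> s" "s \<le> (real i - 1) * d"
  shows "expectation (\<lambda>\<omega>. a s l \<omega> * innov d i k \<omega>) = 0"
proof -
  define t where "t = (real i - 1) * d"
  have T: "real i * d = t + d" "0 \<le> t" "s \<le> t" "s \<le> t + d" using grid_times assms d by (auto simp: t_def)
  have "expectation (\<lambda>\<omega>. a s l \<omega> * innov d i k \<omega>) =
      expectation (\<lambda>\<omega>. (a s l \<omega> - 0 * a s l \<omega>) * (a (t + d) k \<omega> - exp (- lam k * d) * a t k \<omega>))"
    by (simp add: innov_def T(1) t_def[symmetric])
  also have "\<dots> = expectation (\<lambda>\<omega>. a s l \<omega> * a (t + d) k \<omega>) - exp (- lam k * d) * expectation (\<lambda>\<omega>. a s l \<omega> * a t k \<omega>)"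
    using expectation_product_diff[of "a s l" "a s l" "a (t + d) k" "a t k" 0 "exp (- lam k * d)"] T assms d
    by (simp add: a_G)
  also have "\<dots> = 0"
  proof (cases "k = l")
    case True
    have "exp (- lam k * (t + d - s)) = exp (- lam k * d) * exp (- lam k * (t - s))"
      "exp (- lam k * (s + (t + d))) = exp (- lam k * d) * exp (- lam k * (s + t))"
      by (simp_all add: exp_add[symmetric] algebra_simps)
    then show ?thesis
      using cov[of s t k k] cov[of s "t + d" k k] T assms True by (simp add: right_diff_distrib)
  qed (use cov[of s t l k] cov[of s "t + d" l k] T assms in auto)
  finally show ?thesis .
qed

end

text \<open>The earlier innovation combines values at times up to \<open>real j * d\<close>, which
  lie in the past of step \<open>i\<close> because \<open>j \<le> i - 1\<close>.\<close>

lemma expectation_innov_orth_less: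
  assumes d: "0 < d" and "1 \<le> j" "j < i"
  shows "expectation (\<lambda>\<omega>. innov d j l \<omega> * innov d i k \<omega>) = 0"
proof -
  have i: "1 \<le> i" using assms by simp
  have "real j \<le> real i - 1" using assms by linarith
  then have T: "real j * d \<le> (real i - 1) * d" using d by (intro mult_right_mono) auto
  note tj = grid_times[OF d assms(2)]
  have T2: "(real j - 1) * d \<le> (real i - 1) * d" using T tj by linarith
  have "expectation (\<lambda>\<omega>. innov d j l \<omega> * innov d i k \<omega>) =
      expectation (\<lambda>\<omega>. (a (real j * d) l \<omega> - exp (- lam l * d) * a ((real j - 1) * d) l \<omega>) * (innov d i k \<omega> - 0 * innov d i k \<omega>))"
    by (simp add: innov_def)
  also have "\<dots> = expectation (\<lambda>\<omega>. a (real j * d) l \<omega> * innov d i k \<omega>)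
      - exp (- lam l * d) * expectation (\<lambda>\<omega>. a ((real j - 1) * d) l \<omega> * innov d i k \<omega>)"
    by (subst expectation_product_diff[OF a_G[OF tj(3)] a_G[OF tj(1)] innov_G[OF d i] innov_G[OF d i]]) simp
  also have "\<dots> = 0"
    using T T2 tj by (simp add: expectation_past_innov[OF d i])
  finally show ?thesis .
qed

lemma expectation_innov_orth:
  assumes d: "0 < d" and "1 \<le> j" "1 \<le> i"
  shows "expectation (\<lambda>\<omega>. innov d i k \<omega> * innov d j l \<omega>) = (if i = j \<and> k = l then innov_var d k else 0)"
proof -
  consider "i < j" | "j < i" | "i = j" "k = l" | "i = j" "k \<noteq> l" by linarith
  then show ?thesis
  proof cases
    case 2
    then show ?thesis
      using expectation_innov_orth_less[OF d assms(2) 2, of l k] by (simp add: mult.commute)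
  next
    case 3
    then show ?thesis using expectation_innov[OF d assms(3), of k] by (simp add: power2_eq_square)
  next
    case 4
    note T = grid_times[OF d assms(2)]
    have "expectation (\<lambda>\<omega>. innov d j k \<omega> * innov d j l \<omega>) = 0"
      unfolding innov_def
      using expectation_product_diff[OF a_G[OF T(3), of k] a_G[OF T(1), of k] a_G[OF T(3), of l] a_G[OF T(1), of l],
          where c = "exp (- lam k * d)" and e = "exp (- lam l * d)"]
      by (simp add: cov_distinct T(1,3) 4)
    then show ?thesis using 4 by simp
  qed (use expectation_innov_orth_less[OF d assms(3)] in auto)
qed

lemma innov_var_pos:
  assumes "0 < d"
  shows "0 < innov_var d k"
proof -
  have "exp (- lam k * d) < 1" using assms lam_pos[of k] by simp
  then have "(exp (- lam k * d))\<^sup>2 < 1" by (simp add: power_less_one_iff)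
  then show ?thesis using lam_pos[of k] by (simp add: innov_var_def)
qed

lemma innov_var_bounds:
  assumes "0 < d"
  shows "innov_var d k \<le> d" "d - innov_var d k \<le> lam k * d\<^sup>2"
proof -
  define z where "z = 2 * (lam k * d)"
  have z: "0 \<le> z" using assms lam_pos[of k] by (simp add: z_def)
  have x: "(exp (- lam k * d))\<^sup>2 = exp (- z)" by (simp add: z_def power2_eq_square exp_add[symmetric])
  have "innov_var d k \<le> z / (2 * lam k)"
    unfolding innov_var_def x using exp_neg_bounds[OF z] lam_pos[of k] by (intro divide_right_mono) auto
  then show "innov_var d k \<le> d" using lam_pos[of k] by (simp add: z_def)
  have "(z - z\<^sup>2 / 2) / (2 * lam k) \<le> innov_var d k"
    unfolding innov_var_def x using exp_neg_bounds[OF z] lam_pos[of k] by (intro divide_right_mono) auto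
  moreover have "(z - z\<^sup>2 / 2) / (2 * lam k) = d - lam k * d\<^sup>2"
    using lam_pos[of k] by (simp add: z_def field_simps power2_eq_square)
  ultimately show "d - innov_var d k \<le> lam k * d\<^sup>2" by simp
qed

lemma inc_var_bounds:
  assumes d: "0 < d" and i: "1 \<le> i"
  shows "0 < inc_var d i k" "inc_var d i k \<le> (1 - exp (- lam k * d)) / lam k"
proof -
  define x y where "x = exp (- lam k * d)" and "y = exp (- 2 * lam k * ((real i - 1) * d))"
  have x: "0 < x" "x < 1" using d lam_pos[of k] by (auto simp: x_def)
  have y: "0 < y" "y \<le> 1"
    using grid_times[OF d i] lam_pos[of k] by (auto simp: y_def mult_nonneg_nonneg less_imp_le)
  have e: "inc_var d i k = (1 - x) * (2 - (1 - x) * y) / (2 * lam k)"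
    unfolding inc_var_def x_def[symmetric] y_def[symmetric]
    using lam_pos[of k] by (simp add: field_simps power2_eq_square)
  have "(1 - x) * y \<le> 1" using x y mult_le_one[of "1 - x" y] by simp
  then show "0 < inc_var d i k" unfolding e using x lam_pos[of k] by simp
  show "inc_var d i k \<le> (1 - exp (- lam k * d)) / lam k"
    unfolding inc_var_def using lam_pos[of k] by simp
qed

text \<open>The defects form a geometric progression with ratio
  \<open>exp (- 2 * lam k * d)\<close>. Their total stays below half of one stationary variance for
  every \<open>N\<close>, so that it disappears after multiplication by the step, although the first
  defects are not small.\<close>

lemma sum_inc_var_defect:
  assumes d: "0 < d"
  shows "(\<Sum>i=1..N. (1 - exp (- lam k * d)) / lam k - inc_var d i k) \<le> (1 - exp (- lam k * d)) / lam k / 2"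
proof -
  define x where "x = exp (- lam k * d)"
  have x: "0 < x" "x < 1" using d lam_pos[of k] by (auto simp: x_def)
  have x2: "x\<^sup>2 < 1" using x by (simp add: power_less_one_iff)
  have sum_eq: "(\<Sum>i=1..N. (1 - x) / lam k - inc_var d i k) = (1 - x)\<^sup>2 / (2 * lam k) * (\<Sum>i=1..N. (x\<^sup>2) ^ (i - 1))"
    unfolding sum_distrib_left
  proof (intro sum.cong refl)
    fix i assume i: "i \<in> {1..N}"
    have "exp (- 2 * lam k * ((real i - 1) * d)) = exp (real (i - 1) * (real 2 * (- lam k * d)))"
      using i by (simp add: of_nat_diff algebra_simps)
    also have "\<dots> = (x\<^sup>2) ^ (i - 1)"
      unfolding exp_of_nat_mult x_def ..
    finally show "(1 - x) / lam k - inc_var d i k = (1 - x)\<^sup>2 / (2 * lam k) * (x\<^sup>2) ^ (i - 1)"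
      by (simp add: inc_var_def x_def)
  qed

  have "(\<Sum>i=1..N. (x\<^sup>2) ^ (i - 1)) = (\<Sum>i<N. (x\<^sup>2) ^ i)"
    by (rule sum.reindex_bij_witness[of _ Suc "\<lambda>i. i - 1"]) auto
  also have "\<dots> = (1 - (x\<^sup>2) ^ N) / (1 - x\<^sup>2)"
    using x2 by (subst sum_gp_strict) auto
  also have "\<dots> \<le> 1 / (1 - x\<^sup>2)"
    using x2 by (intro divide_right_mono) auto
  also have "\<dots> \<le> 1 / (1 - x)"
    using x x2 by (intro divide_left_mono mult_pos_pos) (auto simp: power2_eq_square)
  finally have "(1 - x)\<^sup>2 / (2 * lam k) * (\<Sum>i=1..N. (x\<^sup>2) ^ (i - 1)) \<le> (1 - x)\<^sup>2 / (2 * lam k) * (1 / (1 - x))"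
    using lam_pos[of k] by (intro mult_left_mono) auto
  also have "(1 - x)\<^sup>2 / (2 * lam k) * (1 / (1 - x)) = (1 - x) / lam k / 2"
    using x by (simp add: power2_eq_square)
  finally show ?thesis
    using sum_eq by (simp only: x_def)
qed

text \<open>An increment is the innovation minus the drift \<open>b\<close>, the old value times
  \<open>1 - exp (- lam k * d)\<close>. The innovation has variance of order \<open>d\<close> and
  the drift one of order \<open>d\<^sup>2\<close>. The factor \<open>d / innov_var d k\<close>
  brings the variance of the innovation to exactly \<open>d\<close>.\<close>

lemma expectation_inc_innov:
  assumes d: "0 < d" and i: "1 \<le> i"
  shows "expectation (\<lambda>\<omega>. \<bar>(inc d i k \<omega>)\<^sup>2 - d / innov_var d k * (innov d i k \<omega>)\<^sup>2\<bar>) \<le>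
    d * (sqrt d * (1 + lam k / 2) + 3 / 2 * lam k * d)"
proof -
  define t x where "t = (real i - 1) * d" and "x = exp (- lam k * d)"
  define b e s where "b \<omega> = (1 - x) * a t k \<omega>" and "e = innov d i k" and "s = innov_var d k" for \<omega>
  have t: "0 \<le> t" using grid_times[OF d i] by (simp add: t_def)
  have eG: "e \<in> G" and bG: "b \<in> G"
    unfolding e_def b_def[abs_def] by (intro innov_G d i scale_closed a_G t)+
  have s: "0 < s" "s \<le> d" "d - s \<le> lam k * d\<^sup>2"
    using innov_var_pos[OF d] innov_var_bounds[OF d] by (auto simp: s_def)
  have inc: "inc d i k \<omega> = e \<omega> - b \<omega>" for \<omega>
    by (simp add: inc_def e_def innov_def b_def t_def x_def algebra_simps)
  have Ee: "expectation (\<lambda>\<omega>. (e \<omega>)\<^sup>2) = s"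
    unfolding e_def s_def by (rule expectation_innov[OF d i])
  have Eb: "expectation (\<lambda>\<omega>. (b \<omega>)\<^sup>2) \<le> lam k * d\<^sup>2 / 2"
  proof -
    have "0 \<le> 1 - x" "1 - x \<le> lam k * d"
      using exp_neg_bounds[of "lam k * d"] d lam_pos[of k] by (auto simp: x_def)
    then have "(1 - x)\<^sup>2 \<le> (lam k * d)\<^sup>2" by (intro power_mono)
    then have "(1 - x)\<^sup>2 * expectation (\<lambda>\<omega>. (a t k \<omega>)\<^sup>2) \<le> (lam k * d)\<^sup>2 * (1 / (2 * lam k))"
      using a_var[OF t, of k] by (intro mult_mono) auto
    then show ?thesis
      using lam_pos[of k] by (simp add: b_def power_mult_distrib power2_eq_square mult_ac)
  qed
  have ptw: "\<bar>(inc d i k \<omega>)\<^sup>2 - d / s * (e \<omega>)\<^sup>2\<bar> \<le>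
      (sqrt d + (d / s - 1)) * (e \<omega>)\<^sup>2 + (1 / sqrt d + 1) * (b \<omega>)\<^sup>2" for \<omega>
  proof -
    \<comment> \<open>The weight in Young's inequality for the cross term: with
      \<open>h = sqrt d\<close>, both \<open>h * (e \<omega>)\<^sup>2\<close> and
      \<open>(b \<omega>)\<^sup>2 / h\<close> have expectation of order
      \<open>d * sqrt d\<close>.\<close>
    define h where "h = sqrt d"
    have h: "0 < h" using d by (simp add: h_def)
    have "0 \<le> (h * \<bar>e \<omega>\<bar> - \<bar>b \<omega>\<bar>)\<^sup>2" by simp
    then have "2 * h * (\<bar>e \<omega>\<bar> * \<bar>b \<omega>\<bar>) \<le> h * (h * (e \<omega>)\<^sup>2 + (b \<omega>)\<^sup>2 / h)"
      using h by (simp add: power2_eq_square algebra_simps)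
    then have cross: "2 * (\<bar>e \<omega>\<bar> * \<bar>b \<omega>\<bar>) \<le> h * (e \<omega>)\<^sup>2 + (b \<omega>)\<^sup>2 / h"
      using h by (metis mult.assoc mult.left_commute mult_le_cancel_left_pos)
    have ds: "0 \<le> (d / s - 1) * (e \<omega>)\<^sup>2" using s by (intro mult_nonneg_nonneg) auto
    have "(inc d i k \<omega>)\<^sup>2 - d / s * (e \<omega>)\<^sup>2 = - (2 * (e \<omega> * b \<omega>)) + (b \<omega>)\<^sup>2 - (d / s - 1) * (e \<omega>)\<^sup>2"
      by (simp add: inc power2_eq_square algebra_simps)
    moreover have "\<bar>2 * (e \<omega> * b \<omega>)\<bar> = 2 * (\<bar>e \<omega>\<bar> * \<bar>b \<omega>\<bar>)" by (simp add: abs_mult)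
    ultimately have "\<bar>(inc d i k \<omega>)\<^sup>2 - d / s * (e \<omega>)\<^sup>2\<bar> \<le> 2 * (\<bar>e \<omega>\<bar> * \<bar>b \<omega>\<bar>) + (b \<omega>)\<^sup>2 + (d / s - 1) * (e \<omega>)\<^sup>2"
      using ds zero_le_power2[of "b \<omega>"] by linarith
    then show ?thesis using cross by (simp add: h_def algebra_simps)
  qed
  have ie: "integrable M (\<lambda>\<omega>. (e \<omega>)\<^sup>2)" "integrable M (\<lambda>\<omega>. (b \<omega>)\<^sup>2)"
    using integrable_square eG bG by auto
  have ii: "integrable M (\<lambda>\<omega>. \<bar>(inc d i k \<omega>)\<^sup>2 - d / s * (e \<omega>)\<^sup>2\<bar>)"
    using integrable_square[OF inc_G[OF d i] inc_G[OF d i]] ie by auto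
  have "expectation (\<lambda>\<omega>. \<bar>(inc d i k \<omega>)\<^sup>2 - d / s * (e \<omega>)\<^sup>2\<bar>) \<le>
      expectation (\<lambda>\<omega>. (sqrt d + (d / s - 1)) * (e \<omega>)\<^sup>2 + (1 / sqrt d + 1) * (b \<omega>)\<^sup>2)"
    using ie by (intro integral_mono ii ptw) auto
  also have "\<dots> = (sqrt d + (d / s - 1)) * s + (1 / sqrt d + 1) * expectation (\<lambda>\<omega>. (b \<omega>)\<^sup>2)"
    using ie by (simp add: Ee)
  also have "\<dots> \<le> (sqrt d * d + lam k * d\<^sup>2) + (1 / sqrt d + 1) * (lam k * d\<^sup>2 / 2)"
  proof (intro add_mono mult_left_mono Eb)
    have "sqrt d * s \<le> sqrt d * d" using s d by (intro mult_left_mono) auto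
    moreover have "(sqrt d + (d / s - 1)) * s = sqrt d * s + (d - s)"
      using s by (simp add: field_simps)
    ultimately show "(sqrt d + (d / s - 1)) * s \<le> sqrt d * d + lam k * d\<^sup>2"
      using s(3) by linarith
  qed (use d in auto)
  also have "\<dots> = d * (sqrt d * (1 + lam k / 2) + 3 / 2 * lam k * d)"
  proof -
    have "1 / sqrt d * (lam k * d\<^sup>2 / 2) = sqrt d * (lam k * d / 2)"
    proof -
      have "d = sqrt d * sqrt d" using d by simp
      then have "d\<^sup>2 = sqrt d * (sqrt d * d)" by (metis mult.assoc power2_eq_square)
      then show ?thesis using d by simp
    qed
    then have "(1 / sqrt d + 1) * (lam k * d\<^sup>2 / 2) = sqrt d * (lam k * d / 2) + lam k * d\<^sup>2 / 2"
      by (simp only: distrib_right mult_1)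
    then show ?thesis by (simp add: field_simps power2_eq_square)
  qed
  finally show ?thesis by (simp add: e_def s_def)
qed

end


section \<open>The Riemann sum for exponents between -1/2 and 1/2\<close>

text \<open>Carries integrals of powers on unbounded or singular domains from the gauge integral to
  the Lebesgue integral; nonnegativity excludes conditional convergence.\<close>

lemma has_bochner_integral_of_nonneg_has_integral:
  fixes f :: "real \<Rightarrow> real"
  assumes [measurable]: "f \<in> borel_measurable borel" "S \<in> sets borel"
    and nn: "\<And>x. x \<in> S \<Longrightarrow> 0 \<le> f x" and I: "(f has_integral I) S"
  shows "has_bochner_integral lborel (\<lambda>x. indicator S x * f x) I"
proof -
  have "((\<lambda>x. if x \<in> S then f x else 0) has_integral I) UNIV"
    using I by (simp add: has_integral_restrict_UNIV)
  moreover have "(\<lambda>x. if x \<in> S then f x else 0) = (\<lambda>x. indicator S x * f x)"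
    by (auto simp: indicator_def fun_eq_iff)
  ultimately have "((\<lambda>x. indicator S x * f x) has_integral I) UNIV" by simp
  then have "(\<integral>\<^sup>+x. ennreal (indicator S x * f x) \<partial>lborel) = ennreal I"
    using nn by (intro nn_integral_has_integral_lborel) (auto simp: indicator_def)
  moreover have "0 \<le> I" using I nn by (rule has_integral_nonneg)
  ultimately show ?thesis
    using nn by (intro has_bochner_integral_nn_integral) (auto simp: indicator_def)
qed

context
  fixes r :: real
  assumes r: "- 1 / 2 < r" "r < 1 / 2"
begin

text \<open>The summand of the expected squared norm after the scaling
  \<open>x = sqrt \<delta> * k\<close>. Division by \<open>\<delta> powr (1/2 - r)\<close> leaves a
  Riemann sum of this function with mesh \<open>sqrt \<delta>\<close>.\<close>

definition heat_profile :: "real \<Rightarrow> real" where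
  "heat_profile x = x powr (2 * r - 2) * (1 - exp (- x\<^sup>2))"

text \<open>At \<open>x\<close> it dominates the profile at every \<open>y \<ge> x\<close>, as is
  required when a Riemann sum evaluates at right endpoints. The summand 1 is for
  \<open>r > 0\<close>, where \<open>x powr (2 * r)\<close> increases and alone would not bound
  later values.\<close>

definition heat_majorant :: "real \<Rightarrow> real" where
  "heat_majorant x = indicator {0<..1} x * (x powr (2 * r) + 1) + indicator {1..} x * x powr (2 * r - 2)"

lemma heat_profile_measurable [measurable]: "heat_profile \<in> borel_measurable borel"
  unfolding heat_profile_def[abs_def] by measurable

lemma heat_profile_nonneg: "0 \<le> heat_profile x"
  by (simp add: heat_profile_def)

lemma heat_profile_le:
  assumes "0 < x"
  shows "heat_profile x \<le> x powr (2 * r)" "heat_profile x \<le> x powr (2 * r - 2)"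
proof -
  have "heat_profile x \<le> x powr (2 * r - 2) * x\<^sup>2"
    unfolding heat_profile_def using exp_neg_bounds[of "x\<^sup>2"] by (intro mult_left_mono) auto
  also have "\<dots> = x powr (2 * r)"
  proof -
    have "x\<^sup>2 = x powr 2" using assms by (simp add: powr_numeral)
    then show ?thesis by (simp add: powr_add[symmetric])
  qed
  finally show "heat_profile x \<le> x powr (2 * r)" .
  show "heat_profile x \<le> x powr (2 * r - 2)"
    unfolding heat_profile_def by (intro mult_left_le) auto
qed

text \<open>The two bounds on \<open>r\<close> are the integrability conditions:
  \<open>2 * r > -1\<close> at 0 and \<open>2 * r - 2 < -1\<close> at infinity.\<close>

lemma heat_majorant_integrable: "integrable lborel heat_majorant"
proof -
  have 1: "integrable lborel (\<lambda>x. indicator {0<..1} x * (x powr (2 * r)))"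
  proof -
    have "((\<lambda>x::real. x powr (2 * r)) has_integral (1 powr (2 * r + 1) / (2 * r + 1))) {0..1}"
      using r by (intro has_integral_powr_from_0) auto
    then have "integrable lborel (\<lambda>x. indicator {0..1} x * (x powr (2 * r)))"
      by (intro integrable.intros has_bochner_integral_of_nonneg_has_integral) auto
    moreover have "(\<lambda>x. indicator {0..1} x * (x powr (2 * r))) = (\<lambda>x. indicator {0<..1} x * (x powr (2 * r)))"
      by (auto simp: indicator_def fun_eq_iff)
    ultimately show ?thesis by simp
  qed
  have 2: "integrable lborel (\<lambda>x. indicator {1..} x * (x powr (2 * r - 2)))"
  proof -
    have "((\<lambda>x::real. x powr (2 * r - 2)) has_integral - (1 powr ((2 * r - 2) + 1)) / ((2 * r - 2) + 1)) {1..}"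
      using r by (intro has_integral_powr_to_inf) auto
    then show ?thesis
      by (intro integrable.intros has_bochner_integral_of_nonneg_has_integral) auto
  qed
  have 3: "integrable lborel (\<lambda>x. indicator {0<..1::real} x :: real)"
    by simp
  show ?thesis
    unfolding heat_majorant_def[abs_def] distrib_left
    using 1 2 3 by (intro Bochner_Integration.integrable_add) auto
qed

lemma heat_profile_le_majorant:
  assumes "0 < x" "x \<le> y"
  shows "heat_profile y \<le> heat_majorant x"
proof (cases "x \<le> 1")
  case True
  have m: "x powr (2 * r) + 1 \<le> heat_majorant x"
    using True assms by (auto simp: heat_majorant_def indicator_def)
  show ?thesis
  proof (cases "y \<le> 1")
    case True
    have "y powr (2 * r) \<le> x powr (2 * r) + 1"
    proof (cases "0 \<le> r")
      case True
      then have "y powr (2 * r) \<le> 1" using \<open>y \<le> 1\<close> assms by (intro powr_le1) auto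
      then show ?thesis by (simp add: add_increasing)
    next
      case False
      then have "y powr (2 * r) \<le> x powr (2 * r)" using assms by (intro powr_mono2') auto
      then show ?thesis by simp
    qed
    then show ?thesis using heat_profile_le(1)[of y] assms m by linarith
  next
    case False
    have "y powr (2 * r - 2) \<le> 1 powr (2 * r - 2)" using False r by (intro powr_mono2') auto
    then have "y powr (2 * r - 2) \<le> 1" by simp
    moreover have "0 \<le> x powr (2 * r)" by simp
    ultimately show ?thesis using heat_profile_le(2)[of y] assms m by linarith
  qed
next
  case False
  have "heat_profile y \<le> y powr (2 * r - 2)" using assms by (intro heat_profile_le) auto
  also have "\<dots> \<le> x powr (2 * r - 2)" using assms r by (intro powr_mono2') auto
  also have "\<dots> = heat_majorant x" using False by (simp add: heat_majorant_def indicator_def)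
  finally show ?thesis .
qed

lemma heat_majorant_nonneg: "0 \<le> heat_majorant x"
  by (auto simp: heat_majorant_def indicator_def)

lemma isCont_heat_profile: "0 < x \<Longrightarrow> isCont heat_profile x"
  unfolding heat_profile_def[abs_def] by (intro continuous_intros) auto

lemma heat_profile_integrable: "integrable lborel (\<lambda>x. indicator {0<..} x * heat_profile x)"
  by (rule Bochner_Integration.integrable_bound[OF heat_majorant_integrable])
     (auto simp: indicator_def heat_profile_nonneg heat_majorant_nonneg intro: heat_profile_le_majorant)

text \<open>Integration by parts: the boundary term is \<open>x powr (2 * r - 1) * (1 - exp (- x\<^sup>2)) / (2 * r - 1)\<close>.\<close>

lemma integral_heat_profile:
  "(\<integral>x. indicator {0<..} x * heat_profile x \<partial>lborel) = Gamma (r + 1/2) / (2 * (1/2 - r))"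
proof -
  \<comment> \<open>The part of the derivative of the boundary term in which the exponential is
    differentiated. The substitution of \<open>x\<^sup>2\<close> turns its integral into the Gamma
    integral.\<close>
  define e where "e x = 2 * x powr (2 * r) * exp (- x\<^sup>2)" for x :: real
  have E0: "einterval 0 \<infinity> = {0<..}" by (auto simp: einterval_def)
  have to_inf: "(LBINT x=0..\<infinity>. g x) = (LBINT x:{0<..}. g x)" for g :: "real \<Rightarrow> real"
    by (simp add: interval_lebesgue_integral_def E0)
  have [measurable]: "e \<in> borel_measurable borel" unfolding e_def[abs_def] by measurable
  have ie: "set_integrable lborel {0<..} e"
  proof -
    have "integrable lborel (\<lambda>x. indicator {0<..} x * e x)"
    proof (rule Bochner_Integration.integrable_bound[OF integrable_mult_right[OF heat_majorant_integrable, of 2]])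
      show "AE x in lborel. norm (indicator {0<..} x * e x) \<le> norm (2 * heat_majorant x)"
      proof (rule AE_I2)
        fix x :: real
        show "norm (indicator {0<..} x * e x) \<le> norm (2 * heat_majorant x)"
        proof (cases "0 < x")
          case True
          have "x powr (2 * r) * exp (- x\<^sup>2) \<le> heat_majorant x"
          proof (cases "x \<le> 1")
            case True
            have "x powr (2 * r) * exp (- x\<^sup>2) \<le> x powr (2 * r) + 1"
              by (rule order.trans[OF mult_left_le]) auto
            then show ?thesis using True \<open>0 < x\<close> by (auto simp: heat_majorant_def indicator_def)
          next
            case False
            have "exp (- x\<^sup>2) \<le> 1 / x\<^sup>2"
            proof -
              have "x\<^sup>2 \<le> exp (x\<^sup>2)" using exp_ge_add_one_self[of "x\<^sup>2"] by linarith
              then show ?thesis using True by (simp add: exp_minus inverse_eq_divide frac_le)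
            qed
            then have "x powr (2 * r) * exp (- x\<^sup>2) \<le> x powr (2 * r) * (1 / x\<^sup>2)"
              by (intro mult_left_mono) auto
            also have "\<dots> = x powr (2 * r - 2)"
              using True by (simp add: powr_diff powr_numeral)
            finally show ?thesis using False by (simp add: heat_majorant_def indicator_def)
          qed
          then show ?thesis using True heat_majorant_nonneg[of x] by (simp add: e_def)
        qed simp
      qed
    qed simp
    then show ?thesis by (simp add: set_integrable_def)
  qed
  have int_e: "(\<integral>x. indicator {0<..} x * e x \<partial>lborel) = Gamma (r + 1/2)"
  proof -
    define f where "f t = t powr (r - 1/2) / exp t" for t :: real
    have fg: "f (x\<^sup>2) * (2 * x) = e x" if "0 < x" for x
    proof -
      have "(x\<^sup>2) powr (r - 1/2) = x powr (2 * r - 1)"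
        using that by (simp add: powr_powr powr_numeral[symmetric] algebra_simps del: powr_numeral)
      then show ?thesis using that by (simp add: f_def e_def powr_diff exp_minus field_simps)
    qed
    have ifg: "set_integrable lborel (einterval 0 \<infinity>) (\<lambda>x. f (x\<^sup>2) * (2 * x))"
      using ie fg unfolding E0 by (subst set_integrable_cong[OF refl refl, of _ _ e]) auto
    have lim0: "((ereal \<circ> (\<lambda>x. x\<^sup>2) \<circ> real_of_ereal) \<longlongrightarrow> 0) (at_right 0)"
      unfolding zero_ereal_def ereal_tendsto_simps
      by (rule tendsto_eq_intros refl | simp)+
    have liminf: "((ereal \<circ> (\<lambda>x. x\<^sup>2) \<circ> real_of_ereal) \<longlongrightarrow> \<infinity>) (at_left \<infinity>)"
      unfolding ereal_tendsto_simps
      unfolding comp_def tendsto_PInfty_eq_at_top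
      by (intro filterlim_pow_at_top filterlim_ident) simp
    have d1: "((\<lambda>x. x\<^sup>2) has_real_derivative 2 * x) (at x)" for x :: real
      by (auto intro!: derivative_eq_intros)
    have d2: "isCont f (x\<^sup>2)" if "0 < ereal x" for x
      unfolding f_def using that by (intro continuous_intros) auto
    have d3: "isCont (\<lambda>x. 2 * x) x" for x :: real
      by (intro continuous_intros)
    have d4: "0 \<le> f (x\<^sup>2)" for x by (simp add: f_def)
    have d5: "0 \<le> 2 * x" if "0 \<le> ereal x" for x using that by simp
    note sub = interval_integral_substitution_nonneg[where f = f and g = "\<lambda>x. x\<^sup>2" and g' = "\<lambda>x. 2 * x",
        OF _ d1 d2 d3 d4 d5 lim0 liminf ifg, simplified]
    have "(LBINT x=0..\<infinity>. f x) = integral {0<..} f"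
      using set_borel_integral_eq_integral(2)[OF sub(1)[unfolded E0]]
      by (simp add: to_inf)
    also have "\<dots> = integral {0..} f"
      by (rule integral_subset_negligible) (auto intro: negligible_subset[of "{0}"])
    also have "\<dots> = Gamma (r + 1/2)"
      using Gamma_integral_real[of "r + 1/2"] r
      by (intro integral_unique) (simp add: f_def[abs_def])
    finally have "Gamma (r + 1/2) = (LBINT x=0..\<infinity>. f (x\<^sup>2) * (2 * x))" using sub(2) by simp
    also have "\<dots> = (LBINT x:{0<..}. f (x\<^sup>2) * (2 * x))"
      by (simp add: to_inf)
    also have "\<dots> = (LBINT x:{0<..}. e x)"
      using fg by (intro set_lebesgue_integral_cong) auto
    finally show ?thesis by (simp add: set_lebesgue_integral_def)
  qed
  define H where "H x = x powr (2 * r - 1) * (1 - exp (- x\<^sup>2))" for x :: real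
  have dH: "(H has_real_derivative (2 * r - 1) * heat_profile x + e x) (at x)" if "0 < x" for x
  proof -
    have "((\<lambda>x. x powr (2 * r - 1)) has_real_derivative (2 * r - 1) * x powr (2 * r - 2)) (at x)"
      using has_real_derivative_powr[OF that, of "2 * r - 1"] by (simp add: algebra_simps)
    moreover have "((\<lambda>x. 1 - exp (- x\<^sup>2)) has_real_derivative 2 * x * exp (- x\<^sup>2)) (at x)"
      by (auto intro!: derivative_eq_intros)
    ultimately have "(H has_real_derivative
        (2 * r - 1) * x powr (2 * r - 2) * (1 - exp (- x\<^sup>2)) + 2 * x * exp (- x\<^sup>2) * x powr (2 * r - 1)) (at x)"
      unfolding H_def[abs_def] by (rule DERIV_mult)
    moreover have "x * x powr (2 * r - 1) = x powr (2 * r)"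
      using that by (simp add: powr_diff)
    then have "2 * x * exp (- x\<^sup>2) * x powr (2 * r - 1) = e x"
      by (simp add: e_def mult_ac)
    ultimately show ?thesis by (simp add: heat_profile_def mult.assoc)
  qed
  have iH: "set_integrable lborel {0<..} (\<lambda>x. (2 * r - 1) * heat_profile x + e x)"
    using ie heat_profile_integrable by (intro set_integral_add set_integrable_mult_right) (auto simp: set_integrable_def)
  \<comment> \<open>Both boundary values of \<open>H\<close> vanish: \<open>H x\<close> is at most
    \<open>x powr (2 * r + 1)\<close> near 0 and at most \<open>x powr (2 * r - 1)\<close> near
    infinity.\<close>
  have "(LBINT x=0..\<infinity>. (2 * r - 1) * heat_profile x + e x) = 0 - 0"
  proof (rule interval_integral_FTC_integrable[where F = H])
    fix x :: real assume x: "0 < ereal x"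
    then have x: "0 < x" by simp
    show "(H has_vector_derivative (2 * r - 1) * heat_profile x + e x) (at x)"
      using dH[OF x] by (simp add: has_real_derivative_iff_has_vector_derivative)
    show "isCont (\<lambda>x. (2 * r - 1) * heat_profile x + e x) x"
      unfolding e_def using x by (intro continuous_intros isCont_heat_profile) auto
  next
    have "((\<lambda>x. H x) \<longlongrightarrow> 0) (at_right 0)"
    proof (rule tendsto_sandwich[of "\<lambda>_. 0" _ _ "\<lambda>x. x powr (2 * r + 1)"])
      show "\<forall>\<^sub>F x in at_right 0. 0 \<le> H x" by (simp add: H_def)
      show "\<forall>\<^sub>F x in at_right 0. H x \<le> x powr (2 * r + 1)"
        unfolding eventually_at_filter
      proof (intro always_eventually allI impI)
        fix x :: real assume "x \<noteq> 0" "x \<in> {0<..}"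
        then have x: "0 < x" by simp
        have "H x = x * heat_profile x"
          using x by (simp add: H_def heat_profile_def powr_diff powr_numeral power2_eq_square)
        also have "\<dots> \<le> x * x powr (2 * r)"
          using x heat_profile_le(1)[OF x] by (intro mult_left_mono) auto
        finally show "H x \<le> x powr (2 * r + 1)" using x by (simp add: powr_add mult.commute)
      qed
      show "((\<lambda>x. x powr (2 * r + 1)) \<longlongrightarrow> 0) (at_right 0)"
        using r by (intro tendsto_zero_powrI[of _ _ _ "2 * r + 1"] tendsto_const) (auto intro: tendsto_ident_at simp: eventually_at_filter)
    qed simp
    then show "((H \<circ> real_of_ereal) \<longlongrightarrow> 0) (at_right 0)"
      unfolding zero_ereal_def by (simp add: ereal_tendsto_simps)
    have "(H \<longlongrightarrow> 0) at_top"
    proof (rule tendsto_sandwich[of "\<lambda>_. 0" _ _ "\<lambda>x. x powr (2 * r - 1)"])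
      show "\<forall>\<^sub>F x in at_top. 0 \<le> H x" by (simp add: H_def)
      show "\<forall>\<^sub>F x in at_top. H x \<le> x powr (2 * r - 1)"
        unfolding H_def by (intro always_eventually allI mult_left_le) auto
      show "((\<lambda>x. x powr (2 * r - 1)) \<longlongrightarrow> 0) at_top"
        using r by (intro tendsto_neg_powr filterlim_ident) auto
    qed simp
    then show "((H \<circ> real_of_ereal) \<longlongrightarrow> 0) (at_left \<infinity>)"
      by (simp add: ereal_tendsto_simps)
  qed (use iH in \<open>auto simp: E0\<close>)
  then have "(LBINT x:{0<..}. (2 * r - 1) * heat_profile x + e x) = 0"
    by (simp add: to_inf)
  moreover have "(LBINT x:{0<..}. (2 * r - 1) * heat_profile x + e x) =
      (2 * r - 1) * (LBINT x:{0<..}. heat_profile x) + (LBINT x:{0<..}. e x)"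
  proof -
    have hp: "set_integrable lborel {0<..} (\<lambda>x. (2 * r - 1) * heat_profile x)"
      using heat_profile_integrable by (intro set_integrable_mult_right) (simp add: set_integrable_def)
    show ?thesis using set_integral_add(2)[OF hp ie] by simp
  qed
  ultimately have "(2 * r - 1) * (\<integral>x. indicator {0<..} x * heat_profile x \<partial>lborel) + Gamma (r + 1/2) = 0"
    using int_e by (simp add: set_lebesgue_integral_def)
  then show ?thesis using r by (simp add: field_simps)
qed

text \<open>The integral is improper at both ends, so the sums are written as integrals of step
  functions with values at right endpoints, and dominated convergence applies. Continuity gives the
  pointwise limit, since the endpoint \<open>y n x\<close> lies within \<open>h n\<close> of
  \<open>x\<close>.\<close>

lemma riemann_sum_heat_profile:
  assumes h: "\<And>n. 0 < h n" and h0: "h \<longlonglongrightarrow> 0"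
  shows "(\<lambda>n. \<Sum>k. h n * heat_profile (h n * real (Suc k))) \<longlonglongrightarrow> Gamma (r + 1/2) / (2 * (1/2 - r))"
proof -
  define y where "y n x = h n * real_of_int \<lceil>x / h n\<rceil>" for n x
  define s where "s n x = indicator {0<..} x * heat_profile (y n x)" for n x
  have [measurable]: "s n \<in> borel_measurable borel" for n
    unfolding s_def[abs_def] y_def[abs_def] by measurable
  have y: "x \<le> y n x" "y n x \<le> x + h n" for n x
  proof -
    have "h n * (x / h n) \<le> y n x" unfolding y_def using h[of n] by (intro mult_left_mono) auto
    then show "x \<le> y n x" using h[of n] by simp
    have "y n x \<le> h n * (x / h n + 1)" unfolding y_def using h[of n] by (intro mult_left_mono) (auto simp: ceiling_correct intro: less_imp_le)
    then show "y n x \<le> x + h n" using h[of n] by (simp add: distrib_left)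
  qed
  have dom: "norm (s n x) \<le> heat_majorant x" for n x
    using heat_profile_le_majorant[OF _ y(1)] heat_majorant_nonneg[of x]
    by (auto simp: s_def indicator_def heat_profile_nonneg)
  have lim: "(\<lambda>n. \<integral>x. s n x \<partial>lborel) \<longlonglongrightarrow> (\<integral>x. indicator {0<..} x * heat_profile x \<partial>lborel)"
  proof (rule integral_dominated_convergence[OF _ _ heat_majorant_integrable])
    show "AE x in lborel. (\<lambda>n. s n x) \<longlonglongrightarrow> indicator {0<..} x * heat_profile x"
    proof (rule AE_I2)
      fix x :: real
      show "(\<lambda>n. s n x) \<longlonglongrightarrow> indicator {0<..} x * heat_profile x"
      proof (cases "0 < x")
        case True
        have "(\<lambda>n. y n x) \<longlonglongrightarrow> x"
        proof (rule tendsto_sandwich[OF _ _ tendsto_const])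
          show "(\<lambda>n. x + h n) \<longlonglongrightarrow> x" using tendsto_add[OF tendsto_const h0, of x] by simp
        qed (simp_all add: y)
        then have "(\<lambda>n. heat_profile (y n x)) \<longlonglongrightarrow> heat_profile x"
          using isCont_heat_profile[OF True] by (rule isCont_tendsto_compose[rotated])
        then show ?thesis using True by (simp add: s_def)
      qed (simp add: s_def)
    qed
  qed (use dom in \<open>auto intro!: AE_I2\<close>)
  have "(\<integral>x. s n x \<partial>lborel) = (\<Sum>k. h n * heat_profile (h n * real (Suc k)))" for n
  proof -
    \<comment> \<open>Open on the left, closed on the right: the ceiling of \<open>x / h n\<close>
      is then \<open>Suc k\<close> on the whole cell.\<close>
    define J where "J k = {h n * real k <.. h n * real (Suc k)}" for k
    have disj: "disjoint_family J"
      unfolding disjoint_family_on_def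
    proof (intro ballI impI)
      fix i j :: nat assume "i \<noteq> j"
      have "J i \<inter> J j = {}" if "i < j" for i j
      proof -
        have "h n * real (Suc i) \<le> h n * real j" using that h[of n] by (intro mult_left_mono) auto
        then show ?thesis unfolding J_def by (auto dest: less_le_trans le_less_trans)
      qed
      then show "J i \<inter> J j = {}" using \<open>i \<noteq> j\<close> by (metis Int_commute linorder_neqE_nat)
    qed
    have pt: "ennreal (s n x) = (\<Sum>k. ennreal (heat_profile (h n * real (Suc k))) * indicator (J k) x)" for x
    proof (cases "0 < x")
      case True
      define k where "k = nat (\<lceil>x / h n\<rceil> - 1)"
      have "0 < x / h n" using True h[of n] by simp
      then have c: "1 \<le> \<lceil>x / h n\<rceil>" by (simp add: le_ceiling_iff)
      then have ck: "real_of_int \<lceil>x / h n\<rceil> = real (Suc k)" by (simp add: k_def)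
      have ub: "x / h n \<le> real (Suc k)" unfolding ck[symmetric] by (rule le_of_int_ceiling)
      have lb: "real k < x / h n" using ceiling_correct[of "x / h n"] ck by simp
      have "x \<in> J k"
        using ub lb h[of n] by (simp add: J_def field_simps)
      from suminf_cmult_indicator[OF disj this, of "\<lambda>k. ennreal (heat_profile (h n * real (Suc k)))"]
      show ?thesis using True by (simp add: s_def y_def ck)
    next
      case False
      have "x \<notin> J k" for k
      proof -
        have "0 \<le> h n * real k" using h[of n] by simp
        then show ?thesis using False by (simp add: J_def)
      qed
      then show ?thesis using False by (simp add: s_def)
    qed
    have "integrable lborel (s n)"
      by (rule Bochner_Integration.integrable_bound[OF heat_majorant_integrable])
         (use dom heat_majorant_nonneg in auto)
    moreover have "0 \<le> s n x" for x by (simp add: s_def heat_profile_nonneg)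
    \<comment> \<open>The series is evaluated in \<open>ennreal\<close>, where it needs no
      convergence proof; finiteness of the integral then yields summability of the real
      series.\<close>
    ultimately have "ennreal (\<integral>x. s n x \<partial>lborel) = (\<integral>\<^sup>+x. ennreal (s n x) \<partial>lborel)"
      by (intro nn_integral_eq_integral[symmetric] AE_I2)
    also have "\<dots> = (\<Sum>k. \<integral>\<^sup>+x. ennreal (heat_profile (h n * real (Suc k))) * indicator (J k) x \<partial>lborel)"
      unfolding pt by (rule nn_integral_suminf) (auto simp: J_def)
    also have "\<dots> = (\<Sum>k. ennreal (h n * heat_profile (h n * real (Suc k))))"
    proof (rule suminf_cong)
      fix k
      have "h n * real k \<le> h n * real (Suc k)" using h[of n] by (intro mult_left_mono) auto
      then have "emeasure lborel (J k) = ennreal (h n)"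
        unfolding J_def by (simp add: algebra_simps)
      then show "(\<integral>\<^sup>+x. ennreal (heat_profile (h n * real (Suc k))) * indicator (J k) x \<partial>lborel) =
          ennreal (h n * heat_profile (h n * real (Suc k)))"
        using h[of n] by (subst nn_integral_cmult_indicator)
          (auto simp: J_def ennreal_mult[symmetric] heat_profile_nonneg mult.commute less_imp_le)
    qed
    finally have eq: "ennreal (\<integral>x. s n x \<partial>lborel) = (\<Sum>k. ennreal (h n * heat_profile (h n * real (Suc k))))" .
    have nn: "0 \<le> h n * heat_profile (h n * real (Suc k))" for k
      using h[of n] heat_profile_nonneg by simp
    have nt: "(\<Sum>k. ennreal (h n * heat_profile (h n * real (Suc k)))) \<noteq> top"
      unfolding eq[symmetric] by simp
    have "ennreal (\<integral>x. s n x \<partial>lborel) = ennreal (\<Sum>k. h n * heat_profile (h n * real (Suc k)))"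
      unfolding eq by (rule suminf_ennreal[OF nn nt])
    moreover have "0 \<le> (\<integral>x. s n x \<partial>lborel)"
      by (intro integral_nonneg_AE AE_I2) (simp add: s_def heat_profile_nonneg)
    moreover have "0 \<le> (\<Sum>k. h n * heat_profile (h n * real (Suc k)))"
      by (intro suminf_nonneg summable_suminf_not_top nn nt)
    ultimately show ?thesis by (simp add: ennreal_inj)
  qed
  then show ?thesis using lim unfolding integral_heat_profile by simp
qed

end


section \<open>Asymptotics of the expected squared norm of an increment\<close>

text \<open>The share of one mode in the expected squared norm of a stationary increment. It
  dominates the share of the process started at 0.\<close>

definition heat_term :: "real \<Rightarrow> real \<Rightarrow> nat \<Rightarrow> real" where
  "heat_term r d k = lam k powr r * ((1 - exp (- lam k * d)) / lam k)"

definition heat_sum :: "real \<Rightarrow> real \<Rightarrow> real" where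
  "heat_sum r d = (\<Sum>k. heat_term r d k)"

lemma lam_powr: "lam k powr r = real (Suc k) powr (2 * r)"
proof -
  have "lam k = real (Suc k) powr 2" by (simp add: eigval_def powr_numeral)
  then show ?thesis by (simp only: powr_powr)
qed

lemma lam_ge_1: "1 \<le> lam k"
  by (simp add: eigval_def one_le_power)

lemma heat_term_eq: "heat_term r d k = real (Suc k) powr (2 * r - 2) * (1 - exp (- (real (Suc k))\<^sup>2 * d))"
proof -
  have "lam k powr r / lam k = real (Suc k) powr (2 * r - 2)"
    unfolding lam_powr by (simp add: powr_diff powr_numeral eigval_def)
  moreover have "heat_term r d k = lam k powr r / lam k * (1 - exp (- lam k * d))"
    by (simp add: heat_term_def)
  ultimately show ?thesis by (simp only: eigval_def)
qed

lemma heat_term_nonneg: "0 \<le> d \<Longrightarrow> 0 \<le> heat_term r d k"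
  using lam_pos[of k] by (simp add: heat_term_def)

lemma summable_Suc_powr: "s < -1 \<Longrightarrow> summable (\<lambda>k. real (Suc k) powr s)"
  using summable_real_powr_iff[of s] by (subst (asm) summable_Suc_iff[symmetric]) simp

lemma summable_heat_term:
  assumes "r < 1 / 2" "0 \<le> d"
  shows "summable (heat_term r d)"
proof (rule summable_comparison_test')
  show "summable (\<lambda>k. real (Suc k) powr (2 * r - 2))"
    using assms by (intro summable_Suc_powr) auto
  show "norm (heat_term r d k) \<le> real (Suc k) powr (2 * r - 2)" if "0 \<le> k" for k
    using heat_term_nonneg[OF assms(2), of r k]
    by (simp add: heat_term_eq mult_left_le)
qed

lemma heat_sum_nonneg: "r < 1 / 2 \<Longrightarrow> 0 \<le> d \<Longrightarrow> 0 \<le> heat_sum r d"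
  unfolding heat_sum_def by (intro suminf_nonneg summable_heat_term heat_term_nonneg)

text \<open>A bound uniform in \<open>k\<close>, which controls the largest share of a single mode.
  For \<open>r > 0\<close> the growing weight \<open>lam k powr r\<close> is absorbed by
  \<open>1 - exp (- z) \<le> z powr (1 - r)\<close> at \<open>z = lam k * d\<close>, so that the
  powers of \<open>lam k\<close> cancel.\<close>

lemma heat_term_le:
  assumes "r < 1 / 2" "0 < d"
  shows "heat_term r d k \<le> d powr (1 - max r 0)"
proof (cases "r \<le> 0")
  case True
  have "lam k powr r \<le> 1"
    using lam_ge_1[of k] True powr_mono[of r 0 "lam k"] by simp
  moreover have "(1 - exp (- lam k * d)) / lam k \<le> d"
    using exp_neg_bounds(1)[of "lam k * d"] lam_pos[of k] assms by (simp add: divide_le_eq mult.commute)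
  moreover have "0 \<le> (1 - exp (- lam k * d)) / lam k" using lam_pos[of k] assms by simp
  ultimately have "heat_term r d k \<le> 1 * d"
    unfolding heat_term_def by (intro mult_mono) auto
  then show ?thesis using True assms by simp
next
  case False
  define z where "z = lam k * d"
  have z: "0 < z" using lam_pos[of k] assms by (simp add: z_def)
  have "1 - exp (- z) \<le> z powr (1 - r)"
  proof (cases "z \<le> 1")
    case True
    have "z = z powr 1" using z by simp
    also have "\<dots> \<le> z powr (1 - r)" using True z False by (intro powr_mono') auto
    finally show ?thesis using exp_neg_bounds(1)[of z] z by simp
  next
    case F: False
    have "1 \<le> z powr (1 - r)" using F assms by (intro ge_one_powr_ge_zero) auto
    then show ?thesis by (smt (verit) exp_gt_zero)
  qed
  then have "heat_term r d k \<le> lam k powr r * (z powr (1 - r) / lam k)"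
    unfolding heat_term_def using lam_pos[of k] by (intro mult_left_mono divide_right_mono) (auto simp: z_def)
  also have "\<dots> = d powr (1 - r)"
    using lam_pos[of k] assms by (simp add: z_def powr_mult powr_diff)
  finally show ?thesis using False by simp
qed

lemma heat_sum_tendsto_middle:
  assumes r: "- 1 / 2 < r" "r < 1 / 2" and d: "\<And>n. 0 < \<delta> n" "\<delta> \<longlonglongrightarrow> 0"
  shows "(\<lambda>n. heat_sum r (\<delta> n) / \<delta> n powr (1/2 - r)) \<longlonglongrightarrow> Gamma (r + 1/2) / (2 * (1/2 - r))"
proof -
  define h where "h n = sqrt (\<delta> n)" for n
  have h: "0 < h n" for n using d by (simp add: h_def)
  have "h \<longlonglongrightarrow> sqrt 0" unfolding h_def by (intro tendsto_intros d)
  then have h0: "h \<longlonglongrightarrow> 0" by simp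
  have "heat_sum r (\<delta> n) / \<delta> n powr (1/2 - r) = (\<Sum>k. h n * heat_profile r (h n * real (Suc k)))" for n
  proof -
    have "heat_sum r (\<delta> n) / \<delta> n powr (1/2 - r) = (\<Sum>k. heat_term r (\<delta> n) k / \<delta> n powr (1/2 - r))"
      unfolding heat_sum_def using summable_heat_term[OF r(2)] d(1)[of n] by (intro suminf_divide[symmetric]) simp
    also have "\<dots> = (\<Sum>k. h n * heat_profile r (h n * real (Suc k)))"
    proof (rule suminf_cong)
      fix k
      define j where "j = real (Suc k)"
      have j: "0 < j" by (simp add: j_def)
      have dh: "\<delta> n = h n powr 2" using d(1)[of n] h[of n] by (simp add: h_def powr_numeral)
      have p: "\<delta> n powr (1/2 - r) = h n powr (1 - 2 * r)"
        unfolding dh powr_powr by (simp add: algebra_simps)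
      have q: "h n * h n powr (2 * r - 2) = 1 / h n powr (1 - 2 * r)"
      proof -
        have "h n * h n powr (2 * r - 2) = h n powr 1 * h n powr (2 * r - 2)" using h[of n] by simp
        also have "\<dots> = h n powr (- (1 - 2 * r))" unfolding powr_add[symmetric] by simp
        finally show ?thesis by (simp only: powr_minus inverse_eq_divide)
      qed
      have "h n * heat_profile r (h n * j) = (h n * h n powr (2 * r - 2)) * (j powr (2 * r - 2) * (1 - exp (- (h n * j)\<^sup>2)))"
        using h[of n] j by (simp add: heat_profile_def[OF r] powr_mult mult_ac)
      also have "(h n * j)\<^sup>2 = j\<^sup>2 * \<delta> n" using d(1)[of n] by (simp add: h_def power_mult_distrib mult.commute)
      finally show "heat_term r (\<delta> n) k / \<delta> n powr (1/2 - r) = h n * heat_profile r (h n * real (Suc k))"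
        unfolding heat_term_eq q p j_def by simp
    qed
    finally show ?thesis .
  qed
  then show ?thesis using riemann_sum_heat_profile[OF r h h0] by simp
qed

text \<open>The sum is split at \<open>R = 1 / sqrt d\<close>, where \<open>lam k * d\<close> is
  about 1. Below, the terms are close to \<open>d / k\<close> and their harmonic sum is
  \<open>d * ln R = d * \<bar>ln d\<bar> / 2\<close> up to \<open>d\<close>; above, they are at most
  \<open>1 / k ^ 3\<close>, in total \<open>4 * d\<close>. The bound \<open>d \<le> 1 / 4\<close>
  ensures \<open>R \<ge> 2\<close> and thereby \<open>m \<ge> R / 2\<close>.\<close>

lemma heat_sum_log_bound:
  assumes d: "0 < d" "d \<le> 1 / 4"
  shows "\<bar>heat_sum (- 1 / 2) d - d * \<bar>ln d\<bar> / 2\<bar> \<le> 5 * d"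
proof -
  define R where "R = 1 / sqrt d"
  define m where "m = nat \<lfloor>R\<rfloor>"
  have sd: "0 < sqrt d" "sqrt d \<le> 1 / 2"
    using d real_sqrt_le_mono[of d "1/4"] by (auto simp: real_sqrt_divide)
  have R2: "2 \<le> R" using sd by (simp add: R_def field_simps)
  have RR: "R * R = 1 / d" using d by (simp add: R_def)
  have m: "real m \<le> R" "R < real m + 1" using R2 by (auto simp: m_def) 
  have mR: "R / 2 \<le> real m" using m R2 by linarith
  have m0: "0 < real m" using mR R2 by linarith
  have lnR: "ln R = \<bar>ln d\<bar> / 2"
    using d by (simp add: R_def ln_div ln_sqrt)
  define f where "f = heat_term (- 1 / 2) d"
  have sf: "summable f" unfolding f_def using d by (intro summable_heat_term) auto
  have f: "f k = (1 - exp (- (real (Suc k))\<^sup>2 * d)) / real (Suc k) ^ 3" for k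
  proof -
    have "real (Suc k) powr (2 * (- 1 / 2) - 2) = real (Suc k) powr (- 3)" by simp
    also have "\<dots> = 1 / real (Suc k) ^ 3"
      by (subst powr_minus) (simp only: powr_numeral[OF of_nat_0_le_iff] inverse_eq_divide)
    finally show ?thesis unfolding f_def heat_term_eq by (simp only: times_divide_eq_left mult_1)
  qed
  have f0: "0 \<le> f k" for k unfolding f_def using d by (intro heat_term_nonneg) auto
  have split: "heat_sum (- 1 / 2) d = (\<Sum>k. f (k + m)) + (\<Sum>k<m. f k)"
    unfolding heat_sum_def f_def[symmetric] by (rule suminf_split_initial_segment[OF sf])
  have f_up: "f k \<le> d / real (Suc k)" and f_lo: "d / real (Suc k) - d\<^sup>2 / 2 * real (Suc k) \<le> f k" for k
  proof -
    define j where "j = real (Suc k)"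
    have j: "0 < j" by (simp add: j_def)
    have z: "0 \<le> j\<^sup>2 * d" using d by simp
    have e: "j\<^sup>2 * d / j ^ 3 = d / j" "(j\<^sup>2 * d - (j\<^sup>2 * d)\<^sup>2 / 2) / j ^ 3 = d / j - d\<^sup>2 / 2 * j"
      using j by (simp_all add: field_simps eval_nat_numeral)
    show "f k \<le> d / real (Suc k)"
      unfolding f j_def[symmetric] e(1)[symmetric] using exp_neg_bounds[OF z] j by (intro divide_right_mono) auto
    show "d / real (Suc k) - d\<^sup>2 / 2 * real (Suc k) \<le> f k"
      unfolding f j_def[symmetric] e(2)[symmetric] using exp_neg_bounds[OF z] j by (intro divide_right_mono) auto
  qed
  have harm: "(\<Sum>k<m. d / real (Suc k)) = d * harm m"
    by (simp add: harm_altdef sum_distrib_left divide_inverse)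
  have "(\<Sum>k<m. f k) \<le> d * harm m"
    unfolding harm[symmetric] by (intro sum_mono f_up)
  also have "\<dots> \<le> d * (ln R + 1)"
  proof -
    have "harm n \<le> ln (real n) + (1::real)" if "0 < n" for n
      using that
    proof (induction n rule: nat_induct_non_zero)
      case (Suc n)
      have "ln (real n / real (Suc n)) \<le> real n / real (Suc n) - 1"
        using Suc by (intro ln_le_minus_one) auto
      then have "ln (real n) - ln (real (Suc n)) \<le> - inverse (real (Suc n))"
        using Suc by (simp add: ln_div field_simps)
      then show ?case using Suc by (simp add: harm_Suc)
    qed (simp add: harm_expand)
    then have "harm m \<le> ln (real m) + (1::real)" using m0 by simp
    also have "\<dots> \<le> ln R + 1" using m m0 by simp
    finally show ?thesis using d by (intro mult_left_mono) auto
  qed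
  finally have head_up: "(\<Sum>k<m. f k) \<le> d * (\<bar>ln d\<bar> / 2) + d" by (simp add: lnR algebra_simps)
  have tail_up: "(\<Sum>k. f (k + m)) \<le> 4 * d"
  proof -
    \<comment> \<open>A telescoping majorant:
      \<open>1 / (j + 1) ^ 3 \<le> 1 / j\<^sup>2 - 1 / (j + 1)\<^sup>2\<close>.\<close>
    define t where "t k = 1 / (real (k + m))\<^sup>2" for k
    have t0: "t \<longlonglongrightarrow> 0"
    proof -
      have "(\<lambda>k. 1 / (real k)\<^sup>2) \<longlonglongrightarrow> 0" by real_asymp
      then show ?thesis unfolding t_def by (rule LIMSEQ_ignore_initial_segment)
    qed
    have tel: "(\<lambda>k. t k - t (Suc k)) sums (t 0 - 0)" by (rule telescope_sums'[OF t0])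
    have le: "f (k + m) \<le> t k - t (Suc k)" for k
    proof -
      define j where "j = real (k + m)"
      have j: "0 < j" using m0 by (simp add: j_def)
      have "f (k + m) \<le> 1 / (j + 1) ^ 3"
        unfolding f using j d by (intro divide_mono) (auto simp: j_def add.commute intro!: mult_nonneg_nonneg)
      also have "\<dots> \<le> 1 / j\<^sup>2 - 1 / (j + 1)\<^sup>2"
      proof -
        have "1 / j\<^sup>2 - 1 / (j + 1)\<^sup>2 - 1 / (j + 1) ^ 3 = (j\<^sup>2 + 3 * j + 1) / (j\<^sup>2 * (j + 1) ^ 3)"
          using j by (simp add: divide_simps) (simp add: algebra_simps eval_nat_numeral)
        moreover have "0 \<le> (j\<^sup>2 + 3 * j + 1) / (j\<^sup>2 * (j + 1) ^ 3)" using j by simp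
        ultimately show ?thesis by linarith
      qed
      finally show ?thesis by (simp add: t_def j_def add.commute)
    qed
    have "(\<Sum>k. f (k + m)) \<le> (\<Sum>k. t k - t (Suc k))"
      using sf by (intro suminf_le le sums_summable[OF tel]) (subst summable_iff_shift)
    also have "\<dots> = 1 / (real m)\<^sup>2" using sums_unique[OF tel] by (simp add: t_def)
    also have "\<dots> \<le> 1 / (R / 2)\<^sup>2" using mR R2 m0 by (intro divide_left_mono power_mono) auto
    also have "\<dots> = 4 * d" using RR d by (simp add: power2_eq_square)
    finally show ?thesis .
  qed
  have tail_lo: "0 \<le> (\<Sum>k. f (k + m))"
    using sf f0 by (intro suminf_nonneg) (subst summable_iff_shift)
  have head_lo: "d * (\<bar>ln d\<bar> / 2) - d \<le> (\<Sum>k<m. f k)"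
  proof -
    have "ln R \<le> ln (real m + 1)" using m R2 by simp
    also have "\<dots> \<le> harm m" by (rule ln_le_harm)
    finally have "\<bar>ln d\<bar> / 2 \<le> harm m" by (simp only: lnR)
    then have "d * (\<bar>ln d\<bar> / 2) \<le> d * harm m" using d by (intro mult_left_mono) auto
    moreover have "d\<^sup>2 / 2 * (\<Sum>k<m. real (Suc k)) \<le> d"
    proof -
      have "(\<Sum>k<m. real (Suc k)) \<le> (\<Sum>k<m. real m)" by (intro sum_mono) auto
      also have "\<dots> = real m * real m" by simp
      also have "\<dots> \<le> R * R" using m m0 by (intro mult_mono) auto
      finally have "(\<Sum>k<m. real (Suc k)) \<le> 1 / d" using RR by simp
      then have "d\<^sup>2 / 2 * (\<Sum>k<m. real (Suc k)) \<le> d\<^sup>2 / 2 * (1 / d)" by (intro mult_left_mono) auto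
      also have "\<dots> \<le> d" using d by (simp add: power2_eq_square)
      finally show ?thesis .
    qed
    moreover have "d * harm m - d\<^sup>2 / 2 * (\<Sum>k<m. real (Suc k)) \<le> (\<Sum>k<m. f k)"
    proof -
      have "(\<Sum>k<m. d / real (Suc k) - d\<^sup>2 / 2 * real (Suc k)) \<le> (\<Sum>k<m. f k)" by (intro sum_mono f_lo)
      then show ?thesis by (simp only: sum_subtractf sum_distrib_left[symmetric] harm)
    qed
    ultimately show ?thesis by linarith
  qed
  show ?thesis unfolding split using head_up head_lo tail_up tail_lo by (simp add: abs_le_iff)
qed

lemma heat_sum_tendsto_log:
  assumes d: "\<And>n. 0 < \<delta> n" "\<delta> \<longlonglongrightarrow> 0"
  shows "(\<lambda>n. heat_sum (- 1 / 2) (\<delta> n) / (\<delta> n * \<bar>ln (\<delta> n)\<bar>)) \<longlonglongrightarrow> 1 / 2"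
proof -
  have d0: "filterlim \<delta> (at_right 0) sequentially"
    using d by (auto simp: filterlim_at less_imp_neq[symmetric])
  have ln: "filterlim (\<lambda>n. \<bar>ln (\<delta> n)\<bar>) at_top sequentially"
    using filterlim_at_infinity_imp_norm_at_top[OF filterlim_at_bot_imp_at_infinity[OF filterlim_compose[OF ln_at_0 d0]]]
    by simp
  have bd: "\<forall>\<^sub>F n in sequentially. norm (heat_sum (- 1 / 2) (\<delta> n) / (\<delta> n * \<bar>ln (\<delta> n)\<bar>) - 1 / 2) \<le> 5 / \<bar>ln (\<delta> n)\<bar>"
  proof -
    have "\<forall>\<^sub>F n in sequentially. \<delta> n < 1 / 4" using d(2) by (rule order_tendstoD) simp
    then show ?thesis
    proof eventually_elim
      case (elim n)
      have L: "0 < \<bar>ln (\<delta> n)\<bar>" using elim d(1)[of n] by (simp add: ln_eq_zero_iff)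
      have "heat_sum (- 1 / 2) (\<delta> n) / (\<delta> n * \<bar>ln (\<delta> n)\<bar>) - 1 / 2 =
          (heat_sum (- 1 / 2) (\<delta> n) - \<delta> n * \<bar>ln (\<delta> n)\<bar> / 2) / (\<delta> n * \<bar>ln (\<delta> n)\<bar>)"
        using L d(1)[of n] by (simp add: field_simps)
      also have "norm \<dots> = \<bar>heat_sum (- 1 / 2) (\<delta> n) - \<delta> n * \<bar>ln (\<delta> n)\<bar> / 2\<bar> / (\<delta> n * \<bar>ln (\<delta> n)\<bar>)"
        unfolding real_norm_def abs_divide abs_mult abs_abs using d(1)[of n] by (simp only: abs_of_pos)
      also have "\<dots> \<le> 5 * \<delta> n / (\<delta> n * \<bar>ln (\<delta> n)\<bar>)"
        using heat_sum_log_bound[of "\<delta> n"] d(1)[of n] elim L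
        by (intro divide_right_mono mult_nonneg_nonneg) (simp_all only: abs_ge_zero less_imp_le)
      also have "\<dots> = 5 / \<bar>ln (\<delta> n)\<bar>" using d(1)[of n] by simp
      finally show ?case .
    qed
  qed
  have "(\<lambda>n. 5 / \<bar>ln (\<delta> n)\<bar>) \<longlonglongrightarrow> 0"
    using tendsto_divide_0[OF tendsto_const, of _ sequentially 5] ln by (metis filterlim_at_top_imp_at_infinity)
  then have "(\<lambda>n. heat_sum (- 1 / 2) (\<delta> n) / (\<delta> n * \<bar>ln (\<delta> n)\<bar>) - 1 / 2) \<longlonglongrightarrow> 0"
    by (rule Lim_null_comparison[OF bd])
  then show ?thesis by (rule LIM_zero_cancel)
qed


section \<open>Power variations at a fixed time\<close>

lemma tau_pos:
  assumes "0 < d" "d < 1"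
  shows "0 < tau r d"
proof -
  have "ln d \<noteq> 0" using assms by simp
  then show ?thesis using assms by (auto simp: tau_def)
qed

lemma tau_square:
  assumes "0 < d"
  shows "(tau r d)\<^sup>2 = (if r < - 1 / 2 then d else if r = - 1 / 2 then d * \<bar>ln d\<bar> else d powr (1 / 2 - r))"
proof -
  have sq: "(x powr e)\<^sup>2 = x powr (2 * e)" if "0 \<le> x" for x e :: real
    using that by (simp add: power2_eq_square powr_add[symmetric])
  show ?thesis using assms by (simp add: tau_def sq)
qed

lemma floor_multiple_bounds:
  assumes "0 < d" "0 \<le> t"
  shows "d * real (nat \<lfloor>t / d\<rfloor>) \<le> t" "t - d \<le> d * real (nat \<lfloor>t / d\<rfloor>)"
proof -
  have nn: "0 \<le> t / d" using assms by simp
  then have e: "real (nat \<lfloor>t / d\<rfloor>) = real_of_int \<lfloor>t / d\<rfloor>" by simp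
  have "real_of_int \<lfloor>t / d\<rfloor> \<le> t / d" by simp
  then have "d * real_of_int \<lfloor>t / d\<rfloor> \<le> d * (t / d)" using assms by (intro mult_left_mono) auto
  then show "d * real (nat \<lfloor>t / d\<rfloor>) \<le> t" unfolding e using assms by simp
  have "t / d - 1 \<le> real_of_int \<lfloor>t / d\<rfloor>" by linarith
  then have "d * (t / d - 1) \<le> d * real_of_int \<lfloor>t / d\<rfloor>" using assms by (intro mult_left_mono) auto
  then show "t - d \<le> d * real (nat \<lfloor>t / d\<rfloor>)" unfolding e using assms by (simp add: right_diff_distrib)
qed

text \<open>The estimates contain auxiliary parameters that must be fixed in dependence on
  \<open>e\<close> before the step shrinks. Each choice gives a convergent bound, and only its limit
  has to lie below \<open>e\<close>.\<close>

lemma tendsto_0_of_upper_bounds: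
  fixes a :: "nat \<Rightarrow> real"
  assumes nn: "\<And>n. 0 \<le> a n"
    and ub: "\<And>e. 0 < e \<Longrightarrow> \<exists>u l. u \<longlonglongrightarrow> l \<and> l < e \<and> (\<forall>\<^sub>F n in sequentially. a n \<le> u n)"
  shows "a \<longlonglongrightarrow> 0"
proof (rule order_tendstoI)
  fix e :: real assume "0 < e"
  from ub[OF this] obtain u l where u: "u \<longlonglongrightarrow> l" "l < e" "\<forall>\<^sub>F n in sequentially. a n \<le> u n" by blast
  have "\<forall>\<^sub>F n in sequentially. u n < e" using u(1,2) by (rule order_tendstoD)
  with u(3) show "\<forall>\<^sub>F n in sequentially. a n < e" by eventually_elim simp
next
  fix e :: real assume "e < 0"
  then show "\<forall>\<^sub>F n in sequentially. e < a n" using nn by (intro always_eventually allI) (meson less_le_trans)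
qed

section \<open>Variation of the modes, uniform moment bounds, and the regimes
  \<open>r \<ge> -1/2\<close>\<close>

context heat_modes
begin

definition normalized_inc :: "real \<Rightarrow> real \<Rightarrow> nat \<Rightarrow> 'a \<Rightarrow> real" where
  "normalized_inc r d i = weighted_squares (\<lambda>k. lam k powr r / (tau r d)\<^sup>2) (inc d i)"

text \<open>Almost surely equal to the power variation with exponent \<open>2 * p\<close>. With
  natural powers of an absolute value it is nonnegative and monotone in \<open>t\<close> at every
  outcome, also where the series of squares diverges.\<close>

definition mode_variation :: "real \<Rightarrow> nat \<Rightarrow> real \<Rightarrow> real \<Rightarrow> 'a \<Rightarrow> real" where
  "mode_variation r p d t \<omega> = d * (\<Sum>i=1..nat \<lfloor>t / d\<rfloor>. normalized_inc r d i \<omega> ^ p)"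

context
  fixes r d :: real
  assumes r: "r < 1 / 2" and d: "0 < d" and tau: "0 < tau r d"
begin

lemma weighted_var_le:
  assumes "1 \<le> i"
  shows "lam k powr r / (tau r d)\<^sup>2 * inc_var d i k \<le> heat_term r d k / (tau r d)\<^sup>2"
proof -
  have "lam k powr r * inc_var d i k \<le> heat_term r d k"
    unfolding heat_term_def using inc_var_bounds(2)[OF d assms] by (intro mult_left_mono) auto
  then have "lam k powr r * inc_var d i k / (tau r d)\<^sup>2 \<le> heat_term r d k / (tau r d)\<^sup>2"
    by (intro divide_right_mono) auto
  then show ?thesis by simp
qed

lemma quadratic_form_inc:
  assumes "1 \<le> i"
  shows "quadratic_form M G (inc d i) (\<lambda>k. lam k powr r / (tau r d)\<^sup>2) (inc_var d i)"
proof unfold_locales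
  show "inc d i k \<in> G" for k by (rule inc_G[OF d assms])
  show "expectation (\<lambda>\<omega>. (inc d i k \<omega>)\<^sup>2) = inc_var d i k" for k by (rule expectation_inc[OF d assms])
  show "0 < inc_var d i k" for k by (rule inc_var_bounds[OF d assms])
  show "0 \<le> lam k powr r / (tau r d)\<^sup>2" for k by simp
  show "summable (\<lambda>k. lam k powr r / (tau r d)\<^sup>2 * inc_var d i k)"
  proof (rule summable_comparison_test')
    show "summable (\<lambda>k. heat_term r d k / (tau r d)\<^sup>2)"
      using summable_heat_term[OF r] d by (intro summable_divide) auto
    show "norm (lam k powr r / (tau r d)\<^sup>2 * inc_var d i k) \<le> heat_term r d k / (tau r d)\<^sup>2" if "0 \<le> k" for k
      using weighted_var_le[OF assms, of k] inc_var_bounds(1)[OF d assms, of k] by simp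
  qed
qed

lemma normalized_inc_nonneg: "0 \<le> normalized_inc r d i \<omega>"
  by (simp add: normalized_inc_def weighted_squares_def)

lemma normalized_inc_moments: "1 \<le> i \<Longrightarrow> has_moments M (normalized_inc r d i)"
  unfolding normalized_inc_def by (rule quadratic_form.Q_has_moments[OF quadratic_form_inc])

lemma weighted_var_sum_le:
  assumes "1 \<le> i"
  shows "(\<Sum>k. lam k powr r / (tau r d)\<^sup>2 * inc_var d i k) \<le> heat_sum r d / (tau r d)\<^sup>2"
proof -
  interpret quadratic_form M G "inc d i" "\<lambda>k. lam k powr r / (tau r d)\<^sup>2" "inc_var d i"
    by (rule quadratic_form_inc[OF assms])
  have "(\<Sum>k. lam k powr r / (tau r d)\<^sup>2 * inc_var d i k) \<le> (\<Sum>k. heat_term r d k / (tau r d)\<^sup>2)"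
    using summable_heat_term[OF r] d
    by (intro suminf_le weighted_var_le assms summable_wv summable_divide) auto
  then show ?thesis
    using summable_heat_term[OF r] d by (simp add: heat_sum_def suminf_divide)
qed

lemma normalized_inc_moment_le:
  assumes "1 \<le> i"
  shows "expectation (\<lambda>\<omega>. normalized_inc r d i \<omega> ^ m) \<le> gauss_moment (2 * m) * (heat_sum r d / (tau r d)\<^sup>2) ^ m"
proof -
  interpret quadratic_form M G "inc d i" "\<lambda>k. lam k powr r / (tau r d)\<^sup>2" "inc_var d i"
    by (rule quadratic_form_inc[OF assms])
  show ?thesis
    unfolding normalized_inc_def
    by (rule order.trans[OF Q_moment_le])
       (intro mult_left_mono power_mono weighted_var_sum_le assms S_nonneg gauss_moment_nonneg)
qed

lemma mode_variation_moments: "has_moments M (mode_variation r p d t)"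
  unfolding mode_variation_def[abs_def]
  by (intro has_moments_cmult has_moments_sum has_moments_power normalized_inc_moments) auto

lemma mode_variation_nonneg: "0 \<le> mode_variation r p d t \<omega>"
  unfolding mode_variation_def using d by (intro mult_nonneg_nonneg sum_nonneg) (auto simp: normalized_inc_nonneg)

lemma mode_variation_mono:
  assumes "0 \<le> s" "s \<le> t"
  shows "mode_variation r p d s \<omega> \<le> mode_variation r p d t \<omega>"
proof -
  have "nat \<lfloor>s / d\<rfloor> \<le> nat \<lfloor>t / d\<rfloor>"
    using assms d by (intro nat_mono floor_mono divide_right_mono) auto
  then show ?thesis
    unfolding mode_variation_def using d
    by (intro mult_left_mono sum_mono2) (auto simp: normalized_inc_nonneg)
qed

text \<open>Jensen's inequality over the steps, each with weight \<open>d\<close> and with total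
  weight at most \<open>t\<close>. The bound is uniform in the step as soon as the ratio of
  \<open>heat_sum\<close> to the squared normalization is bounded.\<close>

lemma mode_variation_moment_le:
  assumes "0 \<le> t" "1 \<le> m"
  shows "expectation (\<lambda>\<omega>. mode_variation r p d t \<omega> ^ m) \<le>
    t ^ m * (gauss_moment (2 * (p * m)) * (heat_sum r d / (tau r d)\<^sup>2) ^ (p * m))"
proof -
  define N where "N = nat \<lfloor>t / d\<rfloor>"
  define A where "A = gauss_moment (2 * (p * m)) * (heat_sum r d / (tau r d)\<^sup>2) ^ (p * m)"
  have A0: "0 \<le> A"
    unfolding A_def using heat_sum_nonneg[OF r, of d] d tau
    by (intro mult_nonneg_nonneg gauss_moment_nonneg zero_le_power divide_nonneg_nonneg) auto
  have dN: "0 \<le> d * real N" "d * real N \<le> t" using floor_multiple_bounds[OF d assms(1)] d by (auto simp: N_def)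
  have i: "integrable M (\<lambda>\<omega>. normalized_inc r d i \<omega> ^ (p * m))" if "i \<in> {1..N}" for i
    using that by (intro has_moments_integrable_power normalized_inc_moments) auto
  have "expectation (\<lambda>\<omega>. mode_variation r p d t \<omega> ^ m) \<le>
      expectation (\<lambda>\<omega>. (d * real N) ^ (m - 1) * (\<Sum>i=1..N. d * normalized_inc r d i \<omega> ^ (p * m)))"
  proof (rule integral_mono)
    show "integrable M (\<lambda>\<omega>. mode_variation r p d t \<omega> ^ m)"
      by (rule has_moments_integrable_power[OF mode_variation_moments])
    show "integrable M (\<lambda>\<omega>. (d * real N) ^ (m - 1) * (\<Sum>i=1..N. d * normalized_inc r d i \<omega> ^ (p * m)))"
      by (intro integrable_mult_right Bochner_Integration.integrable_sum i)
    show "mode_variation r p d t \<omega> ^ m \<le> (d * real N) ^ (m - 1) * (\<Sum>i=1..N. d * normalized_inc r d i \<omega> ^ (p * m))" for \<omega>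
      using power_weighted_sum_le[of "{1..N}" m "\<lambda>_. d" "\<lambda>i. normalized_inc r d i \<omega> ^ p"] assms d
      by (simp add: mode_variation_def N_def[symmetric] sum_distrib_left normalized_inc_nonneg power_mult[symmetric] mult.commute)
  qed
  also have "\<dots> = (d * real N) ^ (m - 1) * (\<Sum>i=1..N. d * expectation (\<lambda>\<omega>. normalized_inc r d i \<omega> ^ (p * m)))"
    using i by (simp add: Bochner_Integration.integral_sum)
  also have "\<dots> \<le> (d * real N) ^ (m - 1) * (\<Sum>i=1..N. d * A)"
    unfolding A_def using d dN
    by (intro mult_left_mono sum_mono normalized_inc_moment_le) auto
  also have "\<dots> = (d * real N) ^ m * A"
    using assms(2) by (cases m) auto
  also have "\<dots> \<le> t ^ m * A"
    using dN A0 by (intro mult_right_mono power_mono) auto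
  finally show ?thesis by (simp add: A_def)
qed

text \<open>
  Because of the zero initial condition the expectation has a defect \<open>A - S i\<close> that is not small for
  small \<open>i\<close>; only its sum over \<open>i\<close> is bounded, by a geometric series.
\<close>

lemma average_close_to_constant:
  assumes c: "0 \<le> c" and L: "0 < L" and p: "1 \<le> p"
    and B: "\<And>k. heat_term r d k / (tau r d)\<^sup>2 \<le> B"
  defines "A \<equiv> heat_sum r d / (tau r d)\<^sup>2"
  shows "expectation (\<lambda>\<omega>. \<bar>d * (\<Sum>i=1..N. normalized_inc r d i \<omega> ^ p) - d * real N * c ^ p\<bar>) \<le>
    real p * L ^ (p - 1) * (d * real N * (sqrt (2 * B * A) + \<bar>A - c\<bar>) + d * A / 2) +
    d * real N * (real p * 2 ^ p * (2 * (gauss_moment (2 * Suc p) * A ^ Suc p + c ^ Suc p)) / L)"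
proof -
  define S where "S i = (\<Sum>k. lam k powr r / (tau r d)\<^sup>2 * inc_var d i k)" for i
  \<comment> \<open>Three errors: fluctuation of the form about its mean \<open>S i\<close>,
    distance of the stationary mean \<open>A\<close> from \<open>c\<close>, and the defect
    \<open>A - S i\<close>. Only the last depends on \<open>i\<close>.\<close>
  define e where "e i = sqrt (2 * B * A) + \<bar>A - c\<bar> + (A - S i)" for i
  have A0: "0 \<le> A" unfolding A_def using heat_sum_nonneg[OF r, of d] d by simp
  have B0: "0 \<le> B"
    using order.trans[OF _ B[of 0]] heat_term_nonneg[of d r 0] d by simp
  have dist: "expectation (\<lambda>\<omega>. \<bar>normalized_inc r d i \<omega> - c\<bar>) \<le> e i" if "i \<in> {1..N}" for i
  proof -
    have i: "1 \<le> i" using that by simp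
    interpret quadratic_form M G "inc d i" "\<lambda>k. lam k powr r / (tau r d)\<^sup>2" "inc_var d i"
      by (rule quadratic_form_inc[OF i])
    have "expectation (\<lambda>\<omega>. \<bar>normalized_inc r d i \<omega> - S i\<bar>) \<le> sqrt (2 * B * S i)"
      unfolding normalized_inc_def S_def
      by (intro expectation_abs_Q_minus_S expectation_inc_orth[OF d i] order.trans[OF weighted_var_le[OF i] B])
    also have "\<dots> \<le> sqrt (2 * B * A)"
      unfolding S_def A_def using B0 by (intro real_sqrt_le_mono mult_left_mono weighted_var_sum_le[OF i]) auto
    finally have 1: "expectation (\<lambda>\<omega>. \<bar>normalized_inc r d i \<omega> - S i\<bar>) \<le> sqrt (2 * B * A)" .
    have SA: "S i \<le> A" using weighted_var_sum_le[OF i] by (simp add: S_def A_def)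
    have int: "integrable M (normalized_inc r d i)"
      by (rule has_moments_integrable[OF normalized_inc_moments[OF i]])
    have "expectation (\<lambda>\<omega>. \<bar>normalized_inc r d i \<omega> - c\<bar>) \<le>
        expectation (\<lambda>\<omega>. \<bar>normalized_inc r d i \<omega> - S i\<bar> + (\<bar>A - c\<bar> + (A - S i)))"
    proof (rule integral_mono)
      show "\<bar>normalized_inc r d i \<omega> - c\<bar> \<le> \<bar>normalized_inc r d i \<omega> - S i\<bar> + (\<bar>A - c\<bar> + (A - S i))" for \<omega>
        using SA by linarith
    qed (use int in auto)
    also have "\<dots> = expectation (\<lambda>\<omega>. \<bar>normalized_inc r d i \<omega> - S i\<bar>) + (\<bar>A - c\<bar> + (A - S i))"
      using int by (simp add: prob_space)
    finally show ?thesis using 1 by (simp add: e_def)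
  qed
  have defect: "(\<Sum>i=1..N. A - S i) \<le> A / 2"
  proof -
    \<comment> \<open>The defect is resolved into modes so that it can be summed over
      \<open>i\<close> within each mode, where it is geometric, before the modes are summed.\<close>
    define D where "D i k = lam k powr r / (tau r d)\<^sup>2 * ((1 - exp (- lam k * d)) / lam k - inc_var d i k)" for i k
    have D: "(\<lambda>k. D i k) sums (A - S i)" if i: "i \<in> {1..N}" for i
    proof -
      interpret quadratic_form M G "inc d i" "\<lambda>k. lam k powr r / (tau r d)\<^sup>2" "inc_var d i"
        by (rule quadratic_form_inc) (use i in simp)
      have "(\<lambda>k. heat_term r d k / (tau r d)\<^sup>2) sums A"
        unfolding A_def heat_sum_def using summable_heat_term[OF r] d
        by (intro sums_divide summable_sums) auto
      moreover have "(\<lambda>k. lam k powr r / (tau r d)\<^sup>2 * inc_var d i k) sums S i"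
        unfolding S_def by (intro summable_sums summable_wv)
      ultimately have "(\<lambda>k. heat_term r d k / (tau r d)\<^sup>2 - lam k powr r / (tau r d)\<^sup>2 * inc_var d i k) sums (A - S i)"
        by (rule sums_diff)
      moreover have "heat_term r d k / (tau r d)\<^sup>2 - lam k powr r / (tau r d)\<^sup>2 * inc_var d i k = D i k" for k
        unfolding D_def heat_term_def right_diff_distrib by simp
      ultimately show ?thesis by simp
    qed
    have "(\<lambda>k. \<Sum>i=1..N. D i k) sums (\<Sum>i=1..N. A - S i)"
      by (intro sums_sum D)
    moreover have "(\<lambda>k. heat_term r d k / (tau r d)\<^sup>2 / 2) sums (A / 2)"
      unfolding A_def heat_sum_def using summable_heat_term[OF r] d
      by (intro sums_divide summable_sums) auto
    moreover have "(\<Sum>i=1..N. D i k) \<le> heat_term r d k / (tau r d)\<^sup>2 / 2" for k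
    proof -
      have "(\<Sum>i=1..N. D i k) = lam k powr r / (tau r d)\<^sup>2 * (\<Sum>i=1..N. (1 - exp (- lam k * d)) / lam k - inc_var d i k)"
        by (simp only: D_def sum_distrib_left)
      also have "\<dots> \<le> lam k powr r / (tau r d)\<^sup>2 * ((1 - exp (- lam k * d)) / lam k / 2)"
        by (intro mult_left_mono sum_inc_var_defect[OF d]) auto
      finally show ?thesis by (simp add: heat_term_def mult_ac)
    qed
    ultimately show ?thesis by (rule sums_le[rotated])
  qed
  have CA: "0 \<le> gauss_moment (2 * Suc p) * A ^ Suc p" "0 \<le> c ^ Suc p" using A0 c gauss_moment_nonneg by simp_all
  have "expectation (\<lambda>\<omega>. \<bar>d * (\<Sum>i\<in>{1..N}. normalized_inc r d i \<omega> ^ p) - d * (\<Sum>i\<in>{1..N}. c ^ p)\<bar>) \<le>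
    real p * L ^ (p - 1) * (d * (\<Sum>i\<in>{1..N}. e i)) +
    (d * real (card {1..N})) * (real p * 2 ^ p * (2 * (gauss_moment (2 * Suc p) * A ^ Suc p + c ^ Suc p)) / L)"
  proof (rule expectation_abs_average_diff[OF _ _ _ _ dist _ _ d L p])
    fix i assume i: "i \<in> {1..N}"
    show "has_moments M (normalized_inc r d i)" using i by (intro normalized_inc_moments) auto
    show "0 \<le> normalized_inc r d i \<omega>" for \<omega> by (rule normalized_inc_nonneg)
    show "has_moments M (\<lambda>_. c)" by (rule has_moments_const)
    show "expectation (\<lambda>\<omega>. normalized_inc r d i \<omega> ^ Suc p) \<le> gauss_moment (2 * Suc p) * A ^ Suc p + c ^ Suc p"
      using normalized_inc_moment_le[of i "Suc p"] i CA unfolding A_def by (intro add_increasing2) auto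
    show "expectation (\<lambda>_. c ^ Suc p) \<le> gauss_moment (2 * Suc p) * A ^ Suc p + c ^ Suc p"
      using CA(1) by (simp add: prob_space)
  qed (rule c)
  also have "d * (\<Sum>i\<in>{1..N}. e i) \<le> d * real N * (sqrt (2 * B * A) + \<bar>A - c\<bar>) + d * A / 2"
  proof -
    have "d * (\<Sum>i\<in>{1..N}. e i) = d * real N * (sqrt (2 * B * A) + \<bar>A - c\<bar>) + d * (\<Sum>i=1..N. A - S i)"
      by (simp only: e_def sum.distrib) (simp add: algebra_simps)
    moreover have "d * (\<Sum>i=1..N. A - S i) \<le> d * (A / 2)"
      using d defect by (intro mult_left_mono) auto
    ultimately show ?thesis by simp
  qed
  finally show ?thesis using L by (simp add: mult_left_mono mult.assoc)
qed

end

text \<open>Two inputs suffice for concentration: the normalized stationary mean tends to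
  \<open>c\<close>, and the largest share of a single mode tends to 0. The limit of the powers is
  then the power \<open>c ^ p\<close> of the limit.\<close>

lemma mode_variation_tendsto_constant:
  assumes r: "- 1 / 2 \<le> r" "r < 1 / 2" and dl: "\<And>n. 0 < \<delta> n" "\<delta> \<longlonglongrightarrow> 0" and t: "0 \<le> t" and p: "1 \<le> p"
    and A: "(\<lambda>n. heat_sum r (\<delta> n) / (tau r (\<delta> n))\<^sup>2) \<longlonglongrightarrow> c"
    and B: "(\<lambda>n. \<delta> n powr (1 - max r 0) / (tau r (\<delta> n))\<^sup>2) \<longlonglongrightarrow> 0"
  shows "(\<lambda>n. expectation (\<lambda>\<omega>. \<bar>mode_variation r p (\<delta> n) t \<omega> - c ^ p * t\<bar>)) \<longlonglongrightarrow> 0"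
proof (rule tendsto_0_of_upper_bounds)
  fix e :: real assume e: "0 < e"
  define An Bn where "An n = heat_sum r (\<delta> n) / (tau r (\<delta> n))\<^sup>2"
    and "Bn n = \<delta> n powr (1 - max r 0) / (tau r (\<delta> n))\<^sup>2" for n
  have c: "0 \<le> c"
    using A by (rule LIMSEQ_le_const) (use heat_sum_nonneg[OF r(2)] dl(1) in \<open>auto intro!: divide_nonneg_nonneg simp: less_imp_le\<close>)
  \<comment> \<open>\<open>C / L\<close> is the limit of the one error term that does not vanish
    with the step, the cost of the cutoff; \<open>L\<close> is chosen to bring it below
    \<open>e\<close>.\<close>
  define C where "C = t * (real p * 2 ^ p * (2 * (gauss_moment (2 * Suc p) * c ^ Suc p + c ^ Suc p)))"
  define L where "L = (C + 1) / e * 2"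
  have C0: "0 \<le> C" unfolding C_def using t c gauss_moment_nonneg by simp
  have L: "0 < L" using C0 e by (simp add: L_def)
  define u where "u n = real p * L ^ (p - 1) * (t * (sqrt (2 * Bn n * An n) + \<bar>An n - c\<bar>) + \<delta> n * An n / 2) +
    t * (real p * 2 ^ p * (2 * (gauss_moment (2 * Suc p) * An n ^ Suc p + c ^ Suc p)) / L) + c ^ p * \<delta> n" for n
  have lim: "u \<longlonglongrightarrow> real p * L ^ (p - 1) * (t * (sqrt (2 * 0 * c) + \<bar>c - c\<bar>) + 0 * c / 2) +
    t * (real p * 2 ^ p * (2 * (gauss_moment (2 * Suc p) * c ^ Suc p + c ^ Suc p)) / L) + c ^ p * 0"
    unfolding u_def using A B dl(2) by (intro tendsto_intros) (auto simp: An_def Bn_def L less_imp_neq[symmetric])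
  have "t * (real p * 2 ^ p * (2 * (gauss_moment (2 * Suc p) * c ^ Suc p + c ^ Suc p)) / L) = C / L"
    by (simp add: C_def)
  also have "C / L < e"
  proof -
    have "C < L * e" using C0 e by (simp add: L_def)
    then show ?thesis using L by (simp add: divide_less_eq mult.commute)
  qed
  finally have small: "t * (real p * 2 ^ p * (2 * (gauss_moment (2 * Suc p) * c ^ Suc p + c ^ Suc p)) / L) < e" .
  have "\<forall>\<^sub>F n in sequentially. \<delta> n < 1" using dl(2) by (rule order_tendstoD) simp
  then have "\<forall>\<^sub>F n in sequentially. expectation (\<lambda>\<omega>. \<bar>mode_variation r p (\<delta> n) t \<omega> - c ^ p * t\<bar>) \<le> u n"
  proof eventually_elim
    case (elim n)
    note tp = tau_pos[OF dl(1) elim, of r]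
    define N where "N = nat \<lfloor>t / \<delta> n\<rfloor>"
    note fb = floor_multiple_bounds[OF dl(1) t, of n, folded N_def]
    have dN0: "0 \<le> \<delta> n * real N" using dl(1)[of n] by simp
    have A0: "0 \<le> An n" unfolding An_def using heat_sum_nonneg[OF r(2), of "\<delta> n"] dl(1)[of n] by simp
    have Bk: "heat_term r (\<delta> n) k / (tau r (\<delta> n))\<^sup>2 \<le> Bn n" for k
      unfolding Bn_def by (intro divide_right_mono heat_term_le r dl) auto
    have B0: "0 \<le> Bn n" by (simp add: Bn_def)
    have mv: "has_moments M (mode_variation r p (\<delta> n) t)" by (rule mode_variation_moments[OF r(2) dl(1) tp])
    have "expectation (\<lambda>\<omega>. \<bar>mode_variation r p (\<delta> n) t \<omega> - c ^ p * t\<bar>) \<le>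
        expectation (\<lambda>\<omega>. \<bar>mode_variation r p (\<delta> n) t \<omega> - \<delta> n * real N * c ^ p\<bar> + c ^ p * \<delta> n)"
    proof (rule integral_mono)
      fix \<omega>
      have "c ^ p * \<bar>\<delta> n * real N - t\<bar> \<le> c ^ p * \<delta> n" using fb dl(1)[of n] c by (intro mult_left_mono) auto
      moreover have "\<bar>c ^ p * (\<delta> n * real N - t)\<bar> = c ^ p * \<bar>\<delta> n * real N - t\<bar>" using c by (simp add: abs_mult)
      moreover have "mode_variation r p (\<delta> n) t \<omega> - c ^ p * t =
          (mode_variation r p (\<delta> n) t \<omega> - \<delta> n * real N * c ^ p) + c ^ p * (\<delta> n * real N - t)"
        by (simp add: algebra_simps)
      ultimately show "\<bar>mode_variation r p (\<delta> n) t \<omega> - c ^ p * t\<bar> \<le>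
          \<bar>mode_variation r p (\<delta> n) t \<omega> - \<delta> n * real N * c ^ p\<bar> + c ^ p * \<delta> n"
        by linarith
    qed (use has_moments_integrable[OF mv] in auto)
    also have "\<dots> = expectation (\<lambda>\<omega>. \<bar>mode_variation r p (\<delta> n) t \<omega> - \<delta> n * real N * c ^ p\<bar>) + c ^ p * \<delta> n"
      using has_moments_integrable[OF mv] by (simp add: prob_space)
    also have "expectation (\<lambda>\<omega>. \<bar>mode_variation r p (\<delta> n) t \<omega> - \<delta> n * real N * c ^ p\<bar>) \<le>
      real p * L ^ (p - 1) * (\<delta> n * real N * (sqrt (2 * Bn n * An n) + \<bar>An n - c\<bar>) + \<delta> n * An n / 2) +
      \<delta> n * real N * (real p * 2 ^ p * (2 * (gauss_moment (2 * Suc p) * An n ^ Suc p + c ^ Suc p)) / L)"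
      using average_close_to_constant[OF r(2) dl(1) tp c L p Bk, where N = N]
      unfolding mode_variation_def N_def[symmetric] An_def .
    also have "\<dots> \<le> real p * L ^ (p - 1) * (t * (sqrt (2 * Bn n * An n) + \<bar>An n - c\<bar>) + \<delta> n * An n / 2) +
      t * (real p * 2 ^ p * (2 * (gauss_moment (2 * Suc p) * An n ^ Suc p + c ^ Suc p)) / L)"
      using L A0 B0 c gauss_moment_nonneg dl(1)[of n] dN0 fb
      by (intro add_mono mult_left_mono mult_right_mono mult_nonneg_nonneg divide_nonneg_nonneg add_nonneg_nonneg) auto
    finally show ?case by (simp add: u_def)
  qed
  with lim small show "\<exists>u l. u \<longlonglongrightarrow> l \<and> l < e \<and>
      (\<forall>\<^sub>F n in sequentially. expectation (\<lambda>\<omega>. \<bar>mode_variation r p (\<delta> n) t \<omega> - c ^ p * t\<bar>) \<le> u n)"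
    by (intro exI[of _ u] exI conjI) auto
qed simp

end


section \<open>The regime \<open>r < -1/2\<close>: truncated innovations and the Bell polynomial
  limit\<close>

lemma quad_moment_tendsto:
  assumes r: "r < - 1 / 2"
  shows "(\<lambda>K. quad_moment (\<lambda>k. lam k powr r) {..<K} p) \<longlonglongrightarrow> limit_const r p"
proof -
  have "(\<lambda>K. \<Sum>k<K. (lam k powr r) ^ l) \<longlonglongrightarrow> real_zeta (- 2 * real l * r)" if l: "1 \<le> l" for l
  proof -
    have e: "(lam k powr r) ^ l = real (Suc k) powr (2 * real l * r)" for k
      unfolding lam_powr by (simp add: powr_power mult_ac)
    \<comment> \<open>As \<open>r\<close> is negative, \<open>l = 1\<close> is the worst case, and
      there \<open>2 * r < - 1\<close> gives summability.\<close>
    have "real l * r \<le> 1 * r" using l r by (intro mult_right_mono_neg) auto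
    then have "2 * (real l * r) < - 1" using r by linarith
    then have "summable (\<lambda>k. real (Suc k) powr (2 * real l * r))"
      by (intro summable_Suc_powr) (simp add: mult.assoc)
    from summable_LIMSEQ[OF this] show ?thesis by (simp add: e real_zeta_def)
  qed
  then have "(\<lambda>K. 2 ^ p * bell p (\<lambda>l. fact (l - 1) / 2 * (\<Sum>k<K. (lam k powr r) ^ l))) \<longlonglongrightarrow>
      2 ^ p * bell p (\<lambda>l. fact (l - 1) / 2 * real_zeta (- 2 * real l * r))"
    by (intro tendsto_mult tendsto_const tendsto_bell) auto
  then show ?thesis using r by (simp add: quad_moment_bell limit_const_def)
qed

context heat_modes
begin

text \<open>The squared norm cut down to \<open>K\<close> modes, with innovations rescaled to
  variance 1. Its moments depend neither on the step nor on \<open>i\<close>.\<close>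

definition innov_square :: "real \<Rightarrow> real \<Rightarrow> nat \<Rightarrow> nat \<Rightarrow> 'a \<Rightarrow> real" where
  "innov_square r d K i \<omega> = (\<Sum>k<K. lam k powr r * (innov d i k \<omega> / sqrt (innov_var d k))\<^sup>2)"

text \<open>The relative error of replacing a squared increment by a squared innovation. It vanishes
  with \<open>d\<close> for each mode but grows with \<open>lam k\<close>, which is why
  \<open>K\<close> stays fixed while the step shrinks.\<close>

definition innov_error :: "real \<Rightarrow> nat \<Rightarrow> real" where
  "innov_error d k = sqrt d * (1 + lam k / 2) + 3 / 2 * lam k * d"

context
  fixes r :: real
  assumes r: "r < - 1 / 2"
begin

lemma summable_lam_powr: "summable (\<lambda>k. lam k powr r)"
  unfolding lam_powr using r by (intro summable_Suc_powr) auto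

context
  fixes d :: real
  assumes d: "0 < d"
begin

lemma standard_innov_G: "1 \<le> i \<Longrightarrow> (\<lambda>\<omega>. innov d i k \<omega> / sqrt (innov_var d k)) \<in> G"
  using scale_closed[OF innov_G[OF d], of i "1 / sqrt (innov_var d k)" k] by simp

lemma standard_innov_orth:
  assumes "1 \<le> i" "1 \<le> j"
  shows "expectation (\<lambda>\<omega>. (innov d i k \<omega> / sqrt (innov_var d k)) * (innov d j l \<omega> / sqrt (innov_var d l))) =
    (if i = j \<and> k = l then 1 else 0)"
proof -
  have "expectation (\<lambda>\<omega>. (innov d i k \<omega> / sqrt (innov_var d k)) * (innov d j l \<omega> / sqrt (innov_var d l))) =
      expectation (\<lambda>\<omega>. (1 / (sqrt (innov_var d k) * sqrt (innov_var d l))) * (innov d i k \<omega> * innov d j l \<omega>))"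
    by (intro Bochner_Integration.integral_cong refl) simp
  also have "\<dots> = (1 / (sqrt (innov_var d k) * sqrt (innov_var d l))) * expectation (\<lambda>\<omega>. innov d i k \<omega> * innov d j l \<omega>)"
    by (rule Bochner_Integration.integral_mult_right_zero)
  also have "\<dots> = (if i = j \<and> k = l then 1 else 0)"
    using expectation_innov_orth[OF d assms(2,1), of k l] innov_var_pos[OF d, of k] by auto
  finally show ?thesis .
qed

lemma innov_square_nonneg: "0 \<le> innov_square r d K i \<omega>"
  unfolding innov_square_def by (intro sum_nonneg) auto

lemma innov_square_moments: "1 \<le> i \<Longrightarrow> has_moments M (innov_square r d K i)"
  unfolding innov_square_def[abs_def]
  by (intro has_moments_sum has_moments_cmult has_moments_power moments standard_innov_G)

lemma
  shows innov_square_moment: "1 \<le> i \<Longrightarrow>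
      expectation (\<lambda>\<omega>. innov_square r d K i \<omega> ^ p) = quad_moment (\<lambda>k. lam k powr r) {..<K} p"
    and innov_square_lln: "expectation (\<lambda>\<omega>. \<bar>(\<Sum>i=1..N. innov_square r d K i \<omega> ^ p) -
        real N * quad_moment (\<lambda>k. lam k powr r) {..<K} p\<bar>) \<le>
      sqrt (real N * quad_moment (\<lambda>k. lam k powr r) {..<K} (2 * p))"
proof -
  define g where "g i k \<omega> = innov d i k \<omega> / sqrt (innov_var d k)" for i k \<omega>
  have gG: "g i k \<in> G" if "1 \<le> i" for i k unfolding g_def[abs_def] using that by (rule standard_innov_G)
  have orth: "expectation (\<lambda>\<omega>. g i k \<omega> * g j l \<omega>) = (if i = j \<and> k = l then 1 else 0)"
    if "1 \<le> i" "1 \<le> j" for i j k l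
    unfolding g_def using that by (rule standard_innov_orth)
  show "expectation (\<lambda>\<omega>. innov_square r d K i \<omega> ^ p) = quad_moment (\<lambda>k. lam k powr r) {..<K} p" if "1 \<le> i"
    unfolding innov_square_def g_def[symmetric]
    by (rule quad_array_moment[of "{i}"]) (use gG orth that in auto)
  have "expectation (\<lambda>\<omega>. \<bar>(\<Sum>i\<in>{1..N}. (\<Sum>k\<in>{..<K}. lam k powr r * (g i k \<omega>)\<^sup>2) ^ p) -
        real (card {1..N}) * quad_moment (\<lambda>k. lam k powr r) {..<K} p\<bar>) \<le>
      sqrt (real (card {1..N}) * quad_moment (\<lambda>k. lam k powr r) {..<K} (2 * p))"
    by (rule quad_array_lln) (use gG orth in auto)
  then show "expectation (\<lambda>\<omega>. \<bar>(\<Sum>i=1..N. innov_square r d K i \<omega> ^ p) -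
        real N * quad_moment (\<lambda>k. lam k powr r) {..<K} p\<bar>) \<le>
      sqrt (real N * quad_moment (\<lambda>k. lam k powr r) {..<K} (2 * p))"
    unfolding innov_square_def g_def by simp
qed

lemma tau_sq: "(tau r d)\<^sup>2 = d" and tau_gt_0: "0 < tau r d" and r_lt: "r < 1 / 2"
  using tau_square[OF d, of r] r d by (auto simp: tau_def)

lemma heat_sum_ratio_le: "heat_sum r d / (tau r d)\<^sup>2 \<le> (\<Sum>k. lam k powr r)"
proof -
  have "heat_term r d k / d \<le> lam k powr r" for k
  proof -
    have "(1 - exp (- lam k * d)) / lam k \<le> d"
      using exp_neg_bounds(1)[of "lam k * d"] lam_pos[of k] d by (simp add: divide_le_eq mult.commute)
    then have "heat_term r d k \<le> lam k powr r * d"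
      unfolding heat_term_def by (intro mult_left_mono) auto
    then show ?thesis using d by (simp add: divide_le_eq)
  qed
  then have "(\<Sum>k. heat_term r d k / d) \<le> (\<Sum>k. lam k powr r)"
    using summable_heat_term[OF r_lt, of d] d by (intro suminf_le summable_lam_powr summable_divide) auto
  then show ?thesis
    unfolding tau_sq heat_sum_def using summable_heat_term[OF r_lt, of d] d by (simp add: suminf_divide)
qed

lemma expectation_inc_innov_square:
  assumes i: "1 \<le> i"
  shows "expectation (\<lambda>\<omega>. \<bar>normalized_inc r d i \<omega> - innov_square r d K i \<omega>\<bar>) \<le>
    (\<Sum>k<K. lam k powr r * innov_error d k) + (\<Sum>k. lam (k + K) powr r)"
proof -
  interpret quadratic_form M G "inc d i" "\<lambda>k. lam k powr r / (tau r d)\<^sup>2" "inc_var d i"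
    by (rule quadratic_form_inc[OF r_lt d tau_gt_0 i])
  define Y where "Y k \<omega> = d / innov_var d k * (innov d i k \<omega>)\<^sup>2" for k \<omega>
  have Y: "has_moments M (Y k)" for k
    unfolding Y_def by (intro has_moments_cmult has_moments_power moments innov_G[OF d i])
  have e: "expectation (\<lambda>\<omega>. \<bar>(inc d i k \<omega>)\<^sup>2 - Y k \<omega>\<bar>) \<le> d * innov_error d k" for k
    unfolding Y_def innov_error_def by (rule expectation_inc_innov[OF d i])
  have sq: "(\<Sum>k<K. lam k powr r / (tau r d)\<^sup>2 * Y k \<omega>) = innov_square r d K i \<omega>" for \<omega>
    unfolding innov_square_def tau_sq Y_def using d innov_var_pos[OF d]
    by (intro sum.cong refl) (simp add: power_divide less_imp_le)
  have wv: "lam k powr r / (tau r d)\<^sup>2 * inc_var d i k \<le> lam k powr r" for k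
  proof -
    have "inc_var d i k \<le> d"
      using inc_var_bounds(2)[OF d i, of k] exp_neg_bounds(1)[of "lam k * d"] lam_pos[of k] d
      by (simp add: divide_le_eq mult.commute) (smt (verit) divide_le_eq mult.commute)
    then have "lam k powr r * inc_var d i k \<le> lam k powr r * d" by (intro mult_left_mono) auto
    then show ?thesis unfolding tau_sq using d by (simp add: divide_le_eq)
  qed
  have "(\<Sum>k. lam (k + K) powr r / (tau r d)\<^sup>2 * inc_var d i (k + K)) \<le> (\<Sum>k. lam (k + K) powr r)"
    using summable_wv summable_lam_powr
    by (intro suminf_le wv summable_ignore_initial_segment)
  moreover have "(\<Sum>k<K. lam k powr r / (tau r d)\<^sup>2 * (d * innov_error d k)) = (\<Sum>k<K. lam k powr r * innov_error d k)"
    unfolding tau_sq using d by (intro sum.cong refl) simp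
  ultimately show ?thesis
    using expectation_diff_partial_sum[of K Y "\<lambda>k. d * innov_error d k"] Y e
    unfolding sq normalized_inc_def by simp
qed

text \<open>The three terms are the replacement by truncated innovations, the cutoff, and the law of
  large numbers. In the last, \<open>d * sqrt N\<close> equals \<open>sqrt d * sqrt (d * N)\<close>
  and hence vanishes while \<open>d * N\<close> stays bounded.\<close>

lemma average_close_to_limit:
  assumes L: "0 < L" and p: "1 \<le> p"
    and C: "gauss_moment (2 * Suc p) * (\<Sum>k. lam k powr r) ^ Suc p \<le> C" "quad_moment (\<lambda>k. lam k powr r) {..<K} (Suc p) \<le> C"
  shows "expectation (\<lambda>\<omega>. \<bar>d * (\<Sum>i=1..N. normalized_inc r d i \<omega> ^ p) - d * real N * quad_moment (\<lambda>k. lam k powr r) {..<K} p\<bar>) \<le>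
    real p * L ^ (p - 1) * (d * real N * ((\<Sum>k<K. lam k powr r * innov_error d k) + (\<Sum>k. lam (k + K) powr r))) +
    d * real N * (real p * 2 ^ p * (2 * C) / L) +
    d * sqrt (real N * quad_moment (\<lambda>k. lam k powr r) {..<K} (2 * p))"
proof -
  let ?q = "\<lambda>p. quad_moment (\<lambda>k. lam k powr r) {..<K} p"
  define E where "E = (\<Sum>k<K. lam k powr r * innov_error d k) + (\<Sum>k. lam (k + K) powr r)"
  have A0: "0 \<le> heat_sum r d / (tau r d)\<^sup>2"
    using heat_sum_nonneg[OF r_lt, of d] d by simp
  have 1: "expectation (\<lambda>\<omega>. \<bar>d * (\<Sum>i\<in>{1..N}. normalized_inc r d i \<omega> ^ p) - d * (\<Sum>i\<in>{1..N}. innov_square r d K i \<omega> ^ p)\<bar>) \<le>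
    real p * L ^ (p - 1) * (d * (\<Sum>i\<in>{1..N}. E)) + (d * real (card {1..N})) * (real p * 2 ^ p * (2 * C) / L)"
  proof (rule expectation_abs_average_diff[OF _ _ _ _ _ _ _ d L p])
    fix i assume i: "i \<in> {1..N}"
    then have i1: "1 \<le> i" by simp
    show "has_moments M (normalized_inc r d i)" by (rule normalized_inc_moments[OF r_lt d tau_gt_0 i1])
    show "0 \<le> normalized_inc r d i \<omega>" for \<omega> by (rule normalized_inc_nonneg[OF r_lt d tau_gt_0])
    show "has_moments M (innov_square r d K i)" by (rule innov_square_moments[OF i1])
    show "0 \<le> innov_square r d K i \<omega>" for \<omega> by (rule innov_square_nonneg)
    show "expectation (\<lambda>\<omega>. \<bar>normalized_inc r d i \<omega> - innov_square r d K i \<omega>\<bar>) \<le> E"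
      unfolding E_def by (rule expectation_inc_innov_square[OF i1])
    show "expectation (\<lambda>\<omega>. innov_square r d K i \<omega> ^ Suc p) \<le> C"
      unfolding innov_square_moment[OF i1] by (rule C)
    have "expectation (\<lambda>\<omega>. normalized_inc r d i \<omega> ^ Suc p) \<le> gauss_moment (2 * Suc p) * (heat_sum r d / (tau r d)\<^sup>2) ^ Suc p"
      by (rule normalized_inc_moment_le[OF r_lt d tau_gt_0 i1])
    also have "\<dots> \<le> gauss_moment (2 * Suc p) * (\<Sum>k. lam k powr r) ^ Suc p"
      by (intro mult_left_mono power_mono heat_sum_ratio_le A0 gauss_moment_nonneg)
    also note C(1)
    finally show "expectation (\<lambda>\<omega>. normalized_inc r d i \<omega> ^ Suc p) \<le> C" .
  qed
  define F where "F \<omega> = (\<Sum>i=1..N. innov_square r d K i \<omega> ^ p) - real N * ?q p" for \<omega>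
  define D where "D \<omega> = d * (\<Sum>i=1..N. normalized_inc r d i \<omega> ^ p) - d * (\<Sum>i=1..N. innov_square r d K i \<omega> ^ p)" for \<omega>
  have mF: "has_moments M F"
    unfolding F_def by (intro has_moments_diff has_moments_const has_moments_sum has_moments_power innov_square_moments) auto
  have mD: "has_moments M D"
    unfolding D_def
    by (intro has_moments_diff has_moments_cmult has_moments_sum has_moments_power innov_square_moments
        normalized_inc_moments[OF r_lt d tau_gt_0]) auto
  have iF: "integrable M (\<lambda>\<omega>. \<bar>F \<omega>\<bar>)" and iD: "integrable M (\<lambda>\<omega>. \<bar>D \<omega>\<bar>)"
    using has_moments_integrable[OF mF] has_moments_integrable[OF mD] by auto
  have e: "d * (\<Sum>i=1..N. normalized_inc r d i \<omega> ^ p) - d * real N * ?q p = D \<omega> + d * F \<omega>" for \<omega>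
    by (simp add: D_def F_def algebra_simps)
  have "expectation (\<lambda>\<omega>. \<bar>d * (\<Sum>i=1..N. normalized_inc r d i \<omega> ^ p) - d * real N * ?q p\<bar>) \<le>
      expectation (\<lambda>\<omega>. \<bar>D \<omega>\<bar> + d * \<bar>F \<omega>\<bar>)"
    unfolding e
  proof (rule integral_mono)
    show "\<bar>D \<omega> + d * F \<omega>\<bar> \<le> \<bar>D \<omega>\<bar> + d * \<bar>F \<omega>\<bar>" for \<omega>
      using abs_triangle_ineq[of "D \<omega>" "d * F \<omega>"] d by (simp add: abs_mult)
    show "integrable M (\<lambda>\<omega>. \<bar>D \<omega> + d * F \<omega>\<bar>)"
      by (intro integrable_abs has_moments_integrable has_moments_add has_moments_cmult mF mD)
  qed (use iF iD in auto)
  also have "\<dots> = expectation (\<lambda>\<omega>. \<bar>D \<omega>\<bar>) + d * expectation (\<lambda>\<omega>. \<bar>F \<omega>\<bar>)"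
    using iF iD by simp
  also have "\<dots> \<le> (real p * L ^ (p - 1) * (d * real N * E) + d * real N * (real p * 2 ^ p * (2 * C) / L)) +
      d * sqrt (real N * ?q (2 * p))"
    using 1 d innov_square_lln[where K = K and N = N and p = p]
    unfolding D_def[symmetric] F_def[symmetric] by (intro add_mono mult_left_mono) (auto simp: mult.assoc)
  finally show ?thesis by (simp add: E_def)
qed

end

text \<open>The order of choices is \<open>L\<close>, then \<open>K\<close>, then large
  \<open>n\<close>: the cutoff cost, the discarded modes and the distance of the truncated moment
  from its limit are made small first, and the remaining errors vanish with the step.\<close>

lemma mode_variation_tendsto_bell:
  assumes dl: "\<And>n. 0 < \<delta> n" "\<delta> \<longlonglongrightarrow> 0" and t: "0 \<le> t" and p: "1 \<le> p"
  shows "(\<lambda>n. expectation (\<lambda>\<omega>. \<bar>mode_variation r p (\<delta> n) t \<omega> - limit_const r p * t\<bar>)) \<longlonglongrightarrow> 0"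
proof (rule tendsto_0_of_upper_bounds)
  fix e :: real assume e: "0 < e"
  define \<kappa> where "\<kappa> = limit_const r p"
  define q where "q K p = quad_moment (\<lambda>k. lam k powr r) {..<K} p" for K p
  \<comment> \<open>The cutoff is chosen before \<open>K\<close>, so its cost requires a moment
    bound uniform in \<open>K\<close>; convergence of the truncated moments supplies it.\<close>
  have "Bseq (\<lambda>K. q K (Suc p))"
    unfolding q_def using quad_moment_tendsto[OF r] by (intro convergent_imp_Bseq convergentI)
  then obtain B where B: "\<And>K. norm (q K (Suc p)) \<le> B" unfolding Bseq_def by blast
  define C where "C = \<bar>gauss_moment (2 * Suc p) * (\<Sum>k. lam k powr r) ^ Suc p\<bar> + B"
  have B0: "0 \<le> B" using order.trans[OF norm_ge_zero B] .
  have C: "gauss_moment (2 * Suc p) * (\<Sum>k. lam k powr r) ^ Suc p \<le> C" "q K (Suc p) \<le> C" for K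
    using B[of K] B0 by (auto simp: C_def)
  have C0: "0 \<le> C" using B0 by (simp add: C_def)
  define D where "D = t * (real p * 2 ^ p * (2 * C))"
  define L where "L = (D + 1) / e * 2"
  have D0: "0 \<le> D" unfolding D_def using t C0 by simp
  have L: "0 < L" using D0 e by (simp add: L_def)
  have DL: "D / L < e / 2"
  proof -
    have "D < L * (e / 2)" using D0 e by (simp add: L_def)
    then show ?thesis using L by (simp add: divide_less_eq mult.commute)
  qed
  have "(\<lambda>K. \<Sum>k. lam (k + K) powr r) \<longlonglongrightarrow> 0"
    using suminf_exist_split2[OF summable_lam_powr] .
  moreover have "(\<lambda>K. q K p) \<longlonglongrightarrow> \<kappa>" unfolding q_def \<kappa>_def by (rule quad_moment_tendsto[OF r])
  ultimately have "(\<lambda>K. real p * L ^ (p - 1) * (t * (\<Sum>k. lam (k + K) powr r)) + t * \<bar>q K p - \<kappa>\<bar>) \<longlonglongrightarrow>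
      real p * L ^ (p - 1) * (t * 0) + t * \<bar>\<kappa> - \<kappa>\<bar>"
    by (intro tendsto_intros)
  then have "(\<lambda>K. real p * L ^ (p - 1) * (t * (\<Sum>k. lam (k + K) powr r)) + t * \<bar>q K p - \<kappa>\<bar>) \<longlonglongrightarrow> 0" by simp
  then have "\<forall>\<^sub>F K in sequentially. real p * L ^ (p - 1) * (t * (\<Sum>k. lam (k + K) powr r)) + t * \<bar>q K p - \<kappa>\<bar> < e / 2"
    using e by (intro order_tendstoD) auto
  then obtain K where K: "real p * L ^ (p - 1) * (t * (\<Sum>k. lam (k + K) powr r)) + t * \<bar>q K p - \<kappa>\<bar> < e / 2"
    by (auto simp: eventually_sequentially)
  define N where "N n = nat \<lfloor>t / \<delta> n\<rfloor>" for n
  note fb = floor_multiple_bounds[OF dl(1) t, folded N_def]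
  have dN: "(\<lambda>n. \<delta> n * real (N n)) \<longlonglongrightarrow> t"
  proof (rule tendsto_sandwich[OF _ _ _ tendsto_const])
    show "(\<lambda>n. t - \<delta> n) \<longlonglongrightarrow> t" using tendsto_diff[OF tendsto_const dl(2), of t] by simp
  qed (use fb in auto)
  define u where "u n = real p * L ^ (p - 1) * (\<delta> n * real (N n) * ((\<Sum>k<K. lam k powr r * innov_error (\<delta> n) k) + (\<Sum>k. lam (k + K) powr r))) +
    \<delta> n * real (N n) * (real p * 2 ^ p * (2 * C) / L) +
    sqrt (\<delta> n) * sqrt (\<delta> n * real (N n) * q K (2 * p)) + \<bar>\<delta> n * real (N n) * q K p - \<kappa> * t\<bar>" for n
  have ie: "(\<lambda>n. innov_error (\<delta> n) k) \<longlonglongrightarrow> sqrt 0 * (1 + lam k / 2) + 3 / 2 * lam k * 0" for k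
    unfolding innov_error_def by (intro tendsto_intros dl)
  have "u \<longlonglongrightarrow> real p * L ^ (p - 1) * (t * ((\<Sum>k<K. lam k powr r * (sqrt 0 * (1 + lam k / 2) + 3 / 2 * lam k * 0)) + (\<Sum>k. lam (k + K) powr r))) +
    t * (real p * 2 ^ p * (2 * C) / L) + sqrt 0 * sqrt (t * q K (2 * p)) + \<bar>t * q K p - \<kappa> * t\<bar>"
    unfolding u_def by (intro tendsto_intros dN ie dl)
  moreover have "t * \<bar>q K p - \<kappa>\<bar> = \<bar>t * q K p - \<kappa> * t\<bar>"
    using t by (simp add: abs_mult mult.commute[of \<kappa>] right_diff_distrib[symmetric])
  ultimately have lim: "u \<longlonglongrightarrow> real p * L ^ (p - 1) * (t * (\<Sum>k. lam (k + K) powr r)) + t * \<bar>q K p - \<kappa>\<bar> + D / L"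
    by (simp add: D_def add_ac)
  have bound: "expectation (\<lambda>\<omega>. \<bar>mode_variation r p (\<delta> n) t \<omega> - \<kappa> * t\<bar>) \<le> u n" for n
  proof -
    have r2: "r < 1 / 2" using r by simp
    have mv: "has_moments M (mode_variation r p (\<delta> n) t)"
      by (rule mode_variation_moments[OF r2 dl(1) tau_gt_0[OF dl(1)]])
    have "expectation (\<lambda>\<omega>. \<bar>mode_variation r p (\<delta> n) t \<omega> - \<kappa> * t\<bar>) \<le>
        expectation (\<lambda>\<omega>. \<bar>mode_variation r p (\<delta> n) t \<omega> - \<delta> n * real (N n) * q K p\<bar> + \<bar>\<delta> n * real (N n) * q K p - \<kappa> * t\<bar>)"
      using has_moments_integrable[OF mv] by (intro integral_mono) auto
    also have "\<dots> = expectation (\<lambda>\<omega>. \<bar>mode_variation r p (\<delta> n) t \<omega> - \<delta> n * real (N n) * q K p\<bar>) + \<bar>\<delta> n * real (N n) * q K p - \<kappa> * t\<bar>"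
      using has_moments_integrable[OF mv] by (simp add: prob_space)
    also have "expectation (\<lambda>\<omega>. \<bar>mode_variation r p (\<delta> n) t \<omega> - \<delta> n * real (N n) * q K p\<bar>) \<le>
      real p * L ^ (p - 1) * (\<delta> n * real (N n) * ((\<Sum>k<K. lam k powr r * innov_error (\<delta> n) k) + (\<Sum>k. lam (k + K) powr r))) +
      \<delta> n * real (N n) * (real p * 2 ^ p * (2 * C) / L) + \<delta> n * sqrt (real (N n) * q K (2 * p))"
      using average_close_to_limit[OF dl(1) L p C[unfolded q_def], where N = "N n"]
      unfolding mode_variation_def N_def[symmetric] q_def .
    also have "\<delta> n * sqrt (real (N n) * q K (2 * p)) = sqrt (\<delta> n) * sqrt (\<delta> n * real (N n) * q K (2 * p))"
    proof -
      have s: "sqrt (\<delta> n) * (sqrt (\<delta> n) * x) = \<delta> n * x" for x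
        using dl(1)[of n] by (simp add: mult.assoc[symmetric])
      show ?thesis unfolding real_sqrt_mult mult.assoc s ..
    qed
    finally show ?thesis by (simp add: u_def)
  qed
  show "\<exists>u l. u \<longlonglongrightarrow> l \<and> l < e \<and>
      (\<forall>\<^sub>F n in sequentially. expectation (\<lambda>\<omega>. \<bar>mode_variation r p (\<delta> n) t \<omega> - limit_const r p * t\<bar>) \<le> u n)"
    unfolding \<kappa>_def[symmetric]
  proof (intro exI conjI)
    show "\<forall>\<^sub>F n in sequentially. expectation (\<lambda>\<omega>. \<bar>mode_variation r p (\<delta> n) t \<omega> - \<kappa> * t\<bar>) \<le> u n"
      using bound by (intro always_eventually allI)
    show "real p * L ^ (p - 1) * (t * (\<Sum>k. lam (k + K) powr r)) + t * \<bar>q K p - \<kappa>\<bar> + D / L < e"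
      using K DL by linarith
  qed (rule lim)
qed simp

end

text \<open>Supplies the uniform moment bounds needed for arbitrary \<open>q\<close>. For
  \<open>r < -1/2\<close> the bound is explicit; in the other regimes it comes from convergence. A
  step equal to 1 at \<open>r = -1/2\<close> is harmless, since division by 0 yields 0.\<close>

lemma heat_sum_ratio_bounded:
  assumes r: "r < 1 / 2" and dl: "\<And>n. 0 < \<delta> n" "\<delta> \<longlonglongrightarrow> 0"
  shows "\<exists>A. \<forall>n. \<bar>heat_sum r (\<delta> n) / (tau r (\<delta> n))\<^sup>2\<bar> \<le> A"
proof -
  consider "r < - 1 / 2" | "r = - 1 / 2" | "- 1 / 2 < r" by linarith
  then show ?thesis
  proof cases
    case 1
    have "\<bar>heat_sum r (\<delta> n) / (tau r (\<delta> n))\<^sup>2\<bar> \<le> (\<Sum>k. lam k powr r)" for n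
      using heat_sum_ratio_le[OF 1 dl(1), of n] heat_sum_nonneg[OF r, of "\<delta> n"] dl(1)[of n] by simp
    then show ?thesis by blast
  next
    case 2
    have "(\<lambda>n. heat_sum r (\<delta> n) / (tau r (\<delta> n))\<^sup>2) \<longlonglongrightarrow> 1 / 2"
      using heat_sum_tendsto_log[OF dl] 2 by (simp add: tau_square dl)
    then have "Bseq (\<lambda>n. heat_sum r (\<delta> n) / (tau r (\<delta> n))\<^sup>2)" by (intro convergent_imp_Bseq convergentI)
    then show ?thesis unfolding Bseq_def by auto
  next
    case 3
    have "(\<lambda>n. heat_sum r (\<delta> n) / (tau r (\<delta> n))\<^sup>2) \<longlonglongrightarrow> Gamma (r + 1/2) / (2 * (1/2 - r))"
      using heat_sum_tendsto_middle[OF 3 r dl] 3 by (simp add: tau_square dl)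
    then have "Bseq (\<lambda>n. heat_sum r (\<delta> n) / (tau r (\<delta> n))\<^sup>2)" by (intro convergent_imp_Bseq convergentI)
    then show ?thesis unfolding Bseq_def by auto
  qed
qed

text \<open>For \<open>r \<ge> -1/2\<close> it remains to see that the largest share of a mode is
  negligible: relative to the squared normalization its bound is
  \<open>1 / \<bar>ln (\<delta> n)\<bar>\<close> at \<open>r = -1/2\<close> and
  \<open>\<delta> n powr (1/2 + r - max r 0)\<close>, with a positive exponent, above it.\<close>

lemma mode_variation_tendsto:
  assumes r: "r < 1 / 2" and dl: "\<And>n. 0 < \<delta> n" "\<delta> \<longlonglongrightarrow> 0" and t: "0 \<le> t" and p: "1 \<le> p"
  shows "(\<lambda>n. expectation (\<lambda>\<omega>. \<bar>mode_variation r p (\<delta> n) t \<omega> - limit_const r p * t\<bar>)) \<longlonglongrightarrow> 0"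
proof -
  have d0: "filterlim \<delta> (at_right 0) sequentially"
    using dl by (auto simp: filterlim_at less_imp_neq[symmetric])
  consider "r < - 1 / 2" | "r = - 1 / 2" | "- 1 / 2 < r" by linarith
  then show ?thesis
  proof cases
    case 1
    then show ?thesis by (rule mode_variation_tendsto_bell[OF _ dl t p])
  next
    case 2
    have "(\<lambda>n. \<delta> n powr (1 - max r 0) / (tau r (\<delta> n))\<^sup>2) \<longlonglongrightarrow> 0"
    proof -
      have "((\<lambda>d::real. d / (d * \<bar>ln d\<bar>)) \<longlongrightarrow> 0) (at_right 0)" by real_asymp
      from filterlim_compose[OF this d0] show ?thesis using 2 dl(1) by (simp add: tau_square less_imp_le)
    qed
    moreover have "(\<lambda>n. heat_sum r (\<delta> n) / (tau r (\<delta> n))\<^sup>2) \<longlonglongrightarrow> 1 / 2"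
      using heat_sum_tendsto_log[OF dl] 2 by (simp add: tau_square dl)
    ultimately have "(\<lambda>n. expectation (\<lambda>\<omega>. \<bar>mode_variation r p (\<delta> n) t \<omega> - (1 / 2) ^ p * t\<bar>)) \<longlonglongrightarrow> 0"
      using 2 by (intro mode_variation_tendsto_constant r dl t p) auto
    then show ?thesis using 2 by (simp add: limit_const_def power_divide)
  next
    case 3
    have "(\<lambda>n. \<delta> n powr (1 - max r 0) / (tau r (\<delta> n))\<^sup>2) \<longlonglongrightarrow> 0"
    proof -
      have "(\<lambda>n. \<delta> n powr (1 / 2 + r - max r 0)) \<longlonglongrightarrow> 0"
        using 3 r dl by (intro tendsto_zero_powrI[OF dl(2) tendsto_const]) (auto simp: max_def less_imp_le)
      moreover have "\<delta> n powr (1 - max r 0) / (tau r (\<delta> n))\<^sup>2 = \<delta> n powr (1 / 2 + r - max r 0)" for n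
        using 3 dl(1)[of n] by (simp add: tau_square powr_diff[symmetric] algebra_simps)
      ultimately show ?thesis by simp
    qed
    moreover have "(\<lambda>n. heat_sum r (\<delta> n) / (tau r (\<delta> n))\<^sup>2) \<longlonglongrightarrow> Gamma (r + 1/2) / (2 * (1/2 - r))"
      using heat_sum_tendsto_middle[OF 3 r dl] 3 by (simp add: tau_square dl)
    ultimately have "(\<lambda>n. expectation (\<lambda>\<omega>. \<bar>mode_variation r p (\<delta> n) t \<omega> - (Gamma (r + 1/2) / (2 * (1/2 - r))) ^ p * t\<bar>)) \<longlonglongrightarrow> 0"
      using 3 by (intro mode_variation_tendsto_constant r dl t p) auto
    then show ?thesis using 3 by (simp add: limit_const_def)
  qed
qed

end


section \<open>From fixed times to the supremum\<close>

text \<open>Turns convergence in mean and a bounded higher moment into convergence of order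
  \<open>q\<close>. Up to \<open>a\<close>, where \<open>a powr q = e\<close>, the constant
  suffices; up to \<open>b\<close> the linear term does; beyond, \<open>e * x \<ge> 1\<close> pays
  for the rounding of \<open>q\<close> to a larger natural power.\<close>

lemma powr_interpolation:
  fixes q e :: real
  assumes q: "0 < q" and e: "0 < e"
  obtains C where "0 \<le> C" "\<And>x. 0 \<le> x \<Longrightarrow> x powr q \<le> e + C * x + e * x ^ (nat \<lceil>q\<rceil> + 1)"
proof -
  define a b C where "a = e powr (1 / q)" and "b = max 1 (1 / e)" and "C = b powr q / a"
  have a: "0 < a" "a powr q = e" using e q by (auto simp: a_def powr_powr)
  have b: "1 \<le> b" "1 / e \<le> b" by (auto simp: b_def)
  have C: "0 \<le> C" using a by (simp add: C_def)
  have "x powr q \<le> e + C * x + e * x ^ (nat \<lceil>q\<rceil> + 1)" if x: "0 \<le> x" for x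
  proof -
    have nn: "0 \<le> C * x" "0 \<le> e * x ^ (nat \<lceil>q\<rceil> + 1)" using C x e by simp_all
    consider "x \<le> a" | "a \<le> x" "x \<le> b" | "b \<le> x" by linarith
    then show ?thesis
    proof cases
      case 1
      have "x powr q \<le> a powr q" using 1 x q by (intro powr_mono2) auto
      then show ?thesis using nn a by linarith
    next
      case 2
      have "x powr q \<le> b powr q" using 2 x q by (intro powr_mono2) auto
      also have "\<dots> = C * a" using a by (simp add: C_def)
      also have "\<dots> \<le> C * x" using 2 C by (intro mult_left_mono)
      finally show ?thesis using nn e by linarith
    next
      case 3
      have x1: "1 \<le> x" "1 / e \<le> x" using 3 b by auto
      have "x powr q \<le> x powr real (nat \<lceil>q\<rceil>)"
        using x1 q by (intro powr_mono) (auto simp: real_nat_ceiling_ge)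
      also have "\<dots> = 1 * x ^ nat \<lceil>q\<rceil>" using x1 by (simp add: powr_realpow)
      also have "\<dots> \<le> (e * x) * x ^ nat \<lceil>q\<rceil>"
        using x1 e by (intro mult_right_mono) (auto simp: divide_le_eq mult.commute)
      finally show ?thesis using nn e by (simp add: mult.assoc)
    qed
  qed
  with C show thesis by (rule that)
qed

text \<open>Between neighbouring grid points a monotone function stays between its values there,
  while the linear limit moves by at most \<open>\<bar>c\<bar> * T / m\<close>. The sum over the
  grid, rather than a maximum, lets expectations be taken term by term.\<close>

lemma monotone_grid_approximation:
  fixes f :: "real \<Rightarrow> real"
  assumes mono: "\<And>s t. 0 \<le> s \<Longrightarrow> s \<le> t \<Longrightarrow> f s \<le> f t" and T: "0 < T" and m: "1 \<le> m"
    and t: "0 \<le> t" "t \<le> T"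
  shows "\<bar>f t - c * t\<bar> \<le>
    (\<Sum>j\<le>m. \<bar>f (real j * T / real m) - c * (real j * T / real m)\<bar>) + \<bar>c\<bar> * T / real m"
proof -
  define g where "g j = real j * T / real m" for j :: nat
  define D where "D = (\<Sum>j\<le>m. \<bar>f (g j) - c * g j\<bar>)"
  have m0: "0 < real m" using m by simp
  have gD: "\<bar>f (g j) - c * g j\<bar> \<le> D" if "j \<le> m" for j
    unfolding D_def using that by (intro member_le_sum) auto
  obtain j where j: "j < m" "g j \<le> t" "t \<le> g (Suc j)"
  proof (cases "t = T")
    \<comment> \<open>At \<open>t = T\<close> the floor would give \<open>j = m\<close>, whose right
      neighbour lies outside the grid.\<close>
    case True
    have "g (m - 1) \<le> t" "t \<le> g (Suc (m - 1))"
      using True T m m0 by (simp_all add: g_def of_nat_diff field_simps)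
    then show thesis using that[of "m - 1"] m by simp
  next
    case False
    define j where "j = nat \<lfloor>t * real m / T\<rfloor>"
    have nn: "0 \<le> t * real m / T" using t T by simp
    have j: "real j \<le> t * real m / T" "t * real m / T < real j + 1" using nn by (auto simp: j_def)
    have "t * real m / T < real m" using False t T m0 by (simp add: divide_less_eq)
    then have "j < m" using j by linarith
    moreover have "g j \<le> t" "t \<le> g (Suc j)"
      using j T m0 by (simp_all add: g_def field_simps)
    ultimately show thesis by (rule that)
  qed
  have gap: "g (Suc j) - g j = T / real m" by (simp add: g_def add_divide_distrib distrib_right)
  have g0: "0 \<le> g j" "0 \<le> g (Suc j)" using T by (simp_all add: g_def)
  have cT: "\<bar>c\<bar> * T / real m = \<bar>c\<bar> * (g (Suc j) - g j)" by (simp add: gap)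
  have up: "f t \<le> f (g (Suc j))" and lo: "f (g j) \<le> f t" using mono j g0 t by auto
  have c1: "\<bar>c * (g (Suc j) - t)\<bar> \<le> \<bar>c\<bar> * (g (Suc j) - g j)"
    unfolding abs_mult using j by (intro mult_left_mono) auto
  have c2: "\<bar>c * (t - g j)\<bar> \<le> \<bar>c\<bar> * (g (Suc j) - g j)"
    unfolding abs_mult using j by (intro mult_left_mono) auto
  have "f t - c * t \<le> (f (g (Suc j)) - c * g (Suc j)) + c * (g (Suc j) - t)"
    using up by (simp add: algebra_simps)
  moreover have "(f (g j) - c * g j) - c * (t - g j) \<le> f t - c * t"
    using lo by (simp add: algebra_simps)
  moreover have "\<bar>f (g (Suc j)) - c * g (Suc j)\<bar> \<le> D" "\<bar>f (g j) - c * g j\<bar> \<le> D"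
    using gD j by auto
  ultimately have "\<bar>f t - c * t\<bar> \<le> D + \<bar>c\<bar> * (g (Suc j) - g j)"
    using c1 c2 by linarith
  then show ?thesis by (simp add: D_def g_def cT)
qed

section \<open>Transfer from the mild solution to its modes, and the supremum over time\<close>

context white_noise
begin

lemma heat_modes_mild_solution:
  assumes u: "mild_solution M W r u"
  shows "heat_modes M {X. \<exists>h. is_wiener_integral M W h X} (\<lambda>t k \<omega>. u t \<omega> (Suc k))"
proof unfold_locales
  fix X Y assume X: "X \<in> {X. \<exists>h. is_wiener_integral M W h X}" and Y: "Y \<in> {X. \<exists>h. is_wiener_integral M W h X}"
  then show "(\<lambda>\<omega>. X \<omega> + Y \<omega>) \<in> {X. \<exists>h. is_wiener_integral M W h X}" using wiener_add by blast
  show "(\<lambda>\<omega>. c * X \<omega>) \<in> {X. \<exists>h. is_wiener_integral M W h X}" for c using X wiener_scale by blast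
  show "centered_gaussian M X" using X wiener_gaussian by blast
next
  have uI: "is_wiener_integral M W (mild_kernel (Suc k) t) (\<lambda>\<omega>. u t \<omega> (Suc k))" if "0 \<le> t" for t k
    using u that by (simp add: mild_solution_def)
  show "(\<lambda>\<omega>. u t \<omega> (Suc k)) \<in> {X. \<exists>h. is_wiener_integral M W h X}" if "0 \<le> t" for t k
    using uI[OF that] by blast
  show "expectation (\<lambda>\<omega>. u s \<omega> (Suc k) * u t \<omega> (Suc l)) =
      (if k = l then (exp (- lam k * (t - s)) - exp (- lam k * (s + t))) / (2 * lam k) else 0)"
    if "0 \<le> s" "s \<le> t" for s t k l
    using wiener_covariance[OF uI uI, of s t k l] mild_kernel_inner_product[of "Suc k" "Suc l" s t] that
    by simp
qed

end

text \<open>For a fixed step the exceptional set comes from countably many increments, so one null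
  set serves all \<open>t\<close> at once. Outside it the series of squares converge and the
  absolute value in \<open>weighted_squares\<close> changes nothing.\<close>

lemma (in heat_modes) power_variation_eq_mode_variation:
  assumes r: "r < 1 / 2" and d: "0 < d" "0 < tau r d" and p: "1 \<le> p"
    and a: "\<And>t k \<omega>. a t k \<omega> = u t \<omega> (Suc k)"
  shows "AE \<omega> in M. \<forall>t. power_variation d r (2 * real p) u t \<omega> = mode_variation r p d t \<omega>"
proof -
  have "AE \<omega> in M. \<forall>i. 1 \<le> i \<longrightarrow> summable (\<lambda>k. lam k powr r / (tau r d)\<^sup>2 * (inc d i k \<omega>)\<^sup>2)"
    unfolding AE_all_countable
    using quadratic_form.AE_summable[OF quadratic_form_inc[OF r d]] by auto
  then show ?thesis
  proof eventually_elim
    case (elim \<omega>)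
    have "(Hnorm r (\<lambda>k. u (real i * d) \<omega> k - u ((real i - 1) * d) \<omega> k) / tau r d) powr (2 * real p) =
        normalized_inc r d i \<omega> ^ p" if i: "1 \<le> i" for i
    proof -
      define s where "s = (\<Sum>k. lam k powr r * (inc d i k \<omega>)\<^sup>2)"
      define x where "x = sqrt s / tau r d"
      have sm': "summable (\<lambda>k. lam k powr r / (tau r d)\<^sup>2 * (inc d i k \<omega>)\<^sup>2)" using elim i by blast
      have "summable (\<lambda>k. (tau r d)\<^sup>2 * (lam k powr r / (tau r d)\<^sup>2 * (inc d i k \<omega>)\<^sup>2))"
        by (intro summable_mult sm')
      then have sm: "summable (\<lambda>k. lam k powr r * (inc d i k \<omega>)\<^sup>2)" using d by simp
      have s0: "0 \<le> s" unfolding s_def by (intro suminf_nonneg sm) auto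
      have "(\<Sum>k. lam k powr r / (tau r d)\<^sup>2 * (inc d i k \<omega>)\<^sup>2) = s / (tau r d)\<^sup>2"
        unfolding s_def suminf_divide[OF sm, symmetric] by (simp add: mult_ac)
      then have Z: "normalized_inc r d i \<omega> = x\<^sup>2"
        using s0 by (simp add: normalized_inc_def weighted_squares_def x_def power_divide)
      have H: "Hnorm r (\<lambda>k. u (real i * d) \<omega> k - u ((real i - 1) * d) \<omega> k) / tau r d = x"
        by (simp add: Hnorm_def x_def s_def inc_def a)
      have x0: "0 \<le> x" using s0 d by (simp add: x_def)
      have "x powr (2 * real p) = (x\<^sup>2) ^ p"
      \<comment> \<open>For a vanishing increment \<open>powr\<close> gives 0, and the natural power
        agrees because \<open>p \<ge> 1\<close>.\<close>
      proof (cases "x = 0")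
        case False
        then have "x powr real (2 * p) = x ^ (2 * p)" using x0 by (intro powr_realpow) auto
        then show ?thesis by (simp add: power_mult)
      qed (use p in simp)
      then show ?thesis by (simp add: H Z)
    qed
    then show ?case by (auto simp: power_variation_def mode_variation_def intro!: sum.cong)
  qed
qed

text \<open>The supremum is dominated almost surely by an integrable \<open>U\<close>, built from
  deviations at finitely many grid points and from the variation at \<open>T\<close>. The comparison
  is one of nonnegative integrals, so it is made directly with the supremum.\<close>

lemma (in heat_modes) power_variation_sup_tendsto:
  assumes r: "r < 1 / 2" and dl: "\<And>n. 0 < \<delta> n" "\<delta> \<longlonglongrightarrow> 0" and p: "1 \<le> p" and q: "0 < q" and T: "0 < T"
    and a: "\<And>t k \<omega>. a t k \<omega> = u t \<omega> (Suc k)"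
  shows "(\<lambda>n. \<integral>\<^sup>+\<omega>. (SUP t\<in>{0..T}.
    ennreal (\<bar>power_variation (\<delta> n) r (2 * real p) u t \<omega> - limit_const r p * t\<bar> powr q)) \<partial>M) \<longlonglongrightarrow> 0"
proof -
  define c where "c = limit_const r p"
  define V where "V n = mode_variation r p (\<delta> n)" for n
  define I where "I n = (\<integral>\<^sup>+\<omega>. (SUP t\<in>{0..T}.
    ennreal (\<bar>power_variation (\<delta> n) r (2 * real p) u t \<omega> - c * t\<bar> powr q)) \<partial>M)" for n
  define m where "m = nat \<lceil>q\<rceil> + 1"
  have d1: "\<forall>\<^sub>F n in sequentially. \<delta> n < 1" using dl(2) by (rule order_tendstoD) simp
  have Vlim: "(\<lambda>n. expectation (\<lambda>\<omega>. \<bar>V n t \<omega> - c * t\<bar>)) \<longlonglongrightarrow> 0" if "0 \<le> t" for t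
    unfolding V_def c_def by (rule mode_variation_tendsto[OF r dl that p])
  from heat_sum_ratio_bounded[OF r dl] obtain A where A: "\<And>n. \<bar>heat_sum r (\<delta> n) / (tau r (\<delta> n))\<^sup>2\<bar> \<le> A" by blast
  \<comment> \<open>Bounds the moment of order \<open>m\<close> of
    \<open>V n T + \<bar>c\<bar> * T\<close> for all large \<open>n\<close>.\<close>
  define R where "R = 2 ^ m * (T ^ m * (gauss_moment (2 * (p * m)) * A ^ (p * m)) + (\<bar>c\<bar> * T) ^ m)"
  have A0: "0 \<le> A" using A[of 0] by linarith
  have R0: "0 \<le> R" unfolding R_def using A0 T gauss_moment_nonneg by simp
  have small: "\<forall>\<^sub>F n in sequentially. I n \<le> ennreal e" if e: "0 < e" for e
  proof -
    \<comment> \<open>Calibrated such that the constant and the moment term of the interpolation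
      together cost \<open>e / 4\<close>; the grid spacing and the expected deviations on the grid
      cost at most as much each. The factor \<open>C\<close> depends on \<open>\<epsilon>\<close>,
      the grid on \<open>C\<close>, and only then does \<open>n\<close> grow.\<close>
    define \<epsilon> where "\<epsilon> = e / (4 * (R + 1))"
    have \<epsilon>: "0 < \<epsilon>" "\<epsilon> + \<epsilon> * R = e / 4"
    proof -
      show "0 < \<epsilon>" using e R0 by (simp add: \<epsilon>_def)
      have "\<epsilon> + \<epsilon> * R = \<epsilon> * (R + 1)" by (simp add: algebra_simps)
      moreover have "e / (4 * y) * y = e / 4" if "y \<noteq> 0" for y using that by simp
      ultimately show "\<epsilon> + \<epsilon> * R = e / 4" using R0 by (simp only: \<epsilon>_def)
    qed
    from powr_interpolation[OF q \<epsilon>(1)] obtain C where C: "0 \<le> C"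
      "\<And>x. 0 \<le> x \<Longrightarrow> x powr q \<le> \<epsilon> + C * x + \<epsilon> * x ^ m"
      unfolding m_def by blast
    obtain N where N: "1 \<le> N" "C * (\<bar>c\<bar> * T / real N) \<le> e / 4"
    proof -
      obtain N :: nat where "C * (\<bar>c\<bar> * T) / (e / 4) < real N" using reals_Archimedean2 by blast
      then have "C * (\<bar>c\<bar> * T) < real (Suc N) * (e / 4)" using e by (simp add: divide_less_eq algebra_simps)
      then have "C * (\<bar>c\<bar> * T / real (Suc N)) \<le> e / 4" by (simp add: divide_le_eq mult.commute del: of_nat_Suc)
      then show thesis using that[of "Suc N"] by simp
    qed
    define t where "t j = real j * T / real N" for j
    have t0: "0 \<le> t j" for j using T by (simp add: t_def)
    define D where "D n \<omega> = (\<Sum>j\<le>N. \<bar>V n (t j) \<omega> - c * t j\<bar>)" for n \<omega>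
    have "(\<lambda>n. C * (\<Sum>j\<le>N. expectation (\<lambda>\<omega>. \<bar>V n (t j) \<omega> - c * t j\<bar>))) \<longlonglongrightarrow> C * (\<Sum>j\<le>N. 0)"
      by (intro tendsto_intros Vlim t0)
    then have "\<forall>\<^sub>F n in sequentially. C * (\<Sum>j\<le>N. expectation (\<lambda>\<omega>. \<bar>V n (t j) \<omega> - c * t j\<bar>)) < e / 4"
      using e by (intro order_tendstoD) auto
    with d1 show "\<forall>\<^sub>F n in sequentially. I n \<le> ennreal e"
    proof eventually_elim
      case (elim n)
      note tp = tau_pos[OF dl(1) elim(1), of r]
      have mV: "has_moments M (V n s)" for s unfolding V_def by (rule mode_variation_moments[OF r dl(1) tp])
      have V0: "0 \<le> V n s \<omega>" for s \<omega> unfolding V_def by (rule mode_variation_nonneg[OF r dl(1) tp])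
      have Vm: "V n s \<omega> \<le> V n s' \<omega>" if "0 \<le> s" "s \<le> s'" for s s' \<omega>
        unfolding V_def by (rule mode_variation_mono[OF r dl(1) tp that])
      \<comment> \<open>The linear term of the interpolation is fed with the grid estimate, which
        becomes small, and the power with the crude bound by the variation at \<open>T\<close>,
        which only stays bounded.\<close>
      define U where "U \<omega> = \<epsilon> + C * (D n \<omega> + \<bar>c\<bar> * T / real N) + \<epsilon> * (V n T \<omega> + \<bar>c\<bar> * T) ^ m" for \<omega>
      have iD: "integrable M (D n)"
        unfolding D_def using has_moments_integrable[OF mV] by (intro Bochner_Integration.integrable_sum) auto
      have mVT: "has_moments M (\<lambda>\<omega>. (V n T \<omega> + \<bar>c\<bar> * T) ^ m)"
        by (intro has_moments_power has_moments_add has_moments_const mV)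
      have iU: "integrable M U"
        unfolding U_def using iD has_moments_integrable[OF mVT] by auto
      have U0: "0 \<le> U \<omega>" for \<omega>
        unfolding U_def D_def using C(1) \<epsilon>(1) T V0
        by (intro add_nonneg_nonneg mult_nonneg_nonneg sum_nonneg zero_le_power divide_nonneg_nonneg) (auto simp: less_imp_le)
      have "I n \<le> (\<integral>\<^sup>+\<omega>. ennreal (U \<omega>) \<partial>M)"
        unfolding I_def
      proof (rule nn_integral_mono_AE)
        show "AE \<omega> in M. (SUP t\<in>{0..T}. ennreal (\<bar>power_variation (\<delta> n) r (2 * real p) u t \<omega> - c * t\<bar> powr q)) \<le> ennreal (U \<omega>)"
          using power_variation_eq_mode_variation[OF r dl(1) tp p a]
        proof eventually_elim
          case (elim \<omega>)
          show ?case
          proof (rule SUP_least)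
            fix s assume "s \<in> {0..T}"
            then have s: "0 \<le> s" "s \<le> T" by auto
            have pv: "power_variation (\<delta> n) r (2 * real p) u s \<omega> = V n s \<omega>" using elim by (simp add: V_def)
            define x where "x = \<bar>V n s \<omega> - c * s\<bar>"
            have x1: "x \<le> D n \<omega> + \<bar>c\<bar> * T / real N"
              unfolding x_def D_def t_def by (rule monotone_grid_approximation[OF Vm T N(1) s])
            have "\<bar>c * s\<bar> \<le> \<bar>c\<bar> * T" unfolding abs_mult using s by (intro mult_left_mono) auto
            then have x2: "x \<le> V n T \<omega> + \<bar>c\<bar> * T"
              using Vm[OF s, of \<omega>] V0[of s \<omega>] unfolding x_def by linarith
            have "x powr q \<le> \<epsilon> + C * x + \<epsilon> * x ^ m" by (rule C(2)) (simp add: x_def)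
            also have "\<dots> \<le> U \<omega>"
              unfolding U_def using C(1) \<epsilon>(1) x1 x2 by (intro add_mono mult_left_mono power_mono) (auto simp: x_def)
            finally show "ennreal (\<bar>power_variation (\<delta> n) r (2 * real p) u s \<omega> - c * s\<bar> powr q) \<le> ennreal (U \<omega>)"
              unfolding pv x_def by (rule ennreal_leI)
          qed
        qed
      qed
      also have "\<dots> = ennreal (expectation U)" using iU U0 by (simp add: nn_integral_eq_integral)
      also have "\<dots> \<le> ennreal e"
      proof (rule ennreal_leI)
        have "expectation (\<lambda>\<omega>. (V n T \<omega> + \<bar>c\<bar> * T) ^ m) \<le> expectation (\<lambda>\<omega>. 2 ^ m * (V n T \<omega> ^ m + (\<bar>c\<bar> * T) ^ m))"
        proof (rule integral_mono)
          fix \<omega>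
          have "(V n T \<omega> + \<bar>c\<bar> * T) ^ m \<le> 2 ^ (m - 1) * (V n T \<omega> ^ m + (\<bar>c\<bar> * T) ^ m)"
            using power_weighted_sum_le[of "{True, False}" m "\<lambda>_. 1" "\<lambda>b. if b then V n T \<omega> else \<bar>c\<bar> * T"] V0 T
            by (simp add: m_def)
          also have "\<dots> \<le> 2 ^ m * (V n T \<omega> ^ m + (\<bar>c\<bar> * T) ^ m)"
            using V0[of T \<omega>] T by (intro mult_right_mono power_increasing) auto
          finally show "(V n T \<omega> + \<bar>c\<bar> * T) ^ m \<le> 2 ^ m * (V n T \<omega> ^ m + (\<bar>c\<bar> * T) ^ m)" .
        qed (use has_moments_integrable[OF mVT] has_moments_integrable_power[OF mV] in auto)
        also have "\<dots> = 2 ^ m * (expectation (\<lambda>\<omega>. V n T \<omega> ^ m) + (\<bar>c\<bar> * T) ^ m)"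
          using has_moments_integrable_power[OF mV, of T m] by (simp add: prob_space)
        also have "\<dots> \<le> R"
        proof -
          have "expectation (\<lambda>\<omega>. V n T \<omega> ^ m) \<le>
              T ^ m * (gauss_moment (2 * (p * m)) * (heat_sum r (\<delta> n) / (tau r (\<delta> n))\<^sup>2) ^ (p * m))"
            unfolding V_def using T by (intro mode_variation_moment_le r dl(1) tp) (auto simp: m_def)
          also have "\<dots> \<le> T ^ m * (gauss_moment (2 * (p * m)) * A ^ (p * m))"
            using A[of n] heat_sum_nonneg[OF r, of "\<delta> n"] dl(1)[of n] T
            by (intro mult_left_mono power_mono gauss_moment_nonneg) auto
          finally show ?thesis unfolding R_def by (intro mult_left_mono) auto
        qed
        finally have mom: "expectation (\<lambda>\<omega>. (V n T \<omega> + \<bar>c\<bar> * T) ^ m) \<le> R" .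
        have ED: "expectation (D n) = (\<Sum>j\<le>N. expectation (\<lambda>\<omega>. \<bar>V n (t j) \<omega> - c * t j\<bar>))"
          unfolding D_def using has_moments_integrable[OF mV] by (intro Bochner_Integration.integral_sum) auto
        have "expectation U = \<epsilon> + C * (expectation (D n) + \<bar>c\<bar> * T / real N) + \<epsilon> * expectation (\<lambda>\<omega>. (V n T \<omega> + \<bar>c\<bar> * T) ^ m)"
          unfolding U_def using iD has_moments_integrable[OF mVT] by (simp add: prob_space)
        also have "\<dots> \<le> \<epsilon> + C * (expectation (D n) + \<bar>c\<bar> * T / real N) + \<epsilon> * R"
          using mom \<epsilon>(1) by (intro add_left_mono mult_left_mono) auto
        also have "\<dots> = e / 4 + C * expectation (D n) + C * (\<bar>c\<bar> * T / real N)"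
          using \<epsilon>(2) by (simp add: distrib_left)
        also have "\<dots> \<le> e" using elim(2) N(2) e unfolding ED by linarith
        finally show "expectation U \<le> e" .
      qed
      finally show ?case .
    qed
  qed
  have "I \<longlonglongrightarrow> 0"
  proof (rule order_tendstoI)
    fix y :: ennreal assume "0 < y"
    then obtain z where z: "0 < z" "z < y" using dense by blast
    then obtain e where e: "z = ennreal e" "0 \<le> e" by (cases z) auto
    then have "0 < e" using z by simp
    from small[OF this] show "\<forall>\<^sub>F n in sequentially. I n < y"
      using z e by (auto elim: eventually_mono)
  qed simp
  then show ?thesis unfolding I_def[abs_def] c_def .
qed

theorem theorem1:
  fixes M :: "'a measure"
    and W :: "(real \<times> real) set \<Rightarrow> 'a \<Rightarrow> real"
    and u :: "real \<Rightarrow> 'a \<Rightarrow> nat \<Rightarrow> real"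
    and \<Delta> :: "nat \<Rightarrow> real"
    and r q T :: real
    and p :: nat
  assumes "prob_space M"
    and "space_time_white_noise M W"
    and "r < 1/2"
    and "mild_solution M W r u"
    and "\<forall>n. 0 < \<Delta> n" and "decseq \<Delta>" and "\<Delta> \<longlonglongrightarrow> 0"
    and "1 \<le> p" and "0 < q" and "0 < T"
  shows "(\<lambda>n. \<integral>\<^sup>+\<omega>. (SUP t\<in>{0..T}.
             ennreal (\<bar>power_variation (\<Delta> n) r (2 * real p) u t \<omega> - limit_const r p * t\<bar> powr q)) \<partial>M)
           \<longlonglongrightarrow> 0"
proof -
  interpret prob_space M by fact
  interpret white_noise M W by unfold_locales fact
  interpret heat_modes M "{X. \<exists>h. is_wiener_integral M W h X}" "\<lambda>t k \<omega>. u t \<omega> (Suc k)"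
    by (rule heat_modes_mild_solution) fact
  show ?thesis
    using assms by (intro power_variation_sup_tendsto) auto
qed

end
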